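(* Let $X$ be a $\sigma$-compact smooth manifold with compact boundary and let $\mathfrak{K}\to X$ be a smooth bundle of Lie algebras whose typical fiber is a compact Lie algebra. Then every bounded projective unitary representation of $\Gamma_c(\mathfrak{K})$ lifts to a bounded unitary representation; i.e., for every continuous Lie algebra homomorphism $\overline{\pi}\colon\Gamma_c(\mathfrak{K})\to\mathfrak{pu}(\mathcal{H})$ there is a continuous Lie algebra homomorphism $\pi\colon\Gamma_c(\mathfrak{K})\to\mathfrak{u}(\mathcal{H})$ whose composition with the quotient map $\mathfrak{u}(\mathcal{H})\to\mathfrak{pu}(\mathcal{H})$ is $\overline{\pi}$.
   Context: A finite-dimensional real Lie algebra is compact if it admits a norm invariant under its adjoint group (it need not be semisimple). $\Gamma(\mathfrak{K})$ is the Lie algebra (pointwise bracket) of sections that are smooth on the interior of $X$ and whose derivatives extend continuously to the boundary, with the smooth compact-open topology; $\Gamma_c(\mathfrak{K})$ is the subalgebra of compactly supported sections with the locally convex direct limit topology of the Fréchet spaces $\{s:\operatorname{supp}(s)\subseteq C\}$, $C\subseteq X$ compact. For a complex Hilbert space $\mathcal{H}$, $\mathfrak{u}(\mathcal{H})$ is the Banach–Lie algebra of bounded skew-hermitian operators and $\mathfrak{pu}(\mathcal{H})=\mathfrak{u}(\mathcal{H})/i\mathbb{R}\mathbf{1}$ with the quotient norm. *)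

theory Defs
  imports "HOL-Analysis.Analysis"
begin

section \<open>Real Lie algebras\<close>

text \<open>Real Lie algebras with explicit carrier, so that fibres of bundles, spaces of sections and
  quotient algebras are instances of one notion, and the zero algebra is included.\<close>

record 'a lie_alg =
  carrier :: "'a set"
  vadd :: "'a \<Rightarrow> 'a \<Rightarrow> 'a"
  vzero :: 'a
  vscale :: "real \<Rightarrow> 'a \<Rightarrow> 'a"
  lbr :: "'a \<Rightarrow> 'a \<Rightarrow> 'a"

locale lie_algebra =
  fixes L :: "'a lie_alg"
  assumes add_closed: "x \<in> carrier L \<Longrightarrow> y \<in> carrier L \<Longrightarrow> vadd L x y \<in> carrier L"
    and zero_closed: "vzero L \<in> carrier L"
    and scale_closed: "x \<in> carrier L \<Longrightarrow> vscale L r x \<in> carrier L"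
    and bracket_closed: "x \<in> carrier L \<Longrightarrow> y \<in> carrier L \<Longrightarrow> lbr L x y \<in> carrier L"
    and add_assoc: "x \<in> carrier L \<Longrightarrow> y \<in> carrier L \<Longrightarrow> z \<in> carrier L \<Longrightarrow>
          vadd L (vadd L x y) z = vadd L x (vadd L y z)"
    and add_commute: "x \<in> carrier L \<Longrightarrow> y \<in> carrier L \<Longrightarrow> vadd L x y = vadd L y x"
    and add_zero: "x \<in> carrier L \<Longrightarrow> vadd L (vzero L) x = x"
    and scale_zero: "x \<in> carrier L \<Longrightarrow> vscale L 0 x = vzero L"
    and scale_one: "x \<in> carrier L \<Longrightarrow> vscale L 1 x = x"
    and scale_scale: "x \<in> carrier L \<Longrightarrow> vscale L r (vscale L t x) = vscale L (r * t) x"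
    and scale_add_right: "x \<in> carrier L \<Longrightarrow> y \<in> carrier L \<Longrightarrow>
          vscale L r (vadd L x y) = vadd L (vscale L r x) (vscale L r y)"
    and scale_add_left: "x \<in> carrier L \<Longrightarrow>
          vscale L (r + t) x = vadd L (vscale L r x) (vscale L t x)"
    and bracket_add: "x \<in> carrier L \<Longrightarrow> y \<in> carrier L \<Longrightarrow> z \<in> carrier L \<Longrightarrow>
          lbr L (vadd L x y) z = vadd L (lbr L x z) (lbr L y z)"
    and bracket_scale: "x \<in> carrier L \<Longrightarrow> y \<in> carrier L \<Longrightarrow>
          lbr L (vscale L r x) y = vscale L r (lbr L x y)"
    and bracket_self: "x \<in> carrier L \<Longrightarrow> lbr L x x = vzero L"
    and jacobi: "x \<in> carrier L \<Longrightarrow> y \<in> carrier L \<Longrightarrow> z \<in> carrier L \<Longrightarrow>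
          vadd L (lbr L x (lbr L y z)) (vadd L (lbr L y (lbr L z x)) (lbr L z (lbr L x y)))
            = vzero L"

definition lie_hom :: "'a lie_alg \<Rightarrow> 'b lie_alg \<Rightarrow> ('a \<Rightarrow> 'b) \<Rightarrow> bool" where
  "lie_hom L M f \<longleftrightarrow>
     f \<in> carrier L \<rightarrow> carrier M \<and>
     (\<forall>x\<in>carrier L. \<forall>y\<in>carrier L. f (vadd L x y) = vadd M (f x) (f y)) \<and>
     (\<forall>r. \<forall>x\<in>carrier L. f (vscale L r x) = vscale M r (f x)) \<and>
     (\<forall>x\<in>carrier L. \<forall>y\<in>carrier L. f (lbr L x y) = lbr M (f x) (f y))"

definition lie_iso :: "'a lie_alg \<Rightarrow> 'b lie_alg \<Rightarrow> ('a \<Rightarrow> 'b) \<Rightarrow> bool" where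
  "lie_iso L M f \<longleftrightarrow> lie_hom L M f \<and> bij_betw f (carrier L) (carrier M)"

definition vdiff :: "'a lie_alg \<Rightarrow> 'a \<Rightarrow> 'a \<Rightarrow> 'a" where
  "vdiff L x y = vadd L x (vscale L (-1) y)"

text \<open>A Lie algebra structure with bracket \<open>br\<close> on a linear subspace \<open>V\<close> of an
  ambient vector space.\<close>

definition subspace_lie :: "'a::real_vector set \<Rightarrow> ('a \<Rightarrow> 'a \<Rightarrow> 'a) \<Rightarrow> 'a lie_alg" where
  "subspace_lie V br = \<lparr>carrier = V, vadd = (+), vzero = 0, vscale = scaleR, lbr = br\<rparr>"

text \<open>The quotient of \<open>L\<close> by an ideal \<open>I\<close>; its elements are the cosets of \<open>I\<close>.\<close>

definition lie_coset :: "'a lie_alg \<Rightarrow> 'a set \<Rightarrow> 'a \<Rightarrow> 'a set" where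
  "lie_coset L I x = vadd L x ` I"

definition lie_quotient :: "'a lie_alg \<Rightarrow> 'a set \<Rightarrow> 'a set lie_alg" where
  "lie_quotient L I =
     \<lparr>carrier = lie_coset L I ` carrier L,
      vadd = (\<lambda>P Q. {vadd L a b |a b. a \<in> P \<and> b \<in> Q}),
      vzero = I,
      vscale = (\<lambda>r P. {vadd L (vscale L r a) i |a i. a \<in> P \<and> i \<in> I}),
      lbr = (\<lambda>P Q. {vadd L (lbr L a b) i |a b i. a \<in> P \<and> b \<in> Q \<and> i \<in> I})\<rparr>"


section \<open>Locally convex topologies\<close>

definition seminorm_on :: "'a lie_alg \<Rightarrow> ('a \<Rightarrow> real) \<Rightarrow> bool" where
  "seminorm_on L p \<longleftrightarrow>
     (\<forall>x\<in>carrier L. 0 \<le> p x) \<and>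
     (\<forall>x\<in>carrier L. \<forall>y\<in>carrier L. p (vadd L x y) \<le> p x + p y) \<and>
     (\<forall>r. \<forall>x\<in>carrier L. p (vscale L r x) = \<bar>r\<bar> * p x)"

definition norm_on :: "'a lie_alg \<Rightarrow> ('a \<Rightarrow> real) \<Rightarrow> bool" where
  "norm_on L p \<longleftrightarrow> seminorm_on L p \<and> (\<forall>x\<in>carrier L. p x = 0 \<longrightarrow> x = vzero L)"

definition seminorm_topology :: "'a lie_alg \<Rightarrow> ('a \<Rightarrow> real) set \<Rightarrow> 'a topology" where
  "seminorm_topology L P = topology (\<lambda>U. U \<subseteq> carrier L \<and>
     (\<forall>x\<in>U. \<exists>F e. finite F \<and> F \<subseteq> P \<and> 0 < e \<and>
        {y \<in> carrier L. \<forall>p\<in>F. p (vdiff L y x) < e} \<subseteq> U))"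

lemma openin_seminorm_topology:
  "openin (seminorm_topology L P) U \<longleftrightarrow> U \<subseteq> carrier L \<and>
     (\<forall>x\<in>U. \<exists>F e. finite F \<and> F \<subseteq> P \<and> 0 < e \<and>
        {y \<in> carrier L. \<forall>p\<in>F. p (vdiff L y x) < e} \<subseteq> U)"
proof -
  define Q where "Q x U \<longleftrightarrow> (\<exists>F e. finite F \<and> F \<subseteq> P \<and> 0 < (e::real) \<and>
        {y \<in> carrier L. \<forall>p\<in>F. p (vdiff L y x) < e} \<subseteq> U)" for x U
  have mono: "Q x V" if "Q x U" "U \<subseteq> V" for x U V
    using that unfolding Q_def by blast
  have int: "Q x (U \<inter> V)" if U: "Q x U" and V: "Q x V" for x U V
  proof -
    obtain F e where F: "finite F" "F \<subseteq> P" "0 < e"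
      "{y \<in> carrier L. \<forall>p\<in>F. p (vdiff L y x) < e} \<subseteq> U"
      using U unfolding Q_def by blast
    obtain G d where G: "finite G" "G \<subseteq> P" "0 < d"
      "{y \<in> carrier L. \<forall>p\<in>G. p (vdiff L y x) < d} \<subseteq> V"
      using V unfolding Q_def by blast
    have "{y \<in> carrier L. \<forall>p\<in>F \<union> G. p (vdiff L y x) < min e d} \<subseteq> U \<inter> V"
      using F(4) G(4) by auto
    then show ?thesis
      unfolding Q_def using F(1-3) G(1-3)
      by (intro exI[of _ "F \<union> G"] exI[of _ "min e d"] conjI) simp_all
  qed
  have "istopology (\<lambda>U. U \<subseteq> carrier L \<and> (\<forall>x\<in>U. Q x U))"
    unfolding istopology_def
  proof (intro conjI allI impI)
    fix S T assume "S \<subseteq> carrier L \<and> (\<forall>x\<in>S. Q x S)" "T \<subseteq> carrier L \<and> (\<forall>x\<in>T. Q x T)"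
    then show "S \<inter> T \<subseteq> carrier L" "\<forall>x\<in>S \<inter> T. Q x (S \<inter> T)"
      using int by auto
  next
    fix \<K> assume *: "\<forall>K\<in>\<K>. K \<subseteq> carrier L \<and> (\<forall>x\<in>K. Q x K)"
    then show "\<Union>\<K> \<subseteq> carrier L" by blast
    show "\<forall>x\<in>\<Union>\<K>. Q x (\<Union>\<K>)"
    proof
      fix x assume "x \<in> \<Union>\<K>"
      then obtain K where K: "K \<in> \<K>" "x \<in> K" by blast
      show "Q x (\<Union>\<K>)"
        by (rule mono[of x K]) (use * K in auto)
    qed
  qed
  then show ?thesis
    unfolding seminorm_topology_def Q_def by (simp only: topology_inverse')
qed

definition locally_convex_topology_on :: "'a lie_alg \<Rightarrow> 'a topology \<Rightarrow> bool" where
  "locally_convex_topology_on L T \<longleftrightarrow>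
     (\<exists>P. (\<forall>p\<in>P. seminorm_on L p) \<and> T = seminorm_topology L P)"

text \<open>The finest locally convex topology on \<open>L\<close> for which the inclusions of all the
  (topologised) subspaces in \<open>\<F>\<close> are continuous: the supremum of all such topologies.\<close>

definition locally_convex_direct_limit :: "'a lie_alg \<Rightarrow> 'a topology set \<Rightarrow> 'a topology" where
  "locally_convex_direct_limit L \<F> = topology_generated_by
     {U. \<exists>T. locally_convex_topology_on L T \<and> (\<forall>S\<in>\<F>. continuous_map S T id) \<and> openin T U}"


section \<open>Compact Lie algebras\<close>

definition exp_ad :: "('a::euclidean_space \<Rightarrow> 'a \<Rightarrow> 'a) \<Rightarrow> 'a \<Rightarrow> 'a \<Rightarrow> 'a" where
  "exp_ad br x y = (\<Sum>n. ((br x ^^ n) y) /\<^sub>R fact n)"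

text \<open>The group generated by \<open>exp (ad x)\<close>; it is closed under inverses because
  \<open>exp (ad (- x))\<close> is inverse to \<open>exp (ad x)\<close>.\<close>

inductive_set adjoint_group ::
    "'a::euclidean_space set \<Rightarrow> ('a \<Rightarrow> 'a \<Rightarrow> 'a) \<Rightarrow> ('a \<Rightarrow> 'a) set"
  for V br where
    one: "id \<in> adjoint_group V br"
  | step: "x \<in> V \<Longrightarrow> g \<in> adjoint_group V br \<Longrightarrow> exp_ad br x \<circ> g \<in> adjoint_group V br"

definition compact_lie_algebra :: "'a::euclidean_space set \<Rightarrow> ('a \<Rightarrow> 'a \<Rightarrow> 'a) \<Rightarrow> bool" where
  "compact_lie_algebra V br \<longleftrightarrow>
     subspace V \<and> lie_algebra (subspace_lie V br) \<and>
     (\<exists>N. norm_on (subspace_lie V br) N \<and> (\<forall>g\<in>adjoint_group V br. \<forall>y\<in>V. N (g y) = N y))"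


section \<open>Manifolds with boundary\<close>

text \<open>The local model for dimension \<open>card B\<close> is the span of a set \<open>B\<close> of coordinate vectors
  (so that dimension \<open>0\<close> is allowed), cut down to a half-space if \<open>b0 \<in> B\<close>. If
  \<open>b0 \<notin> B\<close>, the manifold has no boundary.\<close>

definition half_space :: "'m::euclidean_space set \<Rightarrow> 'm \<Rightarrow> 'm set" where
  "half_space B b0 = {y \<in> span B. b0 \<in> B \<longrightarrow> 0 \<le> y \<bullet> b0}"

definition half_space_interior :: "'m::euclidean_space set \<Rightarrow> 'm \<Rightarrow> 'm set" where
  "half_space_interior B b0 = {y \<in> span B. b0 \<in> B \<longrightarrow> 0 < y \<bullet> b0}"

text \<open>For \<open>S\<close> relatively open in the half-space, \<open>is_jet B b0 S f D\<close> states that \<open>f\<close> is smooth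
  on the interior part of \<open>S\<close>, that \<open>D \<alpha>\<close> is there its iterated partial derivative
  along the list \<open>\<alpha>\<close> of coordinate vectors (head applied last), and that \<open>D \<alpha>\<close> is the
  continuous extension of that derivative to all of \<open>S\<close>. This determines the values of
  \<open>D \<alpha>\<close> on \<open>S\<close> for all \<open>\<alpha> \<in> lists B\<close>, which makes the choice in \<open>jet\<close>
  harmless.\<close>

definition is_jet ::
    "'m::euclidean_space set \<Rightarrow> 'm \<Rightarrow> 'm set \<Rightarrow> ('m \<Rightarrow> 'f::real_normed_vector) \<Rightarrow>
      ('m list \<Rightarrow> 'm \<Rightarrow> 'f) \<Rightarrow> bool" where
  "is_jet B b0 S f D \<longleftrightarrow>
     (\<forall>y\<in>S. D [] y = f y) \<and>
     (\<forall>\<alpha>\<in>lists B. continuous_on S (D \<alpha>)) \<and>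
     (\<forall>\<alpha>\<in>lists B. \<forall>b\<in>B. \<forall>y\<in>S \<inter> half_space_interior B b0.
        ((\<lambda>t. D \<alpha> (y + t *\<^sub>R b)) has_vector_derivative D (b # \<alpha>) y) (at 0))"

definition smooth_on ::
    "'m::euclidean_space set \<Rightarrow> 'm \<Rightarrow> 'm set \<Rightarrow> ('m \<Rightarrow> 'f::real_normed_vector) \<Rightarrow> bool" where
  "smooth_on B b0 S f \<longleftrightarrow> (\<exists>D. is_jet B b0 S f D)"

definition jet ::
    "'m::euclidean_space set \<Rightarrow> 'm \<Rightarrow> 'm set \<Rightarrow> ('m \<Rightarrow> 'f::real_normed_vector) \<Rightarrow>
      'm list \<Rightarrow> 'm \<Rightarrow> 'f" where
  "jet B b0 S f = (SOME D. is_jet B b0 S f D)"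

locale smooth_manifold =
  fixes X :: "'x topology"
    and B :: "'m::euclidean_space set" and b0 :: 'm
    and atlas :: "('x set \<times> ('x \<Rightarrow> 'm)) set"
  assumes coordinates: "B \<subseteq> Basis"
    and hausdorff: "Hausdorff_space X"
    and chart_domain: "(U, \<phi>) \<in> atlas \<Longrightarrow> openin X U"
    and chart_range: "(U, \<phi>) \<in> atlas \<Longrightarrow> openin (top_of_set (half_space B b0)) (\<phi> ` U)"
    and chart_homeomorphism: "(U, \<phi>) \<in> atlas \<Longrightarrow>
          homeomorphic_map (subtopology X U) (top_of_set (\<phi> ` U)) \<phi>"
    and charts_cover: "(\<Union>(U, \<phi>)\<in>atlas. U) = topspace X"
    and charts_compatible: "(U, \<phi>) \<in> atlas \<Longrightarrow> (V, \<psi>) \<in> atlas \<Longrightarrow>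
          smooth_on B b0 (\<phi> ` (U \<inter> V)) (\<psi> \<circ> inv_into U \<phi>)"

definition manifold_boundary ::
    "'m::euclidean_space set \<Rightarrow> 'm \<Rightarrow> ('x set \<times> ('x \<Rightarrow> 'm)) set \<Rightarrow> 'x set" where
  "manifold_boundary B b0 atlas =
     {x. b0 \<in> B \<and> (\<exists>(U, \<phi>)\<in>atlas. x \<in> U \<and> \<phi> x \<bullet> b0 = 0)}"

definition sigma_compact_space :: "'x topology \<Rightarrow> bool" where
  "sigma_compact_space X \<longleftrightarrow>
     (\<exists>C :: nat \<Rightarrow> 'x set. (\<forall>n. compactin X (C n)) \<and> (\<Union>n. C n) = topspace X)"


section \<open>Bundles of Lie algebras and their sections\<close>

text \<open>A bundle is given by its fibres \<open>K x\<close> and an atlas of local trivialisations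
  \<open>(W, \<Phi>)\<close>, where \<open>\<Phi> x\<close> identifies \<open>K x\<close> with the typical fibre for \<open>x \<in> W\<close>.
  The total space is the disjoint union of the fibres, with the smooth structure for which the
  trivialisations are diffeomorphisms. As transition maps are fibrewise linear, their smoothness
  can be tested on one vector of the typical fibre at a time.\<close>

locale lie_algebra_bundle = smooth_manifold X B b0 atlas
  for X :: "'x topology" and B :: "'m::euclidean_space set" and b0 :: 'm
    and atlas :: "('x set \<times> ('x \<Rightarrow> 'm)) set" +
  fixes K :: "'x \<Rightarrow> 'v lie_alg"
    and \<kk> :: "'k::euclidean_space set" and br :: "'k \<Rightarrow> 'k \<Rightarrow> 'k"
    and trivs :: "('x set \<times> ('x \<Rightarrow> 'v \<Rightarrow> 'k)) set"
  assumes typical_fibre_subspace: "subspace \<kk>"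
    and typical_fibre_lie: "lie_algebra (subspace_lie \<kk> br)"
    and fibre_lie: "x \<in> topspace X \<Longrightarrow> lie_algebra (K x)"
    and triv_domain: "(W, \<Phi>) \<in> trivs \<Longrightarrow> openin X W"
    and trivs_cover: "(\<Union>(W, \<Phi>)\<in>trivs. W) = topspace X"
    and triv_iso: "(W, \<Phi>) \<in> trivs \<Longrightarrow> x \<in> W \<Longrightarrow> lie_iso (K x) (subspace_lie \<kk> br) (\<Phi> x)"
    and trivs_compatible:
      "(W, \<Phi>) \<in> trivs \<Longrightarrow> (W', \<Psi>) \<in> trivs \<Longrightarrow> (U, \<phi>) \<in> atlas \<Longrightarrow> v \<in> \<kk> \<Longrightarrow>
        smooth_on B b0 (\<phi> ` (U \<inter> W \<inter> W'))
          (\<lambda>y. let x = inv_into U \<phi> y in \<Psi> x (inv_into (carrier (K x)) (\<Phi> x) v))"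

definition local_rep ::
    "'x set \<times> ('x \<Rightarrow> 'm) \<Rightarrow> 'x set \<times> ('x \<Rightarrow> 'v \<Rightarrow> 'k) \<Rightarrow> ('x \<Rightarrow> 'v) \<Rightarrow> 'm \<Rightarrow> 'k" where
  "local_rep c t s = (case (c, t) of ((U, \<phi>), (W, \<Phi>)) \<Rightarrow>
     (\<lambda>y. let x = inv_into U \<phi> y in \<Phi> x (s x)))"

definition local_dom ::
    "'x set \<times> ('x \<Rightarrow> 'm) \<Rightarrow> 'x set \<times> ('x \<Rightarrow> 'v \<Rightarrow> 'k) \<Rightarrow> 'm set" where
  "local_dom c t = (case (c, t) of ((U, \<phi>), (W, \<Phi>)) \<Rightarrow> \<phi> ` (U \<inter> W))"

definition sections ::
    "'x topology \<Rightarrow> 'm::euclidean_space set \<Rightarrow> 'm \<Rightarrow> ('x set \<times> ('x \<Rightarrow> 'm)) set \<Rightarrow>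
      ('x \<Rightarrow> 'v lie_alg) \<Rightarrow> ('x set \<times> ('x \<Rightarrow> 'v \<Rightarrow> 'k::euclidean_space)) set \<Rightarrow>
      ('x \<Rightarrow> 'v) lie_alg" where
  "sections X B b0 atlas K trivs =
     \<lparr>carrier = {s \<in> \<Pi>\<^sub>E x\<in>topspace X. carrier (K x).
        \<forall>c\<in>atlas. \<forall>t\<in>trivs. smooth_on B b0 (local_dom c t) (local_rep c t s)},
      vadd = (\<lambda>s t. \<lambda>x\<in>topspace X. vadd (K x) (s x) (t x)),
      vzero = (\<lambda>x\<in>topspace X. vzero (K x)),
      vscale = (\<lambda>r s. \<lambda>x\<in>topspace X. vscale (K x) r (s x)),
      lbr = (\<lambda>s t. \<lambda>x\<in>topspace X. lbr (K x) (s x) (t x))\<rparr>"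

text \<open>Smooth compact-open topology: uniform convergence of all derivatives on compact sets,
  each contained in the domain of a chart and a trivialisation. Empty sets are excluded since
  \<open>Sup {}\<close> is unspecified for reals.\<close>

definition section_seminorms ::
    "'x topology \<Rightarrow> 'm::euclidean_space set \<Rightarrow> 'm \<Rightarrow> ('x set \<times> ('x \<Rightarrow> 'm)) set \<Rightarrow>
      ('x set \<times> ('x \<Rightarrow> 'v \<Rightarrow> 'k::euclidean_space)) set \<Rightarrow> (('x \<Rightarrow> 'v) \<Rightarrow> real) set" where
  "section_seminorms X B b0 atlas trivs =
     {(\<lambda>s. SUP x\<in>C. norm (jet B b0 (local_dom (U, \<phi>) (W, \<Phi>))
              (local_rep (U, \<phi>) (W, \<Phi>) s) \<alpha> (\<phi> x)))
      |U \<phi> W \<Phi> C \<alpha>. (U, \<phi>) \<in> atlas \<and> (W, \<Phi>) \<in> trivs \<and>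
         compactin X C \<and> C \<noteq> {} \<and> C \<subseteq> U \<inter> W \<and> \<alpha> \<in> lists B}"

definition sections_topology ::
    "'x topology \<Rightarrow> 'm::euclidean_space set \<Rightarrow> 'm \<Rightarrow> ('x set \<times> ('x \<Rightarrow> 'm)) set \<Rightarrow>
      ('x \<Rightarrow> 'v lie_alg) \<Rightarrow> ('x set \<times> ('x \<Rightarrow> 'v \<Rightarrow> 'k::euclidean_space)) set \<Rightarrow>
      ('x \<Rightarrow> 'v) topology" where
  "sections_topology X B b0 atlas K trivs =
     seminorm_topology (sections X B b0 atlas K trivs) (section_seminorms X B b0 atlas trivs)"

definition section_support ::
    "'x topology \<Rightarrow> ('x \<Rightarrow> 'v lie_alg) \<Rightarrow> ('x \<Rightarrow> 'v) \<Rightarrow> 'x set" where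
  "section_support X K s = X closure_of {x \<in> topspace X. s x \<noteq> vzero (K x)}"

definition compact_sections ::
    "'x topology \<Rightarrow> 'm::euclidean_space set \<Rightarrow> 'm \<Rightarrow> ('x set \<times> ('x \<Rightarrow> 'm)) set \<Rightarrow>
      ('x \<Rightarrow> 'v lie_alg) \<Rightarrow> ('x set \<times> ('x \<Rightarrow> 'v \<Rightarrow> 'k::euclidean_space)) set \<Rightarrow>
      ('x \<Rightarrow> 'v) lie_alg" where
  "compact_sections X B b0 atlas K trivs =
     (let \<Gamma> = sections X B b0 atlas K trivs in
      \<Gamma>\<lparr>carrier := {s \<in> carrier \<Gamma>. compactin X (section_support X K s)}\<rparr>)"

definition compact_sections_topology ::
    "'x topology \<Rightarrow> 'm::euclidean_space set \<Rightarrow> 'm \<Rightarrow> ('x set \<times> ('x \<Rightarrow> 'm)) set \<Rightarrow>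
      ('x \<Rightarrow> 'v lie_alg) \<Rightarrow> ('x set \<times> ('x \<Rightarrow> 'v \<Rightarrow> 'k::euclidean_space)) set \<Rightarrow>
      ('x \<Rightarrow> 'v) topology" where
  "compact_sections_topology X B b0 atlas K trivs =
     locally_convex_direct_limit (compact_sections X B b0 atlas K trivs)
       {subtopology (sections_topology X B b0 atlas K trivs)
          {s \<in> carrier (sections X B b0 atlas K trivs). section_support X K s \<subseteq> C}
        |C. compactin X C}"


section \<open>Unitary and projective unitary Lie algebras\<close>

class complex_hilbert_space = banach +
  fixes scaleC :: "complex \<Rightarrow> 'a \<Rightarrow> 'a" (infixr \<open>*\<^sub>C\<close> 75)
    and cinner :: "'a \<Rightarrow> 'a \<Rightarrow> complex"
  assumes scaleC_of_real: "complex_of_real r *\<^sub>C x = r *\<^sub>R x"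
    and scaleC_add_left: "(a + b) *\<^sub>C x = a *\<^sub>C x + b *\<^sub>C x"
    and scaleC_add_right: "a *\<^sub>C (x + y) = a *\<^sub>C x + a *\<^sub>C y"
    and scaleC_scaleC: "a *\<^sub>C b *\<^sub>C x = (a * b) *\<^sub>C x"
    and cinner_add_right: "cinner x (y + z) = cinner x y + cinner x z"
    and cinner_scaleC_right: "cinner x (a *\<^sub>C y) = a * cinner x y"
    and cinner_commute: "cinner x y = cnj (cinner y x)"
    and cinner_self: "cinner x x = complex_of_real ((norm x)\<^sup>2)"

instantiation complex :: complex_hilbert_space
begin
definition scaleC_complex :: "complex \<Rightarrow> complex \<Rightarrow> complex" where "scaleC_complex a x = a * x"
definition cinner_complex :: "complex \<Rightarrow> complex \<Rightarrow> complex" where "cinner_complex x y = cnj x * y"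
instance
proof
  fix x :: complex
  show "cinner x x = complex_of_real ((norm x)\<^sup>2)"
    unfolding cinner_complex_def complex_norm_square by (simp add: mult.commute)
qed (simp_all add: scaleC_complex_def cinner_complex_def scaleR_conv_of_real algebra_simps)
end

definition unitary_lie :: "('h::complex_hilbert_space \<Rightarrow>\<^sub>L 'h) lie_alg" where
  "unitary_lie =
     \<lparr>carrier = {A. (\<forall>a x. blinfun_apply A (a *\<^sub>C x) = a *\<^sub>C blinfun_apply A x) \<and>
                   (\<forall>x y. cinner (blinfun_apply A x) y = - cinner x (blinfun_apply A y))},
      vadd = (+), vzero = 0, vscale = scaleR, lbr = (\<lambda>A B. (A o\<^sub>L B) - (B o\<^sub>L A))\<rparr>"

definition unitary_topology :: "('h::complex_hilbert_space \<Rightarrow>\<^sub>L 'h) topology" where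
  "unitary_topology = seminorm_topology unitary_lie {norm}"

text \<open>The ideal \<open>\<i>\<real>\<one>\<close>.\<close>

definition imaginary_scalars :: "('h::complex_hilbert_space \<Rightarrow>\<^sub>L 'h) set" where
  "imaginary_scalars = {A. \<exists>r::real. \<forall>x. blinfun_apply A x = (\<i> * complex_of_real r) *\<^sub>C x}"

definition proj_unitary_lie :: "('h::complex_hilbert_space \<Rightarrow>\<^sub>L 'h) set lie_alg" where
  "proj_unitary_lie = lie_quotient unitary_lie imaginary_scalars"

definition proj_unitary_quotient_map ::
    "('h::complex_hilbert_space \<Rightarrow>\<^sub>L 'h) \<Rightarrow> ('h \<Rightarrow>\<^sub>L 'h) set" where
  "proj_unitary_quotient_map = lie_coset unitary_lie imaginary_scalars"

definition quotient_norm :: "('h::complex_hilbert_space \<Rightarrow>\<^sub>L 'h) set \<Rightarrow> real" where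
  "quotient_norm P = (INF A\<in>P. norm A)"

definition proj_unitary_topology :: "('h::complex_hilbert_space \<Rightarrow>\<^sub>L 'h) set topology" where
  "proj_unitary_topology = seminorm_topology proj_unitary_lie {quotient_norm}"

definition continuous_lie_hom ::
    "'a lie_alg \<Rightarrow> 'a topology \<Rightarrow> 'b lie_alg \<Rightarrow> 'b topology \<Rightarrow> ('a \<Rightarrow> 'b) \<Rightarrow> bool" where
  "continuous_lie_hom L S M T f \<longleftrightarrow> lie_hom L M f \<and> continuous_map S T f"

end

theory Submission
  imports Defs
begin

text \<open>
  For sections \<open>s\<close>, \<open>t\<close> choose skew-hermitian representatives \<open>A\<^sub>s\<close>, \<open>A\<^sub>t\<close> of their images. The commutator
  \<open>[A\<^sub>s, A\<^sub>t]\<close> does not depend on the choices, so it is a bilinear, skew operator-valued form, and it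
  vanishes on commuting sections because a nonzero scalar is never a commutator of bounded operators
  (Wielandt). In particular it is local, and over a trivializing patch, where a section is a smooth
  function with values in the compact fibre algebra, a Casimir element of the fibre (Whitehead's
  argument) yields a linear map on operators which vanishes on scalars and reproduces the commutators.
  Cutting off by bump functions, these maps add up to a map \<open>\<Lambda>\<^sub>C\<close> for every compact set \<open>C\<close>, and
  \<open>\<Lambda>\<^sub>C A\<^sub>s\<close> is independent of \<open>C\<close>. It lifts the part of \<open>s\<close> in the commutator algebra; on the
  complement, where all commutators vanish, any bounded linear section of the quotient by the scalars
  will do. Since the resulting lift is bounded by a multiple of the quotient norm on the sections
  supported in \<open>C\<close>, it is continuous for the direct limit topology.
\<close>

section \<open>Invariant forms on compact Lie algebras\<close>

text \<open>A choice of representatives fails to be a homomorphism by a scalar-valued cocycle, and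
  algebras of smooth functions with values in a Lie algebra can have nontrivial ones: a symmetric
  invariant form \<kappa> gives \<kappa>(T, S) f dg. Boundedness is what excludes them. Since the
  commutator form vanishes on the sections f T and g T, it is skew in the constant vectors; with the
  cocycle identity this makes it depend on f and g only through their product. What remains is a
  cocycle of the fibre that vanishes on the centre, and such a cocycle is a coboundary. Double
  commutators fit the problem because they annihilate scalars: applied to an undetermined
  representative they return a determined operator, so the scalar is fixed without solving a global
  equation. The fibre need not be semisimple, so the Killing form may be degenerate; the inner
  product behind the Casimir element is obtained from the invariant norm by minimisation. The same
  norm supplies the linearity of the bracket in its second argument, which is not among the axioms
  of \<open>lie_algebra\<close>.\<close>

lemma form_orthonormal_basis:
  fixes Q :: "'k::euclidean_space \<Rightarrow> 'k \<Rightarrow> real"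
  assumes bil: "bilinear Q" and sym: "\<And>x y. Q x y = Q y x" and pos: "\<And>x. x \<noteq> 0 \<Longrightarrow> 0 < Q x x"
  obtains E where "finite E" "\<And>e f. e \<in> E \<Longrightarrow> f \<in> E \<Longrightarrow> Q e f = (if e = f then 1 else 0)"
    "\<And>x. x = (\<Sum>e\<in>E. Q x e *\<^sub>R e)"
proof -
  define ok where "ok E \<longleftrightarrow> finite E \<and> (\<forall>e\<in>E. \<forall>f\<in>E. Q e f = (if e = f then 1 else 0))" for E
  have lin: "linear (\<lambda>x. Q x y)" for y using bil by (simp add: bilinear_def)
  have Qsum: "Q (\<Sum>e\<in>E. u e *\<^sub>R e) f = (\<Sum>e\<in>E. u e * Q e f)" for E u f
    by (subst linear_sum[OF lin], subst linear_cmul[OF lin]) simp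
  have Qcoeff: "Q (\<Sum>e\<in>E. u e *\<^sub>R e) f = u f" if "ok E" "f \<in> E" for E u f
  proof -
    have "(\<Sum>e\<in>E. u e * Q e f) = (\<Sum>e\<in>E. if e = f then u e else 0)"
      by (rule sum.cong) (use that in \<open>auto simp: ok_def\<close>)
    then show ?thesis using that by (simp add: Qsum ok_def)
  qed
  have indep: "independent E" if "ok E" for E
  proof -
    have "finite E" using that by (simp add: ok_def)
    then show ?thesis
      unfolding independent_explicit
    proof (intro conjI allI impI ballI)
      fix u e assume "(\<Sum>v\<in>E. u v *\<^sub>R v) = 0" "e \<in> E"
      then show "u e = 0" using Qcoeff[OF that \<open>e \<in> E\<close>, of u] linear_0[OF lin[of e]] by simp
    qed
  qed
  \<comment> \<open>Independence bounds the size of orthonormal systems, so one of maximal size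
    exists.\<close>
  have "\<forall>E. ok E \<longrightarrow> card E < Suc DIM('k)"
    using indep independent_bound by (metis less_Suc_eq_le)
  moreover have "ok {}" by (simp add: ok_def)
  ultimately have "\<exists>E. ok E \<and> (\<forall>F. ok F \<longrightarrow> card F \<le> card E)"
    by (intro ex_has_greatest_nat)
  then obtain E where E: "ok E" and max: "\<And>F. ok F \<Longrightarrow> card F \<le> card E"
    by blast
  have "x = (\<Sum>e\<in>E. Q x e *\<^sub>R e)" for x
  proof (rule ccontr)
    \<comment> \<open>A nonzero residual is orthogonal to \<open>E\<close>, and normalising it would
      give a larger system.\<close>
    define r where "r = x - (\<Sum>e\<in>E. Q x e *\<^sub>R e)"
    assume "x \<noteq> (\<Sum>e\<in>E. Q x e *\<^sub>R e)"
    then have r: "0 < Q r r" using pos[of r] by (simp add: r_def)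
    have rE: "Q r f = 0" if "f \<in> E" for f
      using Qcoeff[OF E that, of "Q x"] by (simp add: r_def linear_diff[OF lin[of f]])
    define s where "s = (1 / sqrt (Q r r)) *\<^sub>R r"
    have sE: "Q s f = 0" "Q f s = 0" if "f \<in> E" for f
      using rE[OF that] sym[of f s] by (simp_all add: s_def linear_cmul[OF lin[of f]])
    have "Q s s = (1 / sqrt (Q r r)) * ((1 / sqrt (Q r r)) * Q r r)"
      by (simp add: s_def bilinear_lmul[OF bil] bilinear_rmul[OF bil])
    then have ss: "Q s s = 1" using r by (simp add: divide_simps)
    then have "s \<notin> E" using sE(1)[of s] by auto
    have "ok (insert s E)" using E sE ss by (auto simp: ok_def)
    from max[OF this] show False using \<open>s \<notin> E\<close> E by (simp add: ok_def)
  qed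
  then show ?thesis using that[of E] E by (auto simp: ok_def)
qed

section \<open>The Casimir operator of an invariant inner product\<close>

locale invariant_lie_form =
  fixes br :: "'k::euclidean_space \<Rightarrow> 'k \<Rightarrow> 'k" and Q :: "'k \<Rightarrow> 'k \<Rightarrow> real"
  assumes br_bil: "bilinear br" and br_self: "br x x = 0"
    and br_jacobi: "br x (br y z) = br (br x y) z + br y (br x z)"
    and Q_bil: "bilinear Q" and Q_sym: "Q x y = Q y x" and Q_pos: "x \<noteq> 0 \<Longrightarrow> 0 < Q x x"
    and Q_inv: "Q (br x y) z = - Q y (br x z)"
begin

lemmas br_simps = bilinear_ladd[OF br_bil] bilinear_radd[OF br_bil] bilinear_lsub[OF br_bil]
  bilinear_rsub[OF br_bil] bilinear_lmul[OF br_bil] bilinear_rmul[OF br_bil] bilinear_lneg[OF br_bil]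
  bilinear_rneg[OF br_bil] bilinear_lzero[OF br_bil] bilinear_rzero[OF br_bil]

lemmas Q_simps = bilinear_ladd[OF Q_bil] bilinear_radd[OF Q_bil] bilinear_lsub[OF Q_bil]
  bilinear_rsub[OF Q_bil] bilinear_lmul[OF Q_bil] bilinear_rmul[OF Q_bil] bilinear_lneg[OF Q_bil]
  bilinear_rneg[OF Q_bil] bilinear_lzero[OF Q_bil] bilinear_rzero[OF Q_bil]

lemma linear_br: "linear (br x)" "linear (\<lambda>x. br x y)"
  using br_bil by (simp_all add: bilinear_def)

lemma linear_Q: "linear (Q x)" "linear (\<lambda>x. Q x y)"
  using Q_bil by (simp_all add: bilinear_def)

lemma br_skew: "br x y = - br y x"
proof -
  have "br (x + y) (x + y) = br x y + br y x"
    unfolding bilinear_ladd[OF br_bil] bilinear_radd[OF br_bil] by (simp add: br_self)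
  then show ?thesis by (simp add: br_self eq_neg_iff_add_eq_0)
qed

lemma Q_eq_0: "(\<And>w. Q x w = 0) \<Longrightarrow> x = 0"
  by (metis Q_pos less_irrefl)

lemma Q_eqI: "(\<And>w. Q x w = Q y w) \<Longrightarrow> x = y"
  using Q_eq_0[of "x - y"] by (simp add: Q_simps)

definition onb :: "'k set" where
  "onb = (SOME E. finite E \<and> (\<forall>e\<in>E. \<forall>f\<in>E. Q e f = (if e = f then 1 else 0)) \<and>
     (\<forall>x. x = (\<Sum>e\<in>E. Q x e *\<^sub>R e)))"

lemma onb: "finite onb" "\<And>e f. e \<in> onb \<Longrightarrow> f \<in> onb \<Longrightarrow> Q e f = (if e = f then 1 else 0)"
    "\<And>x. x = (\<Sum>e\<in>onb. Q x e *\<^sub>R e)"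
proof -
  have "\<exists>E. finite E \<and> (\<forall>e\<in>E. \<forall>f\<in>E. Q e f = (if e = f then 1 else 0)) \<and>
     (\<forall>x. x = (\<Sum>e\<in>E. Q x e *\<^sub>R e))"
    by (rule form_orthonormal_basis[OF Q_bil Q_sym Q_pos]) blast+
  from someI_ex[OF this, folded onb_def]
  show "finite onb" "\<And>e f. e \<in> onb \<Longrightarrow> f \<in> onb \<Longrightarrow> Q e f = (if e = f then 1 else 0)"
    "\<And>x. x = (\<Sum>e\<in>onb. Q x e *\<^sub>R e)" by blast+
qed

lemma linear_onb:
  assumes "linear h"
  shows "h x = (\<Sum>e\<in>onb. Q x e *\<^sub>R h e)"
proof -
  have "h (\<Sum>e\<in>onb. Q x e *\<^sub>R e) = (\<Sum>e\<in>onb. Q x e *\<^sub>R h e)"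
    by (simp add: linear_sum[OF assms] linear_cmul[OF assms])
  then show ?thesis by (simp only: onb(3)[symmetric])
qed

text \<open>The tensor \<Sum> e \<otimes> e over an orthonormal basis is invariant under every
  \<open>Q\<close>-skew map, here \<open>br y\<close>; \<open>M\<close> evaluates this invariance.
  It serves as summation by parts below.\<close>

lemma skew_trace:
  assumes M: "bilinear M"
  shows "(\<Sum>e\<in>onb. M (br y e) e + M e (br y e)) = (0::real)"
proof -
  have "(\<Sum>e\<in>onb. M (br y e) e) = (\<Sum>e\<in>onb. \<Sum>f\<in>onb. Q (br y e) f * M f e)"
  proof (rule sum.cong[OF refl])
    fix e
    show "M (br y e) e = (\<Sum>f\<in>onb. Q (br y e) f * M f e)"
      using linear_onb[of "\<lambda>x. M x e" "br y e"] M by (simp add: bilinear_def)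
  qed
  moreover have "(\<Sum>e\<in>onb. M e (br y e)) = (\<Sum>e\<in>onb. \<Sum>f\<in>onb. Q (br y e) f * M e f)"
  proof (rule sum.cong[OF refl])
    fix e
    show "M e (br y e) = (\<Sum>f\<in>onb. Q (br y e) f * M e f)"
      using linear_onb[of "M e" "br y e"] M by (simp add: bilinear_def)
  qed
  moreover have "(\<Sum>e\<in>onb. \<Sum>f\<in>onb. Q (br y e) f * M e f) = (\<Sum>e\<in>onb. \<Sum>f\<in>onb. - (Q (br y e) f * M f e))"
  proof -
    have sk: "Q (br y f) e = - Q (br y e) f" for e f
      by (subst Q_inv, subst Q_sym) simp
    show ?thesis by (subst sum.swap, intro sum.cong refl, subst sk) simp
  qed
  ultimately show ?thesis by (simp add: sum.distrib sum_negf)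
qed

definition cas :: "'k \<Rightarrow> 'k" where "cas x = (\<Sum>e\<in>onb. br e (br e x))"

lemma linear_cas: "linear cas"
  unfolding cas_def
  by (intro linear_compose_sum ballI linear_compose[unfolded o_def, OF linear_br(1) linear_br(1)])

text \<open>Invariance moves one \<open>br e\<close> across \<open>Q\<close>. The result shows that
  \<open>cas\<close> is symmetric and negative semidefinite, and it determines the kernel.\<close>

lemma Q_cas: "Q (cas x) w = - (\<Sum>e\<in>onb. Q (br x e) (br w e))"
proof -
  have "Q (cas x) w = (\<Sum>e\<in>onb. Q (br e (br e x)) w)"
    unfolding cas_def by (rule linear_sum[OF linear_Q(2)])
  also have "\<dots> = (\<Sum>e\<in>onb. - Q (br x e) (br w e))"
  proof (rule sum.cong[OF refl])
    fix e show "Q (br e (br e x)) w = - Q (br x e) (br w e)"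
      by (subst Q_inv, subst br_skew[of e x], subst br_skew[of e w]) (simp add: Q_simps)
  qed
  finally show ?thesis by (simp add: sum_negf)
qed

lemma Q_cas_sym: "Q (cas x) y = Q x (cas y)"
proof -
  have "Q (cas x) y = - (\<Sum>e\<in>onb. Q (br y e) (br x e))" by (subst Q_cas, subst Q_sym) simp
  also have "\<dots> = Q x (cas y)" unfolding Q_cas[symmetric] by (rule Q_sym)
  finally show ?thesis .
qed

text \<open>By \<open>Q_cas\<close>, \<open>Q (cas x) x\<close> is minus a sum of squares of the
  vectors \<open>br x e\<close>, so the kernel of \<open>cas\<close> is the centre.\<close>

lemma cas_eq_0: "cas x = 0 \<longleftrightarrow> (\<forall>y. br x y = 0)"
proof
  assume "cas x = 0"
  then have "(\<Sum>e\<in>onb. Q (br x e) (br x e)) = 0" using Q_cas[of x x] by (simp add: bilinear_lzero[OF Q_bil])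
  moreover have nn: "0 \<le> Q z z" for z using Q_pos[of z] by (cases "z = 0") (simp_all add: bilinear_lzero[OF Q_bil])
  ultimately have "\<forall>e\<in>onb. Q (br x e) (br x e) = 0"
    using onb(1) by (simp add: sum_nonneg_eq_0_iff)
  then have *: "\<forall>e\<in>onb. br x e = 0" by (metis Q_pos less_irrefl)
  show "\<forall>y. br x y = 0"
  proof
    fix y
    show "br x y = 0" using linear_onb[OF linear_br(1), of x y] * by simp
  qed
next
  assume "\<forall>y. br x y = 0"
  then have "\<forall>e. br e x = 0" by (metis br_skew neg_equal_0_iff_equal)
  then show "cas x = 0" by (simp add: cas_def br_simps)
qed

text \<open>Expanding both sides with \<open>Q_cas\<close> and Jacobi leaves a difference that is
  the skew trace of the form \<open>M\<close>.\<close>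

lemma cas_br: "cas (br y x) = br y (cas x)"
proof (rule Q_eqI)
  fix w
  have M: "bilinear (\<lambda>u v. Q (br x u) (br w v))"
    unfolding bilinear_def
    using linear_compose[OF linear_br(1) linear_Q(1), unfolded o_def]
      linear_compose[OF linear_br(1) linear_Q(2), unfolded o_def] by blast
  have "Q (br y (cas x)) w = (\<Sum>e\<in>onb. Q (br x e) (br (br y w) e))"
    by (subst Q_inv) (simp add: Q_cas)
  also have "\<dots> = (\<Sum>e\<in>onb. Q (br x e) (br y (br w e)) - Q (br x e) (br w (br y e)))"
    by (simp add: br_jacobi[of y w] Q_simps)
  finally have 1: "Q (br y (cas x)) w = \<dots>" .
  have "Q (cas (br y x)) w = - (\<Sum>e\<in>onb. Q (br (br y x) e) (br w e))" by (rule Q_cas)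
  also have "\<dots> = (\<Sum>e\<in>onb. Q (br x (br y e)) (br w e) + Q (br x e) (br y (br w e)))"
    unfolding sum_negf[symmetric]
  proof (rule sum.cong[OF refl])
    fix e
    have "Q (br (br y x) e) (br w e) = Q (br y (br x e)) (br w e) - Q (br x (br y e)) (br w e)"
      using br_jacobi[of y x e] by (simp add: Q_simps)
    then show "- Q (br (br y x) e) (br w e) = Q (br x (br y e)) (br w e) + Q (br x e) (br y (br w e))"
      by (simp add: Q_inv[of y "br x e"])
  qed
  finally have 2: "Q (cas (br y x)) w = \<dots>" .
  show "Q (cas (br y x)) w = Q (br y (cas x)) w"
    using skew_trace[OF M, of y] unfolding 1 2 by (simp add: sum.distrib sum_subtractf)
qed

lemma br_cas_left: "br (cas x) y = cas (br x y)"
  using cas_br[of y x] br_skew[of "cas x" y] br_skew[of x y] linear_neg[OF linear_cas] by metis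

text \<open>A symmetric operator is injective on its range, so \<open>cas\<close> and its square
  have the same range; hence \<open>cas\<close> can be inverted modulo its kernel, the
  centre.\<close>

lemma cas_solvable: "\<exists>x. cas (cas x - y) = 0"
proof -
  have "inj_on cas (range cas)"
  proof (rule inj_onI)
    fix u v assume "u \<in> range cas" "v \<in> range cas" and eq: "cas u = cas v"
    then obtain u' v' where "u = cas u'" "v = cas v'" by blast
    then obtain z where z: "u - v = cas z" using linear_diff[OF linear_cas] by metis
    have "cas (cas z) = 0" using eq linear_diff[OF linear_cas, of u v] z by simp
    then have "Q (cas z) (cas z) = 0" using Q_cas_sym[of z "cas z"] by (simp add: Q_simps)
    then have "cas z = 0" by (metis Q_pos less_irrefl)
    then show "u = v" using z by simp
  qed
  moreover have S: "subspace (range cas)" by (simp add: linear_cas linear_subspace_image)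
  ultimately have "dim (cas ` range cas) = dim (range cas)"
    using dim_image_eq[OF linear_cas, of "range cas"] by (simp add: span_eq_iff[THEN iffD2, OF S])
  then have "cas ` range cas = range cas"
    using S linear_subspace_image[OF linear_cas S] by (intro subspace_dim_equal) auto
  then have "cas y \<in> cas ` range cas" by blast
  then obtain x where "cas y = cas (cas x)" by blast
  then have "cas (cas x - y) = 0" by (simp add: linear_diff[OF linear_cas])
  then show ?thesis by blast
qed

text \<open>A preimage under the Casimir operator up to the centre, which brackets do not see
  (\<open>br_cas_dual\<close>).\<close>

definition dual :: "'k \<Rightarrow> 'k" where "dual y = (SOME x. cas (cas x - y) = 0)"

lemma br_cas_dual: "br (cas (dual y)) T = br y T"
proof -
  have "cas (cas (dual y) - y) = 0" unfolding dual_def by (rule someI_ex[OF cas_solvable])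
  then have "br (cas (dual y) - y) T = 0" using cas_eq_0 by blast
  then show ?thesis by (simp only: bilinear_lsub[OF br_bil] right_minus_eq)
qed

text \<open>The Casimir element of the pairs \<open>e\<close>, \<open>dual e\<close>, normalised to
  act as the identity on the derived algebra. By \<open>br_der\<close> and \<open>der_br\<close> it
  is the projection onto the derived algebra along the centre.\<close>

definition der :: "'k \<Rightarrow> 'k" where "der x = (\<Sum>e\<in>onb. br e (br (dual e) x))"

text \<open>\<open>cas\<close> commutes with \<open>br e\<close> and can be moved onto
  \<open>dual e\<close>, where \<open>br_cas_dual\<close> turns it back into \<open>e\<close>; so
  \<open>der x\<close> and \<open>x\<close> have the same image under \<open>cas\<close> and differ
  by a central element.\<close>

lemma br_der: "br (x - der x) y = 0"
proof -
  have "cas (br e (br (dual e) x)) = br e (br e x)" for e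
    by (simp only: cas_br[of e "br (dual e) x"] br_cas_left[of "dual e" x, symmetric] br_cas_dual)
  then have "cas (der x) = cas x"
    by (simp add: der_def linear_sum[OF linear_cas] cas_def[of x])
  then have "cas (x - der x) = 0" by (simp add: linear_diff[OF linear_cas])
  then show ?thesis using cas_eq_0 by blast
qed

lemma central_orthogonal:
  assumes "\<And>y. br z y = 0"
  shows "Q z (br x y) = 0"
proof -
  have "Q z (br x y) = - Q y (br x z)" by (subst Q_sym) (rule Q_inv)
  also have "br x z = 0" by (subst br_skew) (simp add: assms)
  finally show ?thesis by (simp add: Q_simps)
qed

text \<open>The defect \<open>d\<close> is central by \<open>br_der\<close> and also a sum of
  brackets, so it is orthogonal to itself.\<close>

lemma der_br: "der (br x y) = br x y"
proof -
  define d where "d = br x y - der (br x y)"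
  have c: "br d z = 0" for z unfolding d_def by (rule br_der)
  have "Q d d = Q d (br x y) - Q d (der (br x y))"
    by (subst (2) d_def) (simp add: Q_simps)
  also have "\<dots> = 0"
    by (simp add: der_def linear_sum[OF linear_Q(1)] central_orthogonal[OF c])
  finally have "d = 0" using Q_pos[of d] by linarith
  then show ?thesis by (simp add: d_def)
qed

text \<open>The expression \<open>\<theta> (br r x) y\<close> is symmetric in \<open>x\<close>,
  \<open>y\<close> by invariance and skewness of \<theta>, and skew in \<open>r\<close>,
  \<open>x\<close>; permuting through all six orders returns its negative.\<close>

lemma skew_invariant_vanishes:
  fixes \<theta> :: "'k \<Rightarrow> 'k \<Rightarrow> 'b::real_vector"
  assumes skew: "\<And>x y. \<theta> x y = - \<theta> y x"
    and neg: "\<And>x y. \<theta> (- x) y = - \<theta> x y"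
    and inv: "\<And>r x y. \<theta> (br r x) y + \<theta> x (br r y) = 0"
  shows "\<theta> (br r x) y = 0"
proof -
  define c where "c r x y = \<theta> (br r x) y" for r x y
  have s: "c r x y = c r y x" for r x y
    using inv[of r x y] skew[of x "br r y"] by (simp add: c_def)
  have a: "c r x y = - c x r y" for r x y
  proof -
    have "\<theta> (br r x) y = \<theta> (- br x r) y" by (subst br_skew) simp
    also have "\<dots> = - \<theta> (br x r) y" by (rule neg)
    finally show ?thesis by (simp add: c_def)
  qed
  have "c r x y = - c r x y"
    using a[of r x y] s[of x r y] a[of x y r] s[of y x r] a[of y r x] s[of r y x] by simp
  then have "2 *\<^sub>R c r x y = 0" by (simp add: scaleR_2 eq_neg_iff_add_eq_0)
  then show ?thesis by (simp add: c_def)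
qed

text \<open>Whitehead's second lemma by least squares. Subtracting the coboundary nearest to
  \<theta> leaves a cocycle \<eta> orthogonal to all coboundaries. Its derivative along
  \<open>r\<close> is itself a coboundary and, by invariance of the inner product, again orthogonal
  to coboundaries, hence zero. An invariant skew form vanishes on brackets, and the assumption on
  central elements does the rest.\<close>

lemma cocycle_is_coboundary:
  fixes \<theta> :: "'k \<Rightarrow> 'k \<Rightarrow> real"
  assumes bil: "bilinear \<theta>" and skew: "\<And>x y. \<theta> x y = - \<theta> y x"
    and coc: "\<And>r x y. \<theta> r (br x y) = \<theta> (br r x) y + \<theta> x (br r y)"
    and central: "\<And>z y. (\<And>w. br z w = 0) \<Longrightarrow> \<theta> z y = 0"
  shows "\<exists>a. \<forall>x y. \<theta> x y = Q a (br x y)"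
proof -
  have lin: "linear (\<theta> x)" "linear (\<lambda>x. \<theta> x y)" for x y using bil by (simp_all add: bilinear_def)
  \<comment> \<open>\<open>Q a w\<close> is the inner product of \<theta> with the coboundary of
    \<open>a\<close>; \<open>cas a = - w\<close> is the normal equation for the nearest
    coboundary.\<close>
  define w where "w = (\<Sum>e\<in>onb. \<Sum>f\<in>onb. \<theta> e f *\<^sub>R br e f)"
  obtain a where "cas (cas a - (- w)) = 0" using cas_solvable[of "- w"] by blast
  then have c: "br (cas a + w) y = 0" for y by (simp add: cas_eq_0)
  \<comment> \<open>\<open>cas a + w\<close> is central and at the same time a sum of brackets, so
    it is orthogonal to itself.\<close>
  have "Q (cas a + w) (cas a) = 0"
    by (subst (2) cas_def) (simp add: linear_sum[OF linear_Q(1)] central_orthogonal[OF c])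
  moreover have "Q (cas a + w) w = 0"
    by (subst (2) w_def) (simp add: linear_sum[OF linear_Q(1)] bilinear_rmul[OF Q_bil]
      central_orthogonal[OF c])
  ultimately have "Q (cas a + w) (cas a + w) = 0" by (simp add: Q_simps)
  then have caw: "cas a + w = 0" by (metis Q_pos less_irrefl)
  define \<eta> where "\<eta> x y = \<theta> x y - Q a (br x y)" for x y
  have \<eta>_bil: "bilinear \<eta>"
    unfolding bilinear_def \<eta>_def
    using linear_compose[OF linear_br(1) linear_Q(1), unfolded o_def]
      linear_compose[OF linear_br(2) linear_Q(1), unfolded o_def] lin
    by (intro conjI allI linear_compose_sub)
  have \<eta>_lin: "linear (\<eta> x)" "linear (\<lambda>x. \<eta> x y)" for x y
    using \<eta>_bil by (simp_all add: bilinear_def)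
  have \<eta>_skew: "\<eta> x y = - \<eta> y x" for x y
    unfolding \<eta>_def by (subst skew, subst br_skew) (simp add: Q_simps)
  have cas_sum: "(\<Sum>e\<in>onb. \<Sum>f\<in>onb. Q a (br e f) *\<^sub>R br e f) = - cas a"
  proof -
    have "(\<Sum>f\<in>onb. Q a (br e f) *\<^sub>R br e f) = - br e (br e a)" for e
    proof -
      have "Q a (br e f) *\<^sub>R br e f = - br e (Q (br e a) f *\<^sub>R f)" for f
        by (simp add: Q_inv br_simps)
      then have "(\<Sum>f\<in>onb. Q a (br e f) *\<^sub>R br e f) = - br e (\<Sum>f\<in>onb. Q (br e a) f *\<^sub>R f)"
        by (simp add: linear_sum[OF linear_br(1)] sum_negf)
      then show ?thesis by (simp only: onb(3)[symmetric])
    qed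
    then show ?thesis by (simp add: cas_def sum_negf)
  qed
  have "(\<Sum>e\<in>onb. \<Sum>f\<in>onb. \<eta> e f *\<^sub>R br e f) = w - (- cas a)"
    by (simp only: \<eta>_def scaleR_diff_left sum_subtractf w_def cas_sum)
  also have "w - (- cas a) = cas a + w" by simp
  \<comment> \<open>Pairing with \<open>Q d\<close> for an arbitrary \<open>d\<close> shows that
    \<eta> is orthogonal to the coboundary of \<open>d\<close>.\<close>
  finally have \<eta>_orth: "(\<Sum>e\<in>onb. \<Sum>f\<in>onb. \<eta> e f *\<^sub>R br e f) = 0"
    unfolding caw .
  \<comment> \<open>\<open>\<rho> r\<close> is, up to sign, the Lie derivative of \<eta> along
    \<open>r\<close>; for a cocycle it is a coboundary, namely that of the vector \<open>b\<close>
    below.\<close>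
  define \<rho> where "\<rho> r x y = \<eta> (br r x) y + \<eta> x (br r y)" for r x y
  have \<rho>0: "\<rho> r x y = 0" for r x y
  proof -
    define b where "b = (\<Sum>e\<in>onb. \<theta> r e *\<^sub>R e) + br r a"
    have b: "\<rho> r x y = Q b (br x y)" for x y
    proof -
      have "\<rho> r x y = \<theta> r (br x y) - (Q a (br (br r x) y) + Q a (br x (br r y)))"
        unfolding \<rho>_def \<eta>_def coc[of r x y] by simp
      also have "Q a (br (br r x) y) + Q a (br x (br r y)) = Q a (br r (br x y))"
        by (simp add: br_jacobi[of r x y] bilinear_radd[OF Q_bil])
      also have "\<theta> r (br x y) = Q (\<Sum>e\<in>onb. \<theta> r e *\<^sub>R e) (br x y)"
      proof -
        have "\<theta> r (br x y) = (\<Sum>e\<in>onb. Q (br x y) e *\<^sub>R \<theta> r e)" by (rule linear_onb[OF lin(1)])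
        also have "\<dots> = Q (\<Sum>e\<in>onb. \<theta> r e *\<^sub>R e) (br x y)"
          by (simp add: linear_sum[OF linear_Q(2)] bilinear_lmul[OF Q_bil] Q_sym[of "br x y"] mult.commute)
        finally show ?thesis .
      qed
      finally show ?thesis by (simp add: b_def bilinear_ladd[OF Q_bil] Q_inv[of r a])
    qed
    define \<beta> where "\<beta> x y = Q b (br x y)" for x y
    have \<beta>_bil: "linear (\<beta> x)" "linear (\<lambda>x. \<beta> x y)" for x y
      unfolding \<beta>_def
      using linear_compose[OF linear_br(1) linear_Q(1), unfolded o_def]
        linear_compose[OF linear_br(2) linear_Q(1), unfolded o_def] by blast+
    have \<beta>_inv: "\<beta> (br r e) f + \<beta> e (br r f) = - Q (br r b) (br e f)" for e f
      by (simp add: \<beta>_def Q_inv[of r b] br_jacobi[of r e f] bilinear_radd[OF Q_bil])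
    have M1: "bilinear (\<lambda>u v. \<eta> u f * \<beta> v f)" for f
      unfolding bilinear_def by (auto
          simp: linear_iff linear_add[OF \<eta>_lin(2)] linear_add[OF \<beta>_bil(2)]
          linear_cmul[OF \<eta>_lin(2)] linear_cmul[OF \<beta>_bil(2)] algebra_simps)
    have M2: "bilinear (\<lambda>u v. \<eta> e u * \<beta> e v)" for e
      unfolding bilinear_def by (auto
          simp: linear_iff linear_add[OF \<eta>_lin(1)] linear_add[OF \<beta>_bil(1)]
          linear_cmul[OF \<eta>_lin(1)] linear_cmul[OF \<beta>_bil(1)] algebra_simps)
    \<comment> \<open>The square norm of \<rho> is its pairing with the coboundary \<beta>. The skew
      trace identities throw the derivative onto \<beta>, where it produces another coboundary,
      orthogonal to \<eta>.\<close>
    have "\<rho> r e f * \<rho> r e f = \<eta> (br r e) f * \<beta> e f + \<eta> e (br r f) * \<beta> e f" for e f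
    proof -
      have "\<rho> r e f * \<rho> r e f = \<rho> r e f * \<beta> e f" by (simp add: b \<beta>_def)
      then show ?thesis by (simp add: \<rho>_def distrib_right)
    qed
    then have "(\<Sum>e\<in>onb. \<Sum>f\<in>onb. \<rho> r e f * \<rho> r e f)
        = (\<Sum>e\<in>onb. \<Sum>f\<in>onb. \<eta> (br r e) f * \<beta> e f) + (\<Sum>e\<in>onb. \<Sum>f\<in>onb. \<eta> e (br r f) * \<beta> e f)"
      by (simp add: sum.distrib)
    also have "(\<Sum>e\<in>onb. \<Sum>f\<in>onb. \<eta> (br r e) f * \<beta> e f) = - (\<Sum>e\<in>onb. \<Sum>f\<in>onb. \<eta> e f * \<beta> (br r e) f)"
    proof -
      have "(\<Sum>f\<in>onb. \<Sum>e\<in>onb. \<eta> (br r e) f * \<beta> e f + \<eta> e f * \<beta> (br r e) f) = 0"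
        using skew_trace[OF M1] by simp
      then have "(\<Sum>e\<in>onb. \<Sum>f\<in>onb. \<eta> (br r e) f * \<beta> e f + \<eta> e f * \<beta> (br r e) f) = 0"
        by (subst sum.swap)
      then show ?thesis by (simp add: sum.distrib)
    qed
    also have "(\<Sum>e\<in>onb. \<Sum>f\<in>onb. \<eta> e (br r f) * \<beta> e f) = - (\<Sum>e\<in>onb. \<Sum>f\<in>onb. \<eta> e f * \<beta> e (br r f))"
    proof -
      have "(\<Sum>e\<in>onb. \<Sum>f\<in>onb. \<eta> e (br r f) * \<beta> e f + \<eta> e f * \<beta> e (br r f)) = 0"
        using skew_trace[OF M2] by simp
      then show ?thesis by (simp add: sum.distrib)
    qed
    also have "- (\<Sum>e\<in>onb. \<Sum>f\<in>onb. \<eta> e f * \<beta> (br r e) f) + - (\<Sum>e\<in>onb. \<Sum>f\<in>onb. \<eta> e f * \<beta> e (br r f))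
        = - (\<Sum>e\<in>onb. \<Sum>f\<in>onb. \<eta> e f * (\<beta> (br r e) f + \<beta> e (br r f)))"
      by (simp add: distrib_left sum.distrib)
    also have "\<dots> = Q (br r b) (\<Sum>e\<in>onb. \<Sum>f\<in>onb. \<eta> e f *\<^sub>R br e f)"
      unfolding \<beta>_inv by (simp add: linear_sum[OF linear_Q(1)] Q_simps sum_negf)
    also have "\<dots> = 0" unfolding \<eta>_orth by (simp add: Q_simps)
    finally have "(\<Sum>e\<in>onb. \<Sum>f\<in>onb. \<rho> r e f * \<rho> r e f) = 0" .
    then have "\<forall>e\<in>onb. \<forall>f\<in>onb. \<rho> r e f = 0"
      using onb(1) by (simp add: sum_nonneg_eq_0_iff sum_nonneg)
    then have \<beta>0: "\<beta> e f = 0" if "e \<in> onb" "f \<in> onb" for e f using that b by (simp add: \<beta>_def)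
    have \<beta>1: "\<beta> x f = 0" if "f \<in> onb" for f
      using linear_onb[OF \<beta>_bil(2), of x f] \<beta>0 that by simp
    have "\<beta> x y = 0"
      using linear_onb[OF \<beta>_bil(1), of x y] \<beta>1 by simp
    then show ?thesis using b by (simp add: \<beta>_def)
  qed
  have br0: "\<eta> (br r x) y = 0" for r x y
    by (rule skew_invariant_vanishes[OF \<eta>_skew linear_neg[OF \<eta>_lin(2)] \<rho>0[unfolded \<rho>_def]])
  have "\<eta> x y = 0" for x y
  proof -
    have "\<eta> (x - der x) y = 0"
      by (simp add: \<eta>_def central[OF br_der] br_der Q_simps)
    moreover have "\<eta> (der x) y = 0"
      by (simp add: der_def linear_sum[OF \<eta>_lin(2)] br0)
    ultimately show ?thesis using linear_diff[OF \<eta>_lin(2)] by simp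
  qed
  then show ?thesis by (auto simp: \<eta>_def)
qed

text \<open>Writing \<open>br x y\<close> as its own image under \<open>der\<close> eliminates the
  primitive \<open>a\<close>: the formula mentions only values of \<theta>, so it passes to
  operator-valued forms.\<close>

lemma cocycle_eq_der:
  fixes \<theta> :: "'k \<Rightarrow> 'k \<Rightarrow> real"
  assumes "bilinear \<theta>" "\<And>x y. \<theta> x y = - \<theta> y x"
    "\<And>r x y. \<theta> r (br x y) = \<theta> (br r x) y + \<theta> x (br r y)"
    "\<And>z y. (\<And>w. br z w = 0) \<Longrightarrow> \<theta> z y = 0"
  shows "\<theta> x y = (\<Sum>e\<in>onb. \<theta> e (br (dual e) (br x y)))"
proof -
  obtain a where a: "\<theta> x y = Q a (br x y)" for x y using cocycle_is_coboundary[OF assms] by blast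
  show ?thesis
    unfolding a by (subst der_br[symmetric]) (simp add: der_def linear_sum[OF linear_Q(1)])
qed

end

section \<open>Invariant inner products from invariant norms\<close>

definition form_sq :: "('k::euclidean_space \<Rightarrow> 'k \<Rightarrow> real) \<Rightarrow> real" where
  "form_sq Q = (\<Sum>i\<in>Basis. \<Sum>j\<in>Basis. (Q i j)\<^sup>2)"

lemma form_sq_nonneg: "0 \<le> form_sq Q"
  by (simp add: form_sq_def sum_nonneg)

lemma form_sq_entry: "i \<in> Basis \<Longrightarrow> j \<in> Basis \<Longrightarrow> (Q i j)\<^sup>2 \<le> form_sq Q"
proof -
  assume i: "i \<in> Basis" and j: "j \<in> Basis"
  have "(Q i j)\<^sup>2 \<le> (\<Sum>j\<in>Basis. (Q i j)\<^sup>2)" by (rule member_le_sum) (use j in auto)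
  also have "\<dots> \<le> form_sq Q" unfolding form_sq_def
    by (rule member_le_sum[of i Basis "\<lambda>i. \<Sum>j\<in>Basis. (Q i j)\<^sup>2"]) (use i in \<open>auto intro: sum_nonneg\<close>)
  finally show ?thesis .
qed

text \<open>Parallelogram law for the Hilbert-Schmidt norm; the negative term is the uniform
  convexity used for minimisers.\<close>

lemma form_sq_mid:
  "form_sq (\<lambda>x y. (Q x y + R x y) / 2) = form_sq Q / 2 + form_sq R / 2 - form_sq (\<lambda>x y. Q x y - R x y) / 4"
proof -
  have "((a + b) / 2)\<^sup>2 = a\<^sup>2 / 2 + b\<^sup>2 / 2 - (a - b)\<^sup>2 / 4" for a b :: real
    by (simp add: power2_eq_square field_simps)
  then show ?thesis
    by (simp add: form_sq_def sum.distrib sum_subtractf sum_divide_distrib)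
qed

lemma bilinear_basis_expand:
  assumes "bilinear (Q :: 'k::euclidean_space \<Rightarrow> 'k \<Rightarrow> real)"
  shows "Q x y = (\<Sum>i\<in>Basis. \<Sum>j\<in>Basis. (x \<bullet> i) * (y \<bullet> j) * Q i j)"
proof -
  have "Q x y = Q (\<Sum>i\<in>Basis. (x \<bullet> i) *\<^sub>R i) (\<Sum>j\<in>Basis. (y \<bullet> j) *\<^sub>R j)"
    by (simp add: euclidean_representation)
  also have "\<dots> = (\<Sum>(i,j)\<in>Basis \<times> Basis. Q ((x \<bullet> i) *\<^sub>R i) ((y \<bullet> j) *\<^sub>R j))"
    by (rule bilinear_sum[OF assms])
  also have "\<dots> = (\<Sum>i\<in>Basis. \<Sum>j\<in>Basis. (x \<bullet> i) * (y \<bullet> j) * Q i j)"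
    by (simp add: bilinear_lmul[OF assms] bilinear_rmul[OF assms] sum.cartesian_product mult.assoc mult.left_commute)
  finally show ?thesis .
qed

text \<open>The map \<open>g\<close> enters each entry twice and entries are squared, which gives
  \<open>M ^ 4\<close>; Cauchy-Schwarz over pairs of basis vectors and the sum over the entries each
  contribute the square of the dimension.\<close>

lemma form_sq_pullback:
  fixes Q :: "'k::euclidean_space \<Rightarrow> 'k \<Rightarrow> real" and g :: "'k \<Rightarrow> 'k"
  assumes bil: "bilinear Q" and g: "\<And>v. norm (g v) \<le> M * norm v"
  shows "form_sq (\<lambda>x y. Q (g x) (g y)) \<le> (M * real DIM('k)) ^ 4 * form_sq Q"
proof -
  let ?d = "real DIM('k)"
  have M: "0 \<le> M"
  proof -
    obtain i :: 'k where "i \<in> Basis" using nonempty_Basis by blast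
    then have "norm (g i) \<le> M" using g[of i] by simp
    then show ?thesis by (rule order_trans[OF norm_ge_zero])
  qed
  have entry: "(Q (g i) (g j))\<^sup>2 \<le> M ^ 4 * ?d ^ 2 * form_sq Q" if "i \<in> Basis" "j \<in> Basis" for i j
  proof -
    have gi: "\<bar>g i \<bullet> k\<bar> \<le> M" "\<bar>g j \<bullet> k\<bar> \<le> M" if "k \<in> Basis" for k
      using g[of i] g[of j] Basis_le_norm[OF that, of "g i"] Basis_le_norm[OF that, of "g j"]
        \<open>i \<in> Basis\<close> \<open>j \<in> Basis\<close> by auto
    have "\<bar>Q (g i) (g j)\<bar> \<le> (\<Sum>k\<in>Basis. \<Sum>l\<in>Basis. M * M * \<bar>Q k l\<bar>)"
      unfolding bilinear_basis_expand[OF bil, of "g i"]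
      by (intro order_trans[OF sum_abs] sum_mono)
         (auto simp: abs_mult intro!: mult_mono gi M order_trans[OF sum_abs] sum_mono)
    also have "\<dots> = M\<^sup>2 * (\<Sum>(k,l)\<in>Basis\<times>Basis. \<bar>Q k l\<bar>)"
      by (simp add: sum.cartesian_product sum_distrib_left power2_eq_square split_def)
    finally have "(Q (g i) (g j))\<^sup>2 \<le> (M\<^sup>2 * (\<Sum>(k,l)\<in>Basis\<times>Basis. \<bar>Q k l\<bar>))\<^sup>2"
      by (metis abs_ge_zero power2_abs power_mono)
    also have "\<dots> = M ^ 4 * (\<Sum>(k,l)\<in>Basis\<times>Basis. \<bar>Q k l\<bar>)\<^sup>2"
      by (simp add: power_mult_distrib flip: power_mult)
    finally have 1: "(Q (g i) (g j))\<^sup>2 \<le> M ^ 4 * (\<Sum>(k,l)\<in>Basis\<times>Basis. \<bar>Q k l\<bar>)\<^sup>2" .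
    have "(\<Sum>p\<in>Basis\<times>Basis. \<bar>Q (fst p) (snd p)\<bar>)\<^sup>2 \<le>
        (\<Sum>p\<in>Basis\<times>(Basis::'k set). \<bar>Q (fst p) (snd p)\<bar>\<^sup>2) * real (card ((Basis::'k set) \<times> (Basis::'k set)))"
      by (rule sum_squared_le_sum_of_squares[of "\<lambda>p. \<bar>Q (fst p) (snd p)\<bar>" "Basis \<times> Basis"])
    also have "\<dots> = ?d ^ 2 * form_sq Q"
      by (simp add: form_sq_def sum.cartesian_product power2_eq_square card_cartesian_product split_def)
    finally have "(\<Sum>(k,l)\<in>Basis\<times>Basis. \<bar>Q k l\<bar>)\<^sup>2 \<le> ?d ^ 2 * form_sq Q" by (simp add: split_def)
    then have "M ^ 4 * (\<Sum>(k,l)\<in>Basis\<times>Basis. \<bar>Q k l\<bar>)\<^sup>2 \<le> M ^ 4 * (?d ^ 2 * form_sq Q)"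
      by (rule mult_left_mono) simp
    then show ?thesis using 1 by (simp add: mult.assoc)
  qed
  have "form_sq (\<lambda>x y. Q (g x) (g y)) \<le> (\<Sum>i\<in>(Basis::'k set). \<Sum>j\<in>(Basis::'k set). M ^ 4 * ?d ^ 2 * form_sq Q)"
    unfolding form_sq_def[of "\<lambda>x y. Q (g x) (g y)"] by (intro sum_mono entry)
  also have "\<dots> = (M * ?d) ^ 4 * form_sq Q"
    by (simp add: power_mult_distrib algebra_simps eval_nat_numeral)
  finally show ?thesis .
qed

locale vector_norm =
  fixes N :: "'k::euclidean_space \<Rightarrow> real"
  assumes N_nonneg: "0 \<le> N x" and N_zero: "N x = 0 \<Longrightarrow> x = 0"
    and N_tri: "N (x + y) \<le> N x + N y" and N_scale: "N (r *\<^sub>R x) = \<bar>r\<bar> * N x"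
begin

lemma N_0: "N 0 = 0" using N_scale[of 0 0] by simp

lemma N_upper: "\<exists>C. 0 < C \<and> (\<forall>v. N v \<le> C * norm v)"
proof -
  have N_sum: "N (\<Sum>i\<in>I. f i) \<le> (\<Sum>i\<in>I. N (f i))" if "finite I" for I and f :: "'k \<Rightarrow> 'k"
    using that
  proof (induction I)
    case (insert i I)
    then show ?case using N_tri[of "f i" "sum f I"] by simp
  qed (simp add: N_0)
  have "N v \<le> (\<Sum>i\<in>Basis. N i) * norm v" for v
  proof -
    have "N v = N (\<Sum>i\<in>Basis. (v \<bullet> i) *\<^sub>R i)" by (simp add: euclidean_representation)
    also have "\<dots> \<le> (\<Sum>i\<in>Basis. N ((v \<bullet> i) *\<^sub>R i))" by (rule N_sum) simp
    also have "\<dots> \<le> (\<Sum>i\<in>Basis. N i * norm v)"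
      by (rule sum_mono) (simp add: N_scale mult.commute mult_left_mono[OF Basis_le_norm N_nonneg])
    finally show ?thesis by (simp add: sum_distrib_right)
  qed
  moreover have "0 \<le> (\<Sum>i\<in>Basis. N i)" by (simp add: sum_nonneg N_nonneg)
  ultimately have "N v \<le> ((\<Sum>i\<in>Basis. N i) + 1) * norm v" for v
    by (smt (verit) distrib_right mult_cancel_right1 norm_ge_zero)
  then show ?thesis using \<open>0 \<le> (\<Sum>i\<in>Basis. N i)\<close> by (intro exI[of _ "(\<Sum>i\<in>Basis. N i) + 1"]) auto
qed

text \<open>The minimum of \<open>N\<close> on the compact Euclidean unit sphere is positive;
  \<open>N\<close> is continuous there because \<open>N_upper\<close> makes it Lipschitz.\<close>

lemma N_lower: "\<exists>C. 0 < C \<and> (\<forall>v. norm v \<le> C * N v)"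
proof -
  obtain C where C: "0 < C" "\<And>v. N v \<le> C * norm v" using N_upper by blast
  have lip: "\<bar>N x - N y\<bar> \<le> C * norm (x - y)" for x y
  proof -
    have "N x \<le> N y + N (x - y)" "N y \<le> N x + N (x - y)"
      using N_tri[of y "x - y"] N_tri[of x "y - x"] N_scale[of "-1" "x - y"] by simp_all
    then show ?thesis using C(2)[of "x - y"] by linarith
  qed
  have "continuous_on (sphere 0 1) N"
  proof (rule continuous_on_sequentiallyI)
    fix u :: "nat \<Rightarrow> 'k" and a assume "u \<longlonglongrightarrow> a"
    then have "(\<lambda>n. C * norm (u n - a)) \<longlonglongrightarrow> C * norm (a - a)" by (intro tendsto_intros)
    then have "(\<lambda>n. N (u n) - N a) \<longlonglongrightarrow> 0"
      by (intro Lim_null_comparison[OF always_eventually, of "\<lambda>n. N (u n) - N a" "\<lambda>n. C * norm (u n - a)"])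
        (use lip in auto)
    then show "(\<lambda>n. N (u n)) \<longlonglongrightarrow> N a" by (simp add: LIM_zero_iff)
  qed
  moreover have "sphere (0::'k) 1 \<noteq> {}"
  proof -
    obtain i :: 'k where "i \<in> Basis" using nonempty_Basis by blast
    then have "i \<in> sphere 0 1" by simp
    then show ?thesis by blast
  qed
  ultimately obtain w where w: "norm w = 1" "\<And>v. norm v = 1 \<Longrightarrow> N w \<le> N v"
    using continuous_attains_inf[of "sphere 0 1" N] by (auto simp: dist_norm)
  then have pos: "0 < N w" using N_nonneg[of w] N_zero[of w] by force
  have "norm v \<le> (1 / N w) * N v" for v
  proof (cases "v = 0")
    case False
    have "N w \<le> N ((1 / norm v) *\<^sub>R v)" using False by (intro w(2)) simp
    then show ?thesis using False pos by (simp add: N_scale field_simps)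
  qed (simp add: N_0)
  then show ?thesis using pos by (intro exI[of _ "1 / N w"]) simp
qed

definition isoms :: "('k \<Rightarrow> 'k) set" where "isoms = {g. linear g \<and> (\<forall>v. N (g v) = N v)}"

lemma isoms_bound: "\<exists>M. 0 < M \<and> (\<forall>g\<in>isoms. \<forall>v. norm (g v) \<le> M * norm v)"
proof -
  obtain C where C: "0 < C" "\<And>v. N v \<le> C * norm v" using N_upper by blast
  obtain D where D: "0 < D" "\<And>v. norm v \<le> D * N v" using N_lower by blast
  have "norm (g v) \<le> (D * C) * norm v" if "g \<in> isoms" for g v
  proof -
    have "norm (g v) \<le> D * N v" using D(2)[of "g v"] that by (simp add: isoms_def)
    also have "\<dots> \<le> D * (C * norm v)" using C(2) D(1) by simp
    finally show ?thesis by simp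
  qed
  then show ?thesis using C D by (intro exI[of _ "D * C"]) auto
qed

lemma isoms_id: "id \<in> isoms" by (simp add: isoms_def linear_id)

lemma isoms_comp: "g \<in> isoms \<Longrightarrow> h \<in> isoms \<Longrightarrow> (\<lambda>x. g (h x)) \<in> isoms"
  by (auto simp: isoms_def dest: linear_compose[unfolded o_def])

lemma isoms_inverse:
  assumes "g \<in> isoms"
  shows "\<exists>h\<in>isoms. \<forall>x. g (h x) = x"
proof -
  have lin: "linear g" and iso: "\<And>v. N (g v) = N v" using assms by (auto simp: isoms_def)
  have "inj g"
    by (rule linear_injective_0[OF lin, THEN iffD2]) (metis N_0 N_zero iso)
  then obtain h where h: "linear h" "\<And>x. h (g x) = x" "\<And>x. g (h x) = x"
    using linear_injective_isomorphism[OF lin] by blast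
  moreover have "N (h v) = N v" for v using iso[of "h v"] h(3) by simp
  ultimately have "h \<in> isoms" by (simp add: isoms_def)
  then show ?thesis using h(3) by blast
qed

text \<open>The lower bound by \<open>N\<close> is preserved by isometries, midpoints and limits,
  and it keeps the limit of a minimising sequence positive definite.\<close>

definition admissible :: "('k \<Rightarrow> 'k \<Rightarrow> real) set" where
  "admissible = {Q. bilinear Q \<and> (\<forall>x y. Q x y = Q y x) \<and> (\<forall>v. (N v)\<^sup>2 \<le> Q v v)}"

text \<open>The supremum takes the place of an average over the isometry group: it does not grow
  under pullback, and it inherits the uniform convexity of \<open>form_sq\<close>.\<close>

definition energy :: "('k \<Rightarrow> 'k \<Rightarrow> real) \<Rightarrow> real" where
  "energy Q = (SUP g\<in>isoms. form_sq (\<lambda>x y. Q (g x) (g y)))"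

lemma admissible_pullback:
  assumes "Q \<in> admissible" "g \<in> isoms"
  shows "(\<lambda>x y. Q (g x) (g y)) \<in> admissible"
proof -
  have "linear g" and Q: "bilinear Q" using assms by (auto simp: isoms_def admissible_def)
  then have "bilinear (\<lambda>x y. Q (g x) (g y))"
    unfolding bilinear_def
    using linear_compose[of g "Q x" for x, unfolded o_def] linear_compose[of g "\<lambda>x. Q x y" for y, unfolded o_def]
    by blast
  moreover have "\<And>v. (N v)\<^sup>2 \<le> Q (g v) (g v)"
    using assms by (simp add: isoms_def admissible_def) metis
  ultimately show ?thesis using assms by (auto simp: admissible_def)
qed

text \<open>The minimiser of \<open>energy\<close> over the admissible forms is unique because \<open>form_sq\<close> is uniformly
  convex and the isometries are uniformly bounded; uniqueness makes it invariant.\<close>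

lemma invariant_form:
  "\<exists>Q :: 'k \<Rightarrow> 'k \<Rightarrow> real. bilinear Q \<and> (\<forall>x y. Q x y = Q y x) \<and> (\<forall>x. x \<noteq> 0 \<longrightarrow> 0 < Q x x) \<and>
     (\<forall>g\<in>isoms. \<forall>x y. Q (g x) (g y) = Q x y)"
proof -
  obtain M where M: "0 < M" "\<And>g v. g \<in> isoms \<Longrightarrow> norm (g v) \<le> M * norm v" using isoms_bound by blast
  define \<kappa> where "\<kappa> = (M * real DIM('k)) ^ 4"
  have \<kappa>: "0 < \<kappa>" using M by (simp add: \<kappa>_def)
  have pull: "form_sq (\<lambda>x y. Q (g x) (g y)) \<le> \<kappa> * form_sq Q" if "bilinear Q" "g \<in> isoms" for Q g
    unfolding \<kappa>_def by (rule form_sq_pullback) (use that M in auto)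
  have bdd: "bdd_above ((\<lambda>g. form_sq (\<lambda>x y. Q (g x) (g y))) ` isoms)" if "bilinear Q" for Q
    using pull[OF that] by (intro bdd_aboveI[of _ "\<kappa> * form_sq Q"]) auto
  have adm: "bilinear Q" "\<And>x y. Q x y = Q y x" "\<And>v. (N v)\<^sup>2 \<le> Q v v" if "Q \<in> admissible" for Q
    using that by (auto simp: admissible_def)
  have le_energy: "form_sq (\<lambda>x y. Q (g x) (g y)) \<le> energy Q" if "Q \<in> admissible" "g \<in> isoms" for Q g
    unfolding energy_def by (rule cSUP_upper[OF that(2) bdd]) (rule adm(1)[OF that(1)])
  have energy_le: "energy Q \<le> c" if "\<And>g. g \<in> isoms \<Longrightarrow> form_sq (\<lambda>x y. Q (g x) (g y)) \<le> c" for Q c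
    unfolding energy_def by (rule cSUP_least) (use isoms_id that in auto)
  have energy_nonneg: "0 \<le> energy Q" if "Q \<in> admissible" for Q
    using le_energy[OF that isoms_id] form_sq_nonneg order_trans by blast
  have energy_pull: "energy (\<lambda>x y. Q (g x) (g y)) \<le> energy Q" if "Q \<in> admissible" "g \<in> isoms" for Q g
    by (rule energy_le) (rule le_energy[OF that(1) isoms_comp[OF that(2)]])
  obtain C where C: "0 < C" "\<And>v. N v \<le> C * norm v" using N_upper by blast
  have "bilinear (\<lambda>x y. C\<^sup>2 * (x \<bullet> y))" for x y :: 'k
    by (auto simp: bilinear_def linear_iff inner_add_left inner_add_right algebra_simps)
  moreover have "(N v)\<^sup>2 \<le> C\<^sup>2 * (v \<bullet> v)" for v
    using power_mono[OF C(2) N_nonneg, of v 2] by (simp add: power_mult_distrib power2_norm_eq_inner)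
  ultimately have "(\<lambda>x y. C\<^sup>2 * (x \<bullet> y)) \<in> admissible"
    by (auto simp: admissible_def inner_commute)
  then have ne: "admissible \<noteq> {}" by blast
  define m where "m = (INF Q\<in>admissible. energy Q)"
  have bddm: "bdd_below (energy ` admissible)" using energy_nonneg by (intro bdd_belowI[of _ 0]) auto
  have m_le: "m \<le> energy Q" if "Q \<in> admissible" for Q
    unfolding m_def by (rule cINF_lower[OF bddm that])
  \<comment> \<open>Two nearly minimal forms are close. The convexity gain at an isometry
    \<open>g\<close> is measured on the pulled back difference; pulling back once more by the
    inverse isometry bounds it below independently of \<open>g\<close>, at the price of the factor
    \<kappa>.\<close>
  have convex: "form_sq (\<lambda>x y. Q x y - R x y) \<le> 2 * \<kappa> * ((energy Q - m) + (energy R - m))"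
    if Q: "Q \<in> admissible" and R: "R \<in> admissible" for Q R
  proof -
    let ?D = "\<lambda>x y. Q x y - R x y"
    have lin: "linear (Q x)" "linear (\<lambda>x. Q x y)" "linear (R x)" "linear (\<lambda>x. R x y)" for x y
      using adm(1)[OF Q] adm(1)[OF R] by (simp_all add: bilinear_def)
    have D: "bilinear ?D" unfolding bilinear_def by (intro conjI allI linear_compose_sub lin)
    have lm: "linear (\<lambda>x. (Q x y + R x y) / 2)" "linear (\<lambda>y. (Q x y + R x y) / 2)" for x y
      using linear_compose_scale_right[OF linear_compose_add[OF lin(2) lin(4)], of "1/2" y y]
        linear_compose_scale_right[OF linear_compose_add[OF lin(1) lin(3)], of "1/2" x x]
      by simp_all
    have sm: "(Q x y + R x y) / 2 = (Q y x + R y x) / 2" for x y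
      using adm(2)[OF Q, of x y] adm(2)[OF R, of x y] by simp
    have nm: "(N v)\<^sup>2 \<le> (Q v v + R v v) / 2" for v
      using add_mono[OF adm(3)[OF Q, of v] adm(3)[OF R, of v]] by simp
    have mid: "(\<lambda>x y. (Q x y + R x y) / 2) \<in> admissible"
      unfolding admissible_def bilinear_def mem_Collect_eq by (intro conjI allI lm sm nm)
    have "energy (\<lambda>x y. (Q x y + R x y) / 2) \<le> energy Q / 2 + energy R / 2 - form_sq ?D / (4 * \<kappa>)"
    proof (rule energy_le)
      fix g assume g: "g \<in> isoms"
      obtain h where h: "h \<in> isoms" "\<And>x. g (h x) = x"
        using isoms_inverse[OF g] by blast
      have "linear g" using g by (simp add: isoms_def)
      then have "bilinear (\<lambda>x y. ?D (g x) (g y))"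
        using D linear_compose[of g "?D x" for x, unfolded o_def] linear_compose[of g "\<lambda>x. ?D x y" for y, unfolded o_def]
        unfolding bilinear_def by blast
      from pull[OF this h(1)] have "form_sq ?D \<le> \<kappa> * form_sq (\<lambda>x y. ?D (g x) (g y))"
        by (simp add: h(2))
      then have "form_sq ?D / (4 * \<kappa>) \<le> form_sq (\<lambda>x y. ?D (g x) (g y)) / 4"
        using \<kappa> by (simp add: field_simps)
      then show "form_sq (\<lambda>x y. (Q (g x) (g y) + R (g x) (g y)) / 2)
          \<le> energy Q / 2 + energy R / 2 - form_sq ?D / (4 * \<kappa>)"
        unfolding form_sq_mid using le_energy[OF Q g] le_energy[OF R g] by linarith
    qed
    then have "form_sq ?D / (4 * \<kappa>) \<le> energy Q / 2 + energy R / 2 - m"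
      using m_le[OF mid] by linarith
    then show ?thesis using \<kappa> by (simp add: field_simps)
  qed
  have "\<exists>Q\<in>admissible. energy Q < m + 1 / real (Suc n)" for n
    using cINF_less_iff[OF ne bddm, of "m + 1 / real (Suc n)"] by (simp add: m_def)
  then obtain S where S: "\<And>n. S n \<in> admissible" "\<And>n. energy (S n) < m + 1 / real (Suc n)"
    by metis
  have lim1: "(\<lambda>n. m + 1 / real (Suc n)) \<longlonglongrightarrow> m"
    using tendsto_add[OF tendsto_const LIMSEQ_inverse_real_of_nat, of m] by (simp add: inverse_eq_divide)
  \<comment> \<open>By \<open>convex\<close> a minimising sequence is Cauchy in every matrix entry.
    Two energy gaps below \<open>e\<^sup>2 / (4 * \<kappa>)\<close> add up to exactly
    \<open>e\<^sup>2\<close>.\<close>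
  have "Cauchy (\<lambda>n. S n i j)" if ij: "i \<in> Basis" "j \<in> Basis" for i j
  proof (rule metric_CauchyI)
    fix e :: real assume e: "0 < e"
    obtain K :: nat where K: "0 < K" "1 / real K < e\<^sup>2 / (4 * \<kappa>)"
      using real_arch_inverse[of "e\<^sup>2 / (4 * \<kappa>)"] e \<kappa> by (auto simp: inverse_eq_divide)
    show "\<exists>K. \<forall>a\<ge>K. \<forall>b\<ge>K. dist (S a i j) (S b i j) < e"
    proof (intro exI allI impI)
      fix a b assume ab: "K \<le> a" "K \<le> b"
      have small: "energy (S c) - m < e\<^sup>2 / (4 * \<kappa>)" if "K \<le> c" for c
      proof -
        have "1 / real (Suc c) \<le> 1 / real K" using that K by (simp add: frac_le)
        then show ?thesis using S(2)[of c] K by linarith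
      qed
      have "(S a i j - S b i j)\<^sup>2 \<le> 2 * \<kappa> * ((energy (S a) - m) + (energy (S b) - m))"
        using form_sq_entry[OF ij, of "\<lambda>x y. S a x y - S b x y"] convex[OF S(1)[of a] S(1)[of b]] by linarith
      also have "\<dots> < 2 * \<kappa> * (e\<^sup>2 / (4 * \<kappa>) + e\<^sup>2 / (4 * \<kappa>))"
        using small[OF ab(1)] small[OF ab(2)] \<kappa> by (intro mult_strict_left_mono) auto
      also have "\<dots> = e\<^sup>2" using \<kappa> by (simp add: field_simps)
      finally have "\<bar>S a i j - S b i j\<bar>\<^sup>2 < e\<^sup>2" by simp
      then have "\<bar>S a i j - S b i j\<bar> < e" by (rule power2_less_imp_less) (use e in simp)
      then show "dist (S a i j) (S b i j) < e" by (simp add: dist_real_def)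
    qed
  qed
  then have "\<forall>i\<in>Basis. \<forall>j\<in>Basis. \<exists>l. (\<lambda>n. S n i j) \<longlonglongrightarrow> l"
    by (simp add: Cauchy_convergent_iff convergent_def)
  then obtain L where L: "\<And>i j. i \<in> Basis \<Longrightarrow> j \<in> Basis \<Longrightarrow> (\<lambda>n. S n i j) \<longlonglongrightarrow> L i j"
    by metis
  define Q where "Q x y = (\<Sum>i\<in>Basis. \<Sum>j\<in>Basis. (x \<bullet> i) * (y \<bullet> j) * L i j)" for x y :: 'k
  have conv: "(\<lambda>n. S n x y) \<longlonglongrightarrow> Q x y" for x y
    unfolding Q_def bilinear_basis_expand[OF adm(1)[OF S(1)], of _ x y]
    by (intro tendsto_sum tendsto_mult tendsto_const L)
  have "bilinear Q"
    by (auto simp: Q_def bilinear_def linear_iff inner_add_left algebra_simps sum.distrib sum_distrib_left)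
  moreover have "Q x y = Q y x" for x y
    by (rule LIMSEQ_unique[OF conv[of x y]]) (subst adm(2)[OF S(1)], rule conv)
  moreover have "(N v)\<^sup>2 \<le> Q v v" for v
    by (rule LIMSEQ_le_const[OF conv]) (use adm(3)[OF S(1)] in auto)
  ultimately have Q: "Q \<in> admissible" by (simp add: admissible_def)
  have "energy Q \<le> m"
  proof (rule energy_le)
    fix g assume g: "g \<in> isoms"
    have "(\<lambda>n. form_sq (\<lambda>x y. S n (g x) (g y))) \<longlonglongrightarrow> form_sq (\<lambda>x y. Q (g x) (g y))"
      unfolding form_sq_def by (intro tendsto_sum tendsto_power conv)
    moreover have "form_sq (\<lambda>x y. S n (g x) (g y)) \<le> m + 1 / real (Suc n)" for n
      using le_energy[OF S(1) g, of n] S(2)[of n] by linarith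
    ultimately show "form_sq (\<lambda>x y. Q (g x) (g y)) \<le> m"
      by (intro LIMSEQ_le[OF _ lim1]) auto
  qed
  \<comment> \<open>The pullback of the minimiser is a minimiser too, so \<open>convex\<close> makes
    the two forms equal.\<close>
  have inv: "Q (g x) (g y) = Q x y" if g: "g \<in> isoms" for g x y
  proof -
    let ?R = "\<lambda>x y. Q (g x) (g y)"
    have R: "?R \<in> admissible" by (rule admissible_pullback[OF Q g])
    have "form_sq (\<lambda>x y. ?R x y - Q x y) \<le> 2 * \<kappa> * ((energy ?R - m) + (energy Q - m))"
      by (rule convex[OF R Q])
    also have "\<dots> \<le> 0"
      using energy_pull[OF Q g] \<open>energy Q \<le> m\<close> \<kappa> by (intro mult_nonneg_nonpos) auto
    finally have "(?R i j - Q i j)\<^sup>2 \<le> 0" if "i \<in> Basis" "j \<in> Basis" for i j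
      using form_sq_entry[OF that, of "\<lambda>x y. ?R x y - Q x y"] by linarith
    then have "?R i j = Q i j" if "i \<in> Basis" "j \<in> Basis" for i j using that by simp
    then show ?thesis
      using bilinear_basis_expand[OF adm(1)[OF R], of x y] bilinear_basis_expand[OF adm(1)[OF Q], of x y]
      by simp
  qed
  have pos: "0 < Q x x" if "x \<noteq> 0" for x
  proof -
    have "0 < (N x)\<^sup>2" using N_zero that by fastforce
    then show ?thesis using adm(3)[OF Q, of x] by linarith
  qed
  show ?thesis
    by (intro exI[of _ Q] conjI allI ballI impI) (fact adm(1)[OF Q] adm(2)[OF Q] pos inv)+
qed

end

section \<open>Exponentials of linear maps and infinitesimal invariance\<close>

lemma linear_iterate_norm_le:
  fixes D :: "'k::real_normed_vector \<Rightarrow> 'k"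
  assumes "\<And>v. norm (D v) \<le> M * norm v" "0 \<le> M"
  shows "norm ((D ^^ n) u) \<le> M ^ n * norm u"
proof (induction n)
  case (Suc n)
  have "norm (D ((D ^^ n) u)) \<le> M * norm ((D ^^ n) u)" by (rule assms(1))
  also have "\<dots> \<le> M * (M ^ n * norm u)" using Suc assms(2) by (rule mult_left_mono)
  finally show ?case by simp
qed simp

lemma summable_exp_linear:
  fixes D :: "'k::banach \<Rightarrow> 'k"
  assumes "\<And>v. norm (D v) \<le> M * norm v" "0 \<le> M"
  shows "summable (\<lambda>n. norm ((D ^^ n) u /\<^sub>R fact n))"
proof (rule summable_comparison_test'[where N = 0])
  show "summable (\<lambda>n. norm u * (M ^ n /\<^sub>R fact n))"
    by (intro summable_mult summable_exp_generic)
  fix n :: nat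
  show "norm (norm ((D ^^ n) u /\<^sub>R fact n)) \<le> norm u * (M ^ n /\<^sub>R fact n)"
    using linear_iterate_norm_le[OF assms, of n u] by (simp add: field_simps)
qed

lemma linear_funpow:
  fixes D :: "'k::real_vector \<Rightarrow> 'k"
  shows "linear D \<Longrightarrow> linear (D ^^ n)"
  by (induction n) (simp_all add: linear_id linear_compose)

lemma scale_funpow:
  fixes D :: "'k::real_vector \<Rightarrow> 'k"
  assumes "linear D"
  shows "((\<lambda>v. t *\<^sub>R D v) ^^ n) u = t ^ n *\<^sub>R (D ^^ n) u"
  by (induction n) (simp_all add: linear_cmul[OF assms])

lemma linear_exp_series:
  fixes D :: "'k::euclidean_space \<Rightarrow> 'k"
  assumes "linear D"
  shows "linear (\<lambda>u. \<Sum>n. (D ^^ n) u /\<^sub>R fact n)"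
proof -
  obtain M where M: "\<And>v. norm (D v) \<le> M * norm v" "0 \<le> M"
    using linear_bounded_pos[OF assms] by (metis less_imp_le)
  have s: "summable (\<lambda>n. (D ^^ n) u /\<^sub>R fact n)" for u
    by (rule summable_norm_cancel[OF summable_exp_linear[OF M]])
  note lin = linear_funpow[OF assms]
  show ?thesis
  proof (rule linearI)
    fix u v
    show "(\<Sum>n. (D ^^ n) (u + v) /\<^sub>R fact n) = (\<Sum>n. (D ^^ n) u /\<^sub>R fact n) + (\<Sum>n. (D ^^ n) v /\<^sub>R fact n)"
      by (simp add: linear_add[OF lin] scaleR_add_right suminf_add[OF s s])
  next
    fix r u
    show "(\<Sum>n. (D ^^ n) (r *\<^sub>R u) /\<^sub>R fact n) = r *\<^sub>R (\<Sum>n. (D ^^ n) u /\<^sub>R fact n)"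
      by (simp only: linear_cmul[OF lin] scaleR_left_commute[of _ r] suminf_scaleR_right[OF s, symmetric])
  qed
qed

text \<open>What matters is a remainder bounded uniformly for \<open>\<bar>t\<bar> \<le> 1\<close>,
  so that terms of first order in \<open>t\<close> can be compared.\<close>

lemma exp_series_expansion:
  fixes D :: "'k::euclidean_space \<Rightarrow> 'k"
  assumes lin: "linear D"
  shows "\<exists>K r. \<forall>t. \<bar>t\<bar> \<le> 1 \<longrightarrow> norm (r t) \<le> K \<and>
    (\<Sum>n. ((\<lambda>v. t *\<^sub>R D v) ^^ n) u /\<^sub>R fact n) = u + t *\<^sub>R D u + t\<^sup>2 *\<^sub>R r t"
proof -
  obtain M where M: "\<And>v. norm (D v) \<le> M * norm v" "0 \<le> M"
    using linear_bounded_pos[OF assms] by (metis less_imp_le)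
  define a where "a n = (D ^^ n) u /\<^sub>R fact n" for n
  have sa: "summable (\<lambda>n. norm (a n))" unfolding a_def by (rule summable_exp_linear[OF M])
  have sa2: "summable (\<lambda>n. norm (a (n + 2)))" using sa by (subst summable_iff_shift)
  define r where "r t = (\<Sum>n. t ^ n *\<^sub>R a (n + 2))" for t :: real
  have "norm (r t) \<le> (\<Sum>n. norm (a (n + 2))) \<and>
    (\<Sum>n. ((\<lambda>v. t *\<^sub>R D v) ^^ n) u /\<^sub>R fact n) = u + t *\<^sub>R D u + t\<^sup>2 *\<^sub>R r t" if t: "\<bar>t\<bar> \<le> 1" for t
  proof
    have le: "norm (t ^ n *\<^sub>R a m) \<le> norm (a m)" for n m
      using power_le_one[of "\<bar>t\<bar>" n] t by (simp add: power_abs mult_left_le_one_le)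
    have s: "summable (\<lambda>n. norm (t ^ n *\<^sub>R a n))"
      by (rule summable_comparison_test'[OF sa, of 0]) (use le in simp)
    have s2: "summable (\<lambda>n. norm (t ^ n *\<^sub>R a (n + 2)))"
      by (rule summable_comparison_test'[OF sa2, of 0]) (use le in simp)
    have "norm (r t) \<le> (\<Sum>n. norm (t ^ n *\<^sub>R a (n + 2)))"
      unfolding r_def by (rule summable_norm[OF s2])
    also have "\<dots> \<le> (\<Sum>n. norm (a (n + 2)))" by (rule suminf_le[OF le s2 sa2])
    finally show "norm (r t) \<le> (\<Sum>n. norm (a (n + 2)))" .
    have "(\<Sum>n. ((\<lambda>v. t *\<^sub>R D v) ^^ n) u /\<^sub>R fact n) = (\<Sum>n. t ^ n *\<^sub>R a n)"
      by (simp add: scale_funpow[OF lin] a_def mult.commute)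
    also have "\<dots> = (\<Sum>n. t ^ (n + 2) *\<^sub>R a (n + 2)) + (\<Sum>n<2. t ^ n *\<^sub>R a n)"
      by (rule suminf_split_initial_segment[OF summable_norm_cancel[OF s]])
    also have "(\<Sum>n. t ^ (n + 2) *\<^sub>R a (n + 2)) = (\<Sum>n. t\<^sup>2 *\<^sub>R (t ^ n *\<^sub>R a (n + 2)))"
      by (simp add: power2_eq_square mult_ac)
    also have "\<dots> = t\<^sup>2 *\<^sub>R r t"
      unfolding r_def by (rule suminf_scaleR_right[OF summable_norm_cancel[OF s2], symmetric])
    also have "(\<Sum>n<2. t ^ n *\<^sub>R a n) = u + t *\<^sub>R D u"
      by (simp add: a_def numeral_2_eq_2)
    finally show "(\<Sum>n. ((\<lambda>v. t *\<^sub>R D v) ^^ n) u /\<^sub>R fact n) = u + t *\<^sub>R D u + t\<^sup>2 *\<^sub>R r t"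
      by simp
  qed
  then show ?thesis by blast
qed

text \<open>In the expansion of the invariance in powers of \<open>t\<close> the constant terms
  cancel, and the coefficient \<open>c\<close> of \<open>t\<close> is bounded by
  \<open>t * C\<close> for all small positive \<open>t\<close>; so it vanishes.\<close>

lemma infinitesimal_invariance:
  fixes D :: "'k::euclidean_space \<Rightarrow> 'k"
  assumes lin: "linear D" and bil: "bilinear Q"
    and inv: "\<And>t u v. Q (\<Sum>n. ((\<lambda>v. t *\<^sub>R D v) ^^ n) u /\<^sub>R fact n) (\<Sum>n. ((\<lambda>v. t *\<^sub>R D v) ^^ n) v /\<^sub>R fact n)
       = (Q u v :: real)"
  shows "Q (D u) v = - Q u (D v)"
proof -
  obtain K r where r: "\<And>t. \<bar>t\<bar> \<le> 1 \<Longrightarrow> norm (r t) \<le> K"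
    "\<And>t. \<bar>t\<bar> \<le> 1 \<Longrightarrow> (\<Sum>n. ((\<lambda>v. t *\<^sub>R D v) ^^ n) u /\<^sub>R fact n) = u + t *\<^sub>R D u + t\<^sup>2 *\<^sub>R r t"
    using exp_series_expansion[OF lin, of u] by metis
  obtain L s where s: "\<And>t. \<bar>t\<bar> \<le> 1 \<Longrightarrow> norm (s t) \<le> L"
    "\<And>t. \<bar>t\<bar> \<le> 1 \<Longrightarrow> (\<Sum>n. ((\<lambda>v. t *\<^sub>R D v) ^^ n) v /\<^sub>R fact n) = v + t *\<^sub>R D v + t\<^sup>2 *\<^sub>R s t"
    using exp_series_expansion[OF lin, of v] by metis
  obtain B where B: "0 < B" "\<And>x y. \<bar>Q x y\<bar> \<le> B * norm x * norm y"
    using bilinear_bounded_pos[OF bil] by auto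
  have K: "0 \<le> K" "0 \<le> L" using r(1)[of 0] s(1)[of 0] norm_ge_zero order_trans by (metis abs_zero zero_le_one)+
  \<comment> \<open>\<open>C\<close> adds up the bounds of the six terms of order at least two, each
    estimated with \<open>t \<le> 1\<close>.\<close>
  define C where "C = B * norm u * L + B * norm (D u) * norm (D v) + B * norm (D u) * L
    + B * K * norm v + B * K * norm (D v) + B * K * L"
  define c where "c = Q (D u) v + Q u (D v)"
  have bound: "\<bar>c\<bar> \<le> t * C" if t: "0 < t" "t \<le> 1" for t
  proof -
    have t1: "\<bar>t\<bar> \<le> 1" using t by simp
    have "Q u v = Q (u + t *\<^sub>R D u + t\<^sup>2 *\<^sub>R r t) (v + t *\<^sub>R D v + t\<^sup>2 *\<^sub>R s t)"
      using inv[of t u v] r(2)[OF t1] s(2)[OF t1] by simp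
    also have "\<dots> = Q u v + t * c + t\<^sup>2 * (Q u (s t) + Q (D u) (D v) + t * Q (D u) (s t)
       + Q (r t) v + t * Q (r t) (D v) + t\<^sup>2 * Q (r t) (s t))"
      by (simp add: bilinear_ladd[OF bil] bilinear_radd[OF bil] bilinear_lmul[OF bil] bilinear_rmul[OF bil]
          c_def algebra_simps power2_eq_square)
    finally have "t * c = - t\<^sup>2 * (Q u (s t) + Q (D u) (D v) + t * Q (D u) (s t)
       + Q (r t) v + t * Q (r t) (D v) + t\<^sup>2 * Q (r t) (s t))" by simp
    then have "t * c = t * (- t * (Q u (s t) + Q (D u) (D v) + t * Q (D u) (s t)
       + Q (r t) v + t * Q (r t) (D v) + t\<^sup>2 * Q (r t) (s t)))" by (simp add: power2_eq_square)
    then have "c = - t * (Q u (s t) + Q (D u) (D v) + t * Q (D u) (s t)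
       + Q (r t) v + t * Q (r t) (D v) + t\<^sup>2 * Q (r t) (s t))"
      using t(1) unfolding mult_cancel_left by simp
    then have "\<bar>c\<bar> = t * \<bar>Q u (s t) + Q (D u) (D v) + t * Q (D u) (s t)
       + Q (r t) v + t * Q (r t) (D v) + t\<^sup>2 * Q (r t) (s t)\<bar>"
      using t(1) by (simp add: abs_mult)
    also have "\<dots> \<le> t * C"
    proof (rule mult_left_mono)
      have q: "\<bar>Q x (s t)\<bar> \<le> B * norm x * L" for x
        using order_trans[OF B(2)[of x "s t"] mult_left_mono[OF s(1)[OF t1]]] B(1) by simp
      have q': "\<bar>Q (r t) y\<bar> \<le> B * K * norm y" for y
        using order_trans[OF B(2)[of "r t" y] mult_right_mono[OF mult_left_mono[OF r(1)[OF t1]]]] B(1) by simp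
      have q'': "\<bar>Q (r t) (s t)\<bar> \<le> B * K * L"
        using order_trans[OF q'[of "s t"] mult_left_mono[OF s(1)[OF t1]]] B(1) K by simp
      have sc: "\<bar>t * x\<bar> \<le> \<bar>x\<bar>" "\<bar>t\<^sup>2 * x\<bar> \<le> \<bar>x\<bar>" for x :: real
        using t by (simp_all add: abs_mult mult_left_le_one_le power_le_one)
      have a: "\<bar>Q u (s t)\<bar> \<le> B * norm u * L" "\<bar>Q (D u) (D v)\<bar> \<le> B * norm (D u) * norm (D v)"
        "\<bar>t * Q (D u) (s t)\<bar> \<le> B * norm (D u) * L" "\<bar>Q (r t) v\<bar> \<le> B * K * norm v"
        "\<bar>t * Q (r t) (D v)\<bar> \<le> B * K * norm (D v)" "\<bar>t\<^sup>2 * Q (r t) (s t)\<bar> \<le> B * K * L"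
        using q[of u] B(2)[of "D u" "D v"] order_trans[OF sc(1) q[of "D u"]] q'[of v]
          order_trans[OF sc(1) q'[of "D v"]] order_trans[OF sc(2) q''] by simp_all
      show "\<bar>Q u (s t) + Q (D u) (D v) + t * Q (D u) (s t)
       + Q (r t) v + t * Q (r t) (D v) + t\<^sup>2 * Q (r t) (s t)\<bar> \<le> C"
        unfolding C_def by (intro order_trans[OF abs_triangle_ineq] add_mono a)
    qed (use t in simp)
    finally show ?thesis .
  qed
  have "(\<lambda>n. 1 / real (Suc n) * C) \<longlonglongrightarrow> 0 * C"
    using LIMSEQ_inverse_real_of_nat by (intro tendsto_mult tendsto_const) (simp add: inverse_eq_divide)
  then have "\<bar>c\<bar> \<le> 0 * C"
    by (rule LIMSEQ_le_const) (use bound[of "1 / real (Suc n)" for n] in auto)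
  then show ?thesis by (simp add: c_def)
qed

section \<open>Full bilinearity of the bracket from the invariant norm\<close>

locale compact_lie =
  fixes V :: "'k::euclidean_space set" and br :: "'k \<Rightarrow> 'k \<Rightarrow> 'k" and N :: "'k \<Rightarrow> real"
  assumes sub: "subspace V" and lie: "lie_algebra (subspace_lie V br)"
    and norm: "norm_on (subspace_lie V br) N"
    and inv: "g \<in> adjoint_group V br \<Longrightarrow> y \<in> V \<Longrightarrow> N (g y) = N y"
begin

lemmas V_simps [simp] = subspace_add[OF sub] subspace_scale[OF sub] subspace_diff[OF sub] subspace_0[OF sub]
  subspace_neg[OF sub]

lemma br_closed [simp]: "x \<in> V \<Longrightarrow> y \<in> V \<Longrightarrow> br x y \<in> V"
  using lie_algebra.bracket_closed[OF lie] by (simp add: subspace_lie_def)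

lemma br_add_left: "x \<in> V \<Longrightarrow> y \<in> V \<Longrightarrow> z \<in> V \<Longrightarrow> br (x + y) z = br x z + br y z"
  using lie_algebra.bracket_add[OF lie] by (simp add: subspace_lie_def)

lemma br_scale_left: "x \<in> V \<Longrightarrow> y \<in> V \<Longrightarrow> br (r *\<^sub>R x) y = r *\<^sub>R br x y"
  using lie_algebra.bracket_scale[OF lie] by (simp add: subspace_lie_def)

lemma br_same: "x \<in> V \<Longrightarrow> br x x = 0"
  using lie_algebra.bracket_self[OF lie] by (simp add: subspace_lie_def)

lemma jacobi: "x \<in> V \<Longrightarrow> y \<in> V \<Longrightarrow> z \<in> V \<Longrightarrow> br x (br y z) + (br y (br z x) + br z (br x y)) = 0"
  using lie_algebra.jacobi[OF lie] by (simp add: subspace_lie_def)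

lemma N_props:
  "x \<in> V \<Longrightarrow> 0 \<le> N x" "x \<in> V \<Longrightarrow> y \<in> V \<Longrightarrow> N (x + y) \<le> N x + N y"
  "x \<in> V \<Longrightarrow> N (r *\<^sub>R x) = \<bar>r\<bar> * N x" "x \<in> V \<Longrightarrow> N x = 0 \<Longrightarrow> x = 0"
  using norm by (auto simp: norm_on_def seminorm_on_def subspace_lie_def)

lemma N_exp_ad: "x \<in> V \<Longrightarrow> y \<in> V \<Longrightarrow> N (exp_ad br x y) = N y"
  using inv[OF adjoint_group.step[OF _ adjoint_group.one]] by simp

lemma br_0: "x \<in> V \<Longrightarrow> br x 0 = 0"
proof -
  assume "x \<in> V"
  \<comment> \<open>Jacobi for \<open>x\<close>, \<open>x\<close>, \<open>x\<close>: all inner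
    brackets vanish, leaving three copies of \<open>br x 0\<close>.\<close>
  then have "br x 0 + (br x 0 + br x 0) = 0" using jacobi[of x x x] by (simp add: br_same)
  then have "3 *\<^sub>R br x 0 = 0" by (simp add: scaleR_add_left[of 1 2, simplified] scaleR_2)
  then show ?thesis by simp
qed

lemma br_zero: "y \<in> V \<Longrightarrow> br 0 y = 0"
  using br_scale_left[of 0 y 0] by simp

lemma br_br_swap:
  assumes "x \<in> V" "z \<in> V"
  shows "br x (br z x) = - br x (br x z)"
  using jacobi[of x x z] assms by (simp add: br_same br_0 eq_neg_iff_add_eq_0 add.commute)

text \<open>Jacobi for \<open>y\<close>, \<open>x\<close>, \<open>s *\<^sub>R x\<close>, where the
  remaining scalars sit in first arguments. Homogeneity on values of the bracket is enough for the
  iterates of \<open>br x\<close>.\<close>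

lemma br_br_scale:
  assumes "x \<in> V" "y \<in> V"
  shows "br x (s *\<^sub>R br x y) = s *\<^sub>R br x (br x y)"
proof -
  have "br x (s *\<^sub>R x) = 0"
  proof (cases "s = 0")
    case False
    have "s *\<^sub>R br x (s *\<^sub>R x) = br (s *\<^sub>R x) (s *\<^sub>R x)" using assms by (simp add: br_scale_left)
    then show ?thesis using False assms by (simp add: br_same)
  qed (use assms in \<open>simp add: br_0\<close>)
  then have "br x (s *\<^sub>R br x y) + s *\<^sub>R br x (br y x) = 0"
    using jacobi[of y x "s *\<^sub>R x"] assms by (simp add: br_0 br_scale_left)
  then show ?thesis using br_br_swap[of x y] assms by simp
qed

lemma br_funpow_closed [simp]: "x \<in> V \<Longrightarrow> y \<in> V \<Longrightarrow> (br x ^^ n) y \<in> V"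
  by (induction n) simp_all

lemma br_scale_funpow:
  assumes "x \<in> V" "y \<in> V"
  shows "(br (t *\<^sub>R x) ^^ n) y = t ^ n *\<^sub>R (br x ^^ n) y"
proof (induction n)
  case (Suc n)
  have "br x (t ^ n *\<^sub>R (br x ^^ n) y) = t ^ n *\<^sub>R br x ((br x ^^ n) y)"
  proof (cases n)
    case (Suc m)
    then show ?thesis using br_br_scale[of x "(br x ^^ m) y" "t ^ n"] assms by simp
  qed simp
  then show ?case using Suc assms by (simp add: br_scale_left)
qed simp

lemma br_funpow_0: "x \<in> V \<Longrightarrow> (br x ^^ n) 0 = 0"
  by (induction n) (simp_all add: br_0)

text \<open>The bracket is not assumed to be linear in its second argument, so convergence of the exponential
  series is not automatic. On brackets it holds because the value of a divergent series would be the
  same for \<open>w\<close> and \<open>2 w\<close>.\<close>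

lemma summable_exp_ad_br:
  assumes x: "x \<in> V" and y: "y \<in> V" and w: "w = br x y"
  shows "summable (\<lambda>n. t ^ n *\<^sub>R (br x ^^ n) w /\<^sub>R fact n)"
proof (rule ccontr)
  define f where "f c n = (br (t *\<^sub>R x) ^^ n) (c *\<^sub>R w) /\<^sub>R fact n" for c :: real and n
  have wV: "w \<in> V" using x y w by simp
  have tw: "(br x ^^ n) (2 *\<^sub>R w) = 2 *\<^sub>R (br x ^^ n) w" for n
  proof (induction n)
    case (Suc n)
    have "(br x ^^ n) w = br x ((br x ^^ n) y)"
      unfolding w by (simp add: funpow_swap1)
    then show ?case using Suc br_br_scale[of x "(br x ^^ n) y" 2] x y by simp
  qed simp
  assume not: "\<not> summable (\<lambda>n. t ^ n *\<^sub>R (br x ^^ n) w /\<^sub>R fact n)"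
  have f1: "f 1 = (\<lambda>n. t ^ n *\<^sub>R (br x ^^ n) w /\<^sub>R fact n)"
    using x wV by (simp add: f_def br_scale_funpow fun_eq_iff)
  have f2: "f 2 = (\<lambda>n. 2 *\<^sub>R f 1 n)"
    using x wV by (simp add: f_def br_scale_funpow tw fun_eq_iff)
  have n1: "\<not> summable (f 1)" using not f1 by simp
  have n2: "\<not> summable (f 2)"
  proof
    assume "summable (f 2)"
    then have "summable (\<lambda>n. (1/2) *\<^sub>R f 2 n)" by (rule summable_scaleR_right)
    then show False using n1 by (simp add: f2)
  qed
  \<comment> \<open>\<open>suminf\<close> is a definite description. For a divergent series no
    candidate satisfies it, so both sides are the same unspecified value.\<close>
  have "suminf (f 1) = suminf (f 2)"
    using n1 n2 by (simp add: suminf_def summable_def)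
  then have "exp_ad br (t *\<^sub>R x) w = exp_ad br (t *\<^sub>R x) (2 *\<^sub>R w)"
    by (simp add: exp_ad_def f_def[abs_def])
  then have "N w = N (2 *\<^sub>R w)" using N_exp_ad[of "t *\<^sub>R x" w] N_exp_ad[of "t *\<^sub>R x" "2 *\<^sub>R w"] x wV by simp
  then have "w = 0" using N_props(3)[OF wV, of 2] N_props(4)[OF wV] by simp
  then have "f 1 = (\<lambda>n. 0)" unfolding f1 using x by (simp add: br_funpow_0)
  then show False using n1 by simp
qed

text \<open>The terms of the series of the bracket at the parameter \<open>2 * t\<close> tend to
  zero and are therefore bounded; the spare factor \<open>(1 / 2) ^ n\<close> turns this bound into
  a geometric majorant.\<close>

lemma summable_exp_ad:
  assumes x: "x \<in> V" and y: "y \<in> V"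
  shows "summable (\<lambda>n. t ^ n *\<^sub>R (br x ^^ n) y /\<^sub>R fact n)"
proof -
  define w where "w = br x y"
  have w: "(br x ^^ Suc n) y = (br x ^^ n) w" for n
    unfolding w_def by (simp only: funpow_Suc_right comp_apply)
  have "(\<lambda>n. (2 * t) ^ n *\<^sub>R (br x ^^ n) w /\<^sub>R fact n) \<longlonglongrightarrow> 0"
    by (rule summable_LIMSEQ_zero[OF summable_exp_ad_br[OF x y w_def]])
  then have "Bseq (\<lambda>n. (2 * t) ^ n *\<^sub>R (br x ^^ n) w /\<^sub>R fact n)"
    by (intro convergent_imp_Bseq convergentI)
  then obtain K where K: "\<And>n. norm ((2 * t) ^ n *\<^sub>R (br x ^^ n) w /\<^sub>R fact n) \<le> K"
    unfolding Bseq_def by blast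
  have "summable (\<lambda>n. t ^ Suc n *\<^sub>R (br x ^^ Suc n) y /\<^sub>R fact (Suc n))"
  proof (rule summable_comparison_test')
    show "summable (\<lambda>n. (\<bar>t\<bar> * K) * (1 / 2) ^ n)"
      by (intro summable_mult summable_geometric) simp
    fix n
    have "norm (t ^ Suc n *\<^sub>R (br x ^^ Suc n) y /\<^sub>R fact (Suc n))
      = (\<bar>t\<bar> * (1 / 2) ^ n / (1 + real n)) * norm ((2 * t) ^ n *\<^sub>R (br x ^^ n) w /\<^sub>R fact n)"
    proof -
      let ?a = "\<bar>t\<bar> * \<bar>t\<bar> ^ n * norm ((br x ^^ n) w) * inverse (fact n) * inverse (1 + real n)"
      have h: "(1 / 2) ^ n * 2 ^ n = (1::real)" by (simp flip: power_mult_distrib)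
      have "norm (t ^ Suc n *\<^sub>R (br x ^^ Suc n) y /\<^sub>R fact (Suc n)) = ?a"
        unfolding w by (simp add: abs_mult power_abs)
      also have "\<dots> = ((1 / 2) ^ n * 2 ^ n) * ?a" by (simp only: h mult_1)
      also have "\<dots> = (\<bar>t\<bar> * (1 / 2) ^ n / (1 + real n)) * norm ((2 * t) ^ n *\<^sub>R (br x ^^ n) w /\<^sub>R fact n)"
      proof -
        have "norm ((2 * t) ^ n *\<^sub>R (br x ^^ n) w /\<^sub>R fact n)
            = 2 ^ n * \<bar>t\<bar> ^ n * norm ((br x ^^ n) w) * inverse (fact n)"
          by (simp add: abs_mult power_abs power_mult_distrib)
        then show ?thesis by (simp only: divide_inverse[of _ "1 + real n"] mult_ac)
      qed
      finally show ?thesis .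
    qed
    also have "\<dots> \<le> (\<bar>t\<bar> * (1 / 2) ^ n) * K"
    proof (rule mult_mono)
      show "\<bar>t\<bar> * (1 / 2) ^ n / (1 + real n) \<le> \<bar>t\<bar> * (1 / 2) ^ n"
        using divide_left_mono[of 1 "1 + real n" "\<bar>t\<bar> * (1 / 2) ^ n"] by simp
    qed (use K in auto)
    finally show "norm (t ^ Suc n *\<^sub>R (br x ^^ Suc n) y /\<^sub>R fact (Suc n)) \<le> \<bar>t\<bar> * K * (1 / 2) ^ n"
      by (simp add: mult_ac)
  qed
  then show ?thesis by (rule summable_Suc_iff[THEN iffD1])
qed

lemma exp_ad_closed:
  assumes x: "x \<in> V" and y: "y \<in> V"
  shows "exp_ad br (t *\<^sub>R x) y \<in> V"
proof -
  let ?f = "\<lambda>n. t ^ n *\<^sub>R (br x ^^ n) y /\<^sub>R fact n"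
  have "(\<lambda>n. sum ?f {..<n}) \<longlonglongrightarrow> exp_ad br (t *\<^sub>R x) y"
    using summable_LIMSEQ[OF summable_exp_ad[OF x y, of t]] x y
    by (simp add: exp_ad_def br_scale_funpow)
  moreover have "sum ?f {..<n} \<in> V" for n
    by (rule subspace_sum[OF sub]) (use x y in simp)
  ultimately show ?thesis by (rule closed_sequentially[OF closed_subspace[OF sub], rotated])
qed

text \<open>If all iterates from the second on agree, the two exponential curves differ by
  \<open>(p - x) + t *\<^sub>R d\<close>. The invariant norm keeps this bounded in \<open>t\<close>,
  so the slope \<open>d\<close> is zero.\<close>

lemma br_eq_if_br_br_eq:
  assumes z: "z \<in> V" and p: "p \<in> V" and x: "x \<in> V" and eq: "br z (br z p) = br z (br z x)"
  shows "br z p = br z x"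
proof -
  define d where "d = br z p - br z x"
  have dV: "d \<in> V" "p - x \<in> V" using z p x by (simp_all add: d_def)
  have pow: "(br z ^^ (n + 2)) p = (br z ^^ (n + 2)) x" for n
    by (induction n) (use eq in \<open>simp_all add: numeral_2_eq_2\<close>)
  have bound: "\<bar>t\<bar> * N d \<le> 2 * N p + 2 * N x" for t
  proof -
    let ?f = "\<lambda>y n. t ^ n *\<^sub>R (br z ^^ n) y /\<^sub>R fact n"
    have e: "exp_ad br (t *\<^sub>R z) y = (\<Sum>n. ?f y n)" if "y \<in> V" for y
      using z that by (simp add: exp_ad_def br_scale_funpow)
    have s: "(\<Sum>n. ?f y n) = (\<Sum>n. ?f y (n + 2)) + (y + t *\<^sub>R br z y)" if "y \<in> V" for y
      using suminf_split_initial_segment[OF summable_exp_ad[OF z that, of t], of 2]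
      by (simp add: numeral_2_eq_2)
    have "exp_ad br (t *\<^sub>R z) p - exp_ad br (t *\<^sub>R z) x = (p - x) + t *\<^sub>R d"
      unfolding e[OF p] e[OF x] s[OF p] s[OF x] pow by (simp add: d_def scaleR_diff_right)
    then have E: "t *\<^sub>R d = (exp_ad br (t *\<^sub>R z) p - exp_ad br (t *\<^sub>R z) x) + (x - p)" by simp
    have V: "exp_ad br (t *\<^sub>R z) p \<in> V" "exp_ad br (t *\<^sub>R z) x \<in> V"
      using exp_ad_closed z p x by blast+
    have Nd: "N (u - v) \<le> N u + N v" if "u \<in> V" "v \<in> V" for u v
      using N_props(2)[of u "(-1) *\<^sub>R v"] N_props(3)[of v "-1"] that by simp
    have "N (t *\<^sub>R d) \<le> N (exp_ad br (t *\<^sub>R z) p - exp_ad br (t *\<^sub>R z) x) + N (x - p)"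
      unfolding E by (rule N_props(2)) (use V x p in simp_all)
    also have "\<dots> \<le> (N p + N x) + (N x + N p)"
      using Nd[OF V] Nd[OF x p] N_exp_ad[of "t *\<^sub>R z"] z p x by simp
    finally show ?thesis using N_props(3)[OF dV(1), of t] by simp
  qed
  have "N d = 0"
  proof (rule ccontr)
    assume "N d \<noteq> 0"
    then have "0 < N d" using N_props(1)[OF dV(1)] by simp
    moreover have "0 \<le> N p" "0 \<le> N x" using N_props(1) p x by auto
    ultimately show False using bound[of "(2 * N p + 2 * N x + 1) / N d"] by simp
  qed
  then show ?thesis using N_props(4)[OF dV(1)] by (simp add: d_def)
qed

text \<open>Polarising \<open>br (x + y) (x + y) = 0\<close> takes additivity in the second argument
  only in the form \<open>br z (x + z) = br z x\<close>. By \<open>br_eq_if_br_br_eq\<close> this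
  may be checked after applying \<open>br z\<close> once more, where Jacobi yields it.\<close>

lemma br_anti:
  assumes x: "x \<in> V" and y: "y \<in> V"
  shows "br x y = - br y x"
proof -
  have shift: "br z (x + z) = br z x" if x: "x \<in> V" and z: "z \<in> V" for x z
  proof (rule br_eq_if_br_br_eq)
    let ?p = "x + z"
    have pz: "br ?p z = br x z" and px: "br ?p x = br z x" using x z by (simp_all add: br_add_left br_same)
    have "br x (br z ?p) + (br z (br z x) + (br x (br x z) + br z (br x z))) = 0"
      using jacobi[of x z ?p] x z by (simp add: px br_add_left)
    then have 1: "br x (br z ?p) = - br x (br x z)" using br_br_swap[OF z x] by (simp add: eq_neg_iff_add_eq_0)
    have "br x (br z ?p) + br z (br z ?p) = - (br x (br x z) + br z (br x z))"
      using br_br_swap[of ?p z] x z by (simp add: pz br_add_left)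
    then show "br z (br z ?p) = br z (br z x)" using 1 br_br_swap[OF z x] by simp
  qed (use x z in simp_all)
  have "br (x + y) (x + y) = br x (y + x) + br y (x + y)" using x y by (simp add: br_add_left add.commute)
  then show ?thesis using shift[OF y x] shift[OF x y] br_same[of "x + y"] x y
    by (simp add: eq_neg_iff_add_eq_0)
qed

lemma br_add_right: "x \<in> V \<Longrightarrow> y \<in> V \<Longrightarrow> z \<in> V \<Longrightarrow> br x (y + z) = br x y + br x z"
  using br_anti[of x "y + z"] br_anti[of x y] br_anti[of x z] by (simp add: br_add_left)

lemma br_scale_right: "x \<in> V \<Longrightarrow> y \<in> V \<Longrightarrow> br x (r *\<^sub>R y) = r *\<^sub>R br x y"
  using br_anti[of x "r *\<^sub>R y"] br_anti[of x y] by (simp add: br_scale_left)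

lemma br_derivation:
  assumes "x \<in> V" "y \<in> V" "z \<in> V"
  shows "br x (br y z) = br (br x y) z + br y (br x z)"
proof -
  have "br y (br z x) = - br y (br x z)"
    using br_anti[of z x] br_scale_right[of y "br x z" "-1"] assms by simp
  moreover have "br z (br x y) = - br (br x y) z" using br_anti[of z "br x y"] assms by simp
  ultimately have "br x (br y z) - (br (br x y) z + br y (br x z)) = 0"
    using jacobi[OF assms] by (simp add: algebra_simps)
  then show ?thesis by simp
qed

end

section \<open>The Casimir element\<close>

lemma subspace_projection:
  assumes "subspace (V :: 'k::euclidean_space set)"
  obtains P where "linear P" "\<And>v. P v \<in> V" "\<And>v. v \<in> V \<Longrightarrow> P v = v"
proof -
  obtain g where "g ` UNIV \<subseteq> V" "linear g" "\<forall>v\<in>V. g (id v) = v"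
    using linear_exists_left_inverse_on[OF linear_id assms inj_on_id] by blast
  then show ?thesis by (intro that[of g]) auto
qed

text \<open>Extending the bracket by zero along a complement of \<open>V\<close> reduces everything to an invariant form on the
  whole ambient space.\<close>

lemma (in compact_lie) ambient_invariant_form:
  assumes P: "linear P" "\<And>v. P v \<in> V" "\<And>v. v \<in> V \<Longrightarrow> P v = v"
  obtains Q where "invariant_lie_form (\<lambda>x y. br (P x) (P y)) Q"
proof -
  define b where "b x y = br (P x) (P y)" for x y
  have bV: "b x y \<in> V" and Pb: "P (b x y) = b x y" for x y using P by (simp_all add: b_def)
  have lin1: "linear (b x)" and lin2: "linear (\<lambda>x. b x y)" for x y
    using P(2) by (auto intro!: linearI simp: b_def linear_add[OF P(1)] linear_cmul[OF P(1)]
        br_add_left br_add_right br_scale_left br_scale_right)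
  have b_bil: "bilinear b" using lin1 lin2 by (simp add: bilinear_def)
  \<comment> \<open>The invariant norm on \<open>V\<close> is extended by the Euclidean norm of the
    complementary component.\<close>
  define n where "n v = N (P v) + norm (v - P v)" for v
  have Pd: "P (v - P v) = 0" for v by (simp add: linear_diff[OF P(1)] P(2,3))
  have "vector_norm n"
  proof
    fix x y :: 'k and r :: real
    show "0 \<le> n x" using N_props(1)[OF P(2)] by (simp add: n_def)
    show "x = 0" if "n x = 0"
    proof -
      have "N (P x) = 0" "norm (x - P x) = 0"
        using that N_props(1)[OF P(2), of x] norm_ge_zero[of "x - P x"] unfolding n_def by linarith+
      then show "x = 0" using N_props(4)[OF P(2), of x] by simp
    qed
    have "norm (x + y - P (x + y)) \<le> norm (x - P x) + norm (y - P y)"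
      using norm_triangle_ineq[of "x - P x" "y - P y"] by (simp add: linear_add[OF P(1)] algebra_simps)
    then show "n (x + y) \<le> n x + n y"
      using N_props(2)[OF P(2) P(2), of x y] by (simp add: n_def linear_add[OF P(1)])
    show "n (r *\<^sub>R x) = \<bar>r\<bar> * n x"
      by (simp add: n_def linear_cmul[OF P(1)] N_props(3)[OF P(2)] distrib_left flip: scaleR_diff_right)
  qed
  then interpret vn: vector_norm n .
  obtain Q where Q: "bilinear Q" "\<And>x y. Q x y = Q y x" "\<And>x. x \<noteq> 0 \<Longrightarrow> 0 < Q x x"
    "\<And>g x y. g \<in> vn.isoms \<Longrightarrow> Q (g x) (g y) = (Q x y :: real)"
    using vn.invariant_form by blast
  \<comment> \<open>The exponential of the extended bracket acts on the \<open>V\<close>-component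
    and fixes the complement, so it will be an isometry of \<open>n\<close>.\<close>
  have exp: "(\<Sum>n. (b x ^^ n) u /\<^sub>R fact n) = exp_ad br (P x) (P u) + (u - P u)" for x u
  proof -
    have pow: "(b x ^^ n) u = (br (P x) ^^ n) (P u) + (if n = 0 then u - P u else 0)" for n
    proof (cases n)
      case (Suc m)
      have "(b x ^^ Suc m) u = (br (P x) ^^ Suc m) (P u)"
        by (induction m) (simp_all add: b_def P(2,3))
      then show ?thesis using Suc by simp
    qed simp
    have "(\<lambda>n. (br (P x) ^^ n) (P u) /\<^sub>R fact n) sums exp_ad br (P x) (P u)"
      using summable_sums[OF summable_exp_ad[OF P(2) P(2), of 1 x u]] by (simp add: exp_ad_def)
    moreover have "(\<lambda>n. (if n = 0 then u - P u else 0)) sums (u - P u)"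
      using sums_single[of 0 "\<lambda>_. u - P u"] by simp
    ultimately have "(\<lambda>n. (br (P x) ^^ n) (P u) /\<^sub>R fact n + (if n = 0 then u - P u else 0))
        sums (exp_ad br (P x) (P u) + (u - P u))" by (rule sums_add)
    moreover have "(\<lambda>n. (br (P x) ^^ n) (P u) /\<^sub>R fact n + (if n = 0 then u - P u else 0))
        = (\<lambda>n. (b x ^^ n) u /\<^sub>R fact n)"
      by (auto simp: pow fun_eq_iff)
    ultimately show ?thesis by (simp add: sums_iff)
  qed
  have iso: "(\<lambda>u. \<Sum>n. (b x ^^ n) u /\<^sub>R fact n) \<in> vn.isoms" for x
  proof -
    have "n (exp_ad br (P x) (P u) + (u - P u)) = n u" for u
    proof -
      have "exp_ad br (P x) (P u) \<in> V" using exp_ad_closed[OF P(2) P(2), of 1] by simp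
      then have "P (exp_ad br (P x) (P u) + (u - P u)) = exp_ad br (P x) (P u)"
        by (simp add: linear_add[OF P(1)] P(3) Pd)
      then show ?thesis by (simp add: n_def N_exp_ad P(2))
    qed
    then show ?thesis using linear_exp_series[OF lin1, of x] by (simp add: vn.isoms_def exp)
  qed
  have "invariant_lie_form b Q"
  proof
    fix x y z
    show "b x (b y z) = b (b x y) z + b y (b x z)"
      using bV by (simp add: b_def P(2,3) br_derivation[of "P x" "P y" "P z"])
    show "Q (b x y) z = - Q y (b x z)"
    proof (rule infinitesimal_invariance[OF lin1 Q(1)])
      fix t u v
      have "(\<lambda>v. t *\<^sub>R b x v) = b (t *\<^sub>R x)"
        using linear_cmul[OF lin2] by (simp add: fun_eq_iff)
      then show "Q (\<Sum>n. ((\<lambda>v. t *\<^sub>R b x v) ^^ n) u /\<^sub>R fact n) (\<Sum>n. ((\<lambda>v. t *\<^sub>R b x v) ^^ n) v /\<^sub>R fact n) = Q u v"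
        using Q(4)[OF iso[of "t *\<^sub>R x"]] by simp
    qed
    show "bilinear b" "bilinear Q" "Q x y = Q y x" "x \<noteq> 0 \<Longrightarrow> 0 < Q x x"
      by (fact b_bil Q(1-3))+
    show "b x x = 0" by (simp add: b_def br_same P(2))
  qed
  then show ?thesis by (intro that[of Q]) (simp only: b_def[abs_def])
qed

text \<open>A cocycle that descends to the quotient by the centre. The last clause is essential: on
  an abelian algebra every skew bilinear form satisfies the cocycle identity, but only zero is a
  coboundary.\<close>

definition (in compact_lie) central_cocycle :: "('k \<Rightarrow> 'k \<Rightarrow> 'b::real_vector) \<Rightarrow> bool" where
  "central_cocycle \<theta> \<longleftrightarrow>
     (\<forall>x\<in>V. \<forall>y\<in>V. \<forall>z\<in>V. \<theta> (x + y) z = \<theta> x z + \<theta> y z) \<and>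
     (\<forall>r. \<forall>x\<in>V. \<forall>y\<in>V. \<theta> (r *\<^sub>R x) y = r *\<^sub>R \<theta> x y) \<and>
     (\<forall>x\<in>V. \<forall>y\<in>V. \<theta> x y = - \<theta> y x) \<and>
     (\<forall>r\<in>V. \<forall>x\<in>V. \<forall>y\<in>V. \<theta> r (br x y) = \<theta> (br r x) y + \<theta> x (br r y)) \<and>
     (\<forall>z\<in>V. \<forall>y\<in>V. (\<forall>w\<in>V. br z w = 0) \<longrightarrow> \<theta> z y = 0)"

text \<open>The elements \<open>p i\<close> and \<open>q i\<close> invert the Casimir operator of the derived algebra.\<close>

definition (in compact_lie) casimir :: "'i set \<Rightarrow> ('i \<Rightarrow> 'k) \<Rightarrow> ('i \<Rightarrow> 'k) \<Rightarrow> bool" where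
  "casimir I p q \<longleftrightarrow> finite I \<and> (\<forall>i. p i \<in> V \<and> q i \<in> V) \<and>
     (\<forall>x\<in>V. \<forall>y\<in>V. (\<Sum>i\<in>I. br (p i) (br (q i) (br x y))) = br x y) \<and>
     (\<forall>x\<in>V. \<forall>y\<in>V. br (x - (\<Sum>i\<in>I. br (p i) (br (q i) x))) y = 0) \<and>
     (\<forall>\<theta> :: 'k \<Rightarrow> 'k \<Rightarrow> real. central_cocycle \<theta> \<longrightarrow>
        (\<forall>x\<in>V. \<forall>y\<in>V. \<theta> x y = (\<Sum>i\<in>I. \<theta> (p i) (br (q i) (br x y)))))"

text \<open>The pairs are an orthonormal basis and its preimages under the ambient Casimir operator,
  projected to \<open>V\<close>; the extended bracket is not changed by the projection.\<close>

lemma (in compact_lie) casimir_exists: "\<exists>(I :: 'k set) p q. casimir I p q"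
proof -
  obtain P where P: "linear P" "\<And>v. P v \<in> V" "\<And>v. v \<in> V \<Longrightarrow> P v = v"
    by (rule subspace_projection[OF sub]) blast
  obtain Q where "invariant_lie_form (\<lambda>x y. br (P x) (P y)) Q"
    by (rule ambient_invariant_form[OF P])
  then interpret L: invariant_lie_form "\<lambda>x y. br (P x) (P y)" Q .
  define p where "p e = P e" for e
  define q where "q e = P (L.dual e)" for e
  have V: "p e \<in> V" "q e \<in> V" for e by (simp_all add: p_def q_def P(2))
  have der: "L.der x = (\<Sum>e\<in>L.onb. br (p e) (br (q e) x))" if "x \<in> V" for x
    using that P(2) by (simp add: L.der_def p_def q_def P(3))
  have derV: "L.der x \<in> V" for x unfolding L.der_def by (rule subspace_sum[OF sub]) (simp add: P(2))
  show ?thesis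
    unfolding casimir_def
  proof (rule exI[of _ L.onb], rule exI[of _ p], rule exI[of _ q], intro conjI allI ballI impI)
    show "finite L.onb" by (rule L.onb(1))
    show "p i \<in> V" for i by (rule V)
    show "q i \<in> V" for i by (rule V)
  next
    fix x y assume x: "x \<in> V" and y: "y \<in> V"
    show "(\<Sum>i\<in>L.onb. br (p i) (br (q i) (br x y))) = br x y"
      using L.der_br[of x y] der[of "br x y"] x y by (simp add: P(3))
    show "br (x - (\<Sum>i\<in>L.onb. br (p i) (br (q i) x))) y = 0"
      using L.br_der[of x y] der[OF x] derV[of x] x y by (simp add: P(3))
  next
    fix \<theta> :: "'k \<Rightarrow> 'k \<Rightarrow> real" and x y
    assume coc: "central_cocycle \<theta>" and x: "x \<in> V" and y: "y \<in> V"
    have add: "x \<in> V \<Longrightarrow> y \<in> V \<Longrightarrow> z \<in> V \<Longrightarrow> \<theta> (x + y) z = \<theta> x z + \<theta> y z" for x y z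
      using coc unfolding central_cocycle_def by blast
    have sc: "x \<in> V \<Longrightarrow> y \<in> V \<Longrightarrow> \<theta> (r *\<^sub>R x) y = r * \<theta> x y" for r x y
      using coc unfolding central_cocycle_def real_scaleR_def by blast
    have sk: "x \<in> V \<Longrightarrow> y \<in> V \<Longrightarrow> \<theta> x y = - \<theta> y x" for x y
      using coc unfolding central_cocycle_def by blast
    have co: "r \<in> V \<Longrightarrow> x \<in> V \<Longrightarrow> y \<in> V \<Longrightarrow> \<theta> r (br x y) = \<theta> (br r x) y + \<theta> x (br r y)" for r x y
      using coc unfolding central_cocycle_def by blast
    have ce: "z \<in> V \<Longrightarrow> y \<in> V \<Longrightarrow> (\<And>w. w \<in> V \<Longrightarrow> br z w = 0) \<Longrightarrow> \<theta> z y = 0" for z y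
      using coc unfolding central_cocycle_def by blast
    \<comment> \<open>\<theta> is controlled on \<open>V\<close> only; composing with
      \<open>P\<close> makes it a bilinear form on the whole space.\<close>
    define \<eta> where "\<eta> x y = \<theta> (P x) (P y)" for x y
    have sk': "\<eta> x y = - \<eta> y x" for x y unfolding \<eta>_def by (rule sk) (simp_all add: P(2))
    have l: "linear (\<lambda>x. \<eta> x y)" for y
      by (rule linearI) (simp_all add: \<eta>_def linear_add[OF P(1)] linear_cmul[OF P(1)] add sc P(2))
    have "linear (\<eta> x)" for x
    proof -
      have "\<eta> x = (\<lambda>y. - \<eta> y x)" by (rule ext) (rule sk')
      then show ?thesis using linear_compose_neg[OF l] by simp
    qed
    then have bil: "bilinear \<eta>" using l by (simp add: bilinear_def)
    have "\<eta> x y = (\<Sum>e\<in>L.onb. \<eta> e (br (P (L.dual e)) (P (br (P x) (P y)))))"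
    proof (rule L.cocycle_eq_der[OF bil sk'])
      show "\<eta> r (br (P x) (P y)) = \<eta> (br (P r) (P x)) y + \<eta> x (br (P r) (P y))" for r x y
        using co[OF P(2) P(2) P(2), of r x y] P(2) by (simp add: \<eta>_def P(3))
      show "\<eta> z y = 0" if "\<And>w. br (P z) (P w) = 0" for z y
        unfolding \<eta>_def by (rule ce[OF P(2) P(2)]) (metis that P(3))
    qed
    then show "\<theta> x y = (\<Sum>i\<in>L.onb. \<theta> (p i) (br (q i) (br x y)))"
      using x y P(2) by (simp add: \<eta>_def p_def q_def P(3))
  qed
qed

section \<open>Smooth functions and bump functions\<close>

text \<open>As soon as the derivatives of the generators lie in the hull, so do all higher
  derivatives of its elements. This takes the place of explicit higher Leibniz and chain rule
  formulas.\<close>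

inductive_set algebra_hull :: "('a \<Rightarrow> real) set \<Rightarrow> ('a \<Rightarrow> real) set" for G where
  gen: "g \<in> G \<Longrightarrow> g \<in> algebra_hull G"
| const: "(\<lambda>_. c) \<in> algebra_hull G"
| add: "f \<in> algebra_hull G \<Longrightarrow> g \<in> algebra_hull G \<Longrightarrow> (\<lambda>x. f x + g x) \<in> algebra_hull G"
| mult: "f \<in> algebra_hull G \<Longrightarrow> g \<in> algebra_hull G \<Longrightarrow> (\<lambda>x. f x * g x) \<in> algebra_hull G"

text \<open>\<open>R\<close> relates a function to its derivative; it is instantiated by derivatives
  on the line and by directional derivatives on the interior of a half-space.\<close>

lemma algebra_hull_derivation:
  assumes gens: "\<And>g. g \<in> G \<Longrightarrow> \<exists>g'\<in>algebra_hull G. R g g'"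
    and const: "\<And>c. R (\<lambda>_. c) (\<lambda>_. 0)"
    and add: "\<And>f f' g g'. R f f' \<Longrightarrow> R g g' \<Longrightarrow> R (\<lambda>x. f x + g x) (\<lambda>x. f' x + g' x)"
    and mult: "\<And>f f' g g'. R f f' \<Longrightarrow> R g g' \<Longrightarrow> R (\<lambda>x. f x * g x) (\<lambda>x. f' x * g x + f x * g' x)"
    and f: "f \<in> algebra_hull G"
  shows "\<exists>f'\<in>algebra_hull G. R f f'"
  using f
proof induction
  case (const c)
  show ?case using assms(2) algebra_hull.const by blast
next
  case (add f g)
  then show ?case using assms(3) algebra_hull.add by blast
next
  case (mult f g)
  then obtain f' g' where "f' \<in> algebra_hull G" "R f f'" "g' \<in> algebra_hull G" "R g g'" by blast
  moreover have "(\<lambda>x. f' x * g x + f x * g' x) \<in> algebra_hull G"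
    using calculation mult.hyps algebra_hull.add[OF algebra_hull.mult algebra_hull.mult] by blast
  ultimately show ?case using assms(4) by blast
qed (rule gens)

text \<open>The powers of \<open>x\<close> in the denominator are those produced by repeated
  differentiation of \<open>exp (- 1 / x)\<close>, so derivatives stay in the linear span of the
  family.\<close>

definition flat_exp :: "nat \<Rightarrow> real \<Rightarrow> real" where
  "flat_exp n x = (if 0 < x then exp (- 1 / x) / x ^ n else 0)"

lemma tendsto_flat_exp: "(flat_exp n \<longlongrightarrow> 0) (at 0)"
proof -
  have "((\<lambda>x. (inverse x) ^ n / exp (inverse x)) \<longlongrightarrow> 0) (at_right (0::real))"
    by (rule filterlim_compose[OF tendsto_power_div_exp_0 filterlim_inverse_at_top_right])
  then have "(flat_exp n \<longlongrightarrow> 0) (at_right 0)"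
    by (rule Lim_transform_eventually)
      (auto simp: eventually_at_filter flat_exp_def exp_minus field_simps)
  moreover have "(flat_exp n \<longlongrightarrow> 0) (at_left 0)"
    by (rule Lim_transform_eventually[OF tendsto_const])
      (auto simp: eventually_at_filter flat_exp_def)
  ultimately show ?thesis by (simp add: filterlim_split_at_real)
qed

lemma has_real_derivative_flat_exp:
  "(flat_exp n has_real_derivative flat_exp (n + 2) x - real n * flat_exp (n + 1) x) (at x)"
proof -
  consider "x < 0" | "x = 0" | "0 < x" by linarith
  then show ?thesis
  proof cases
    case 1
    have "((\<lambda>_. 0) has_real_derivative 0) (at x)" by simp
    then have "(flat_exp n has_real_derivative 0) (at x)"
      by (rule DERIV_cong_ev[THEN iffD1, rotated -1])
        (use 1 eventually_nhds_in_open[of "{..<0}" x] in \<open>auto simp: flat_exp_def elim!: eventually_mono\<close>)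
    then show ?thesis using 1 by (simp add: flat_exp_def)
  next
    case 2
    \<comment> \<open>The difference quotient at the origin is the next member of the family,
      \<open>flat_exp (Suc n)\<close>.\<close>
    have "((\<lambda>h. (flat_exp n (0 + h) - flat_exp n 0) / h) \<longlongrightarrow> 0) (at 0)"
      by (rule Lim_transform_eventually[OF tendsto_flat_exp[of "Suc n"]])
        (auto simp: eventually_at_filter flat_exp_def)
    then have "(flat_exp n has_real_derivative 0) (at 0)" by (simp add: DERIV_def)
    then show ?thesis using 2 by (simp add: flat_exp_def)
  next
    case 3
    have eq: "flat_exp m z = exp (- 1 / z - real m * ln z)" if "0 < z" for m z
      using that by (simp add: flat_exp_def exp_diff exp_of_nat_mult)
    have "((\<lambda>z. exp (- 1 / z - real n * ln z)) has_real_derivative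
        exp (- 1 / x - real n * ln x) * (1 / x\<^sup>2 - real n / x)) (at x)"
      using 3 by (auto intro!: derivative_eq_intros simp: power2_eq_square)
    also have "exp (- 1 / x - real n * ln x) * (1 / x\<^sup>2 - real n / x)
        = flat_exp (n + 2) x - real n * flat_exp (n + 1) x"
      unfolding eq[OF 3, symmetric] using 3
      by (simp add: flat_exp_def right_diff_distrib power2_eq_square mult_ac)
    finally show ?thesis
      by (rule DERIV_cong_ev[THEN iffD1, rotated -1])
        (use 3 eventually_nhds_in_open[of "{0<..}" x] in \<open>auto simp: eq elim!: eventually_mono\<close>)
  qed
qed

text \<open>A set closed under derivatives consists of smooth functions; this is how smoothness on the line is
  expressed here.\<close>

definition derivative_closed :: "(real \<Rightarrow> real) set \<Rightarrow> bool" where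
  "derivative_closed H \<longleftrightarrow> (\<forall>h\<in>H. \<exists>h'\<in>H. \<forall>x. (h has_real_derivative h' x) (at x))"

text \<open>The step is \<open>E 0 / (E 0 + F 0)\<close>, where \<open>E\<close> vanishes from 2 on
  and \<open>F\<close> up to 1. Adjoining the reciprocal \<open>J\<close> of the denominator as a
  generator keeps the hull closed under derivatives, since the derivative of \<open>J\<close> is a
  polynomial in \<open>J\<close> and derivatives of \<open>E 0\<close> and
  \<open>F 0\<close>.\<close>

lemma smooth_step_exists:
  "\<exists>H h. derivative_closed H \<and> h \<in> H \<and> (\<forall>x\<le>1. h x = 1) \<and> (\<forall>x\<ge>2. h x = (0::real))"
proof -
  define E where "E n x = flat_exp n (2 - x)" for n x
  define F where "F n x = flat_exp n (x - 1)" for n x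
  define J where "J x = inverse (E 0 x + F 0 x)" for x
  define G where "G = range E \<union> range F \<union> {J}"
  have E': "(E n has_real_derivative - (E (n + 2) x - real n * E (n + 1) x)) (at x)" for n x
    unfolding E_def by (rule DERIV_cong[OF DERIV_chain2[OF has_real_derivative_flat_exp]])
      (auto intro!: derivative_eq_intros)
  have F': "(F n has_real_derivative F (n + 2) x - real n * F (n + 1) x) (at x)" for n x
    unfolding F_def by (rule DERIV_cong[OF DERIV_chain2[OF has_real_derivative_flat_exp]])
      (auto intro!: derivative_eq_intros)
  have pos: "0 < E 0 x + F 0 x" for x
    by (cases "x < 2") (auto simp: E_def F_def flat_exp_def add_pos_nonneg add_nonneg_pos)
  have J': "(J has_real_derivative - ((E' + F') * (J x * J x))) (at x)"
    if "(E 0 has_real_derivative E') (at x)" "(F 0 has_real_derivative F') (at x)" for E' F' x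
    unfolding J_def using DERIV_inverse'[OF DERIV_add[OF that]] pos[of x] by (simp add: mult_ac)
  define R where "R f f' \<longleftrightarrow> (\<forall>x. (f has_real_derivative f' x) (at x))" for f f' :: "real \<Rightarrow> real"
  note hull = algebra_hull.intros[where G = G]
  have inG: "E n \<in> algebra_hull G" "F n \<in> algebra_hull G" "J \<in> algebra_hull G" for n
    by (intro hull(1); simp add: G_def)+
  have neg: "(\<lambda>x. - f x) \<in> algebra_hull G" if "f \<in> algebra_hull G" for f
    using hull(4)[OF hull(2)[of "-1"] that] by simp
  have comb: "(\<lambda>x. f x - c * g x) \<in> algebra_hull G" if "f \<in> algebra_hull G" "g \<in> algebra_hull G" for f g c
    using hull(3)[OF that(1) hull(4)[OF hull(2)[of "-c"] that(2)]] by simp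
  have "\<exists>g'\<in>algebra_hull G. R g g'" if g: "g \<in> G" for g
  proof -
    consider n where "g = E n" | n where "g = F n" | "g = J" using g by (auto simp: G_def)
    then show ?thesis
    proof cases
      case 1
      have "R g (\<lambda>x. - (E (n + 2) x - real n * E (n + 1) x))" unfolding 1 R_def using E' by blast
      then show ?thesis using neg[OF comb[OF inG(1) inG(1)]] by blast
    next
      case 2
      have "R g (\<lambda>x. F (n + 2) x - real n * F (n + 1) x)" unfolding 2 R_def using F' by blast
      then show ?thesis using comb[OF inG(2) inG(2)] by blast
    next
      case 3
      define D where "D x = - (E (0 + 2) x - real 0 * E (0 + 1) x) + (F (0 + 2) x - real 0 * F (0 + 1) x)" for x
      have "R g (\<lambda>x. - (D x * (J x * J x)))" unfolding 3 R_def D_def using J'[OF E' F'] by blast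
      moreover have "(\<lambda>x. - (D x * (J x * J x))) \<in> algebra_hull G"
        unfolding D_def by (rule neg[OF hull(4)[OF hull(3)[OF neg[OF comb[OF inG(1) inG(1)]] comb[OF inG(2) inG(2)]]
              hull(4)[OF inG(3) inG(3)]]])
      ultimately show ?thesis by blast
    qed
  qed
  then have "\<exists>f'\<in>algebra_hull G. R f f'" if "f \<in> algebra_hull G" for f
    by (rule algebra_hull_derivation[OF _ _ _ _ that])
      (auto simp: R_def intro!: derivative_eq_intros)
  then have "derivative_closed (algebra_hull G)" unfolding derivative_closed_def R_def by blast
  moreover have "(\<lambda>x. E 0 x * J x) \<in> algebra_hull G" by (rule hull(4)[OF inG(1) inG(3)])
  moreover have "E 0 x * J x = 1" if "x \<le> 1" for x
    using that by (simp add: J_def E_def F_def flat_exp_def)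
  moreover have "E 0 x * J x = 0" if "2 \<le> x" for x
    using that by (simp add: E_def flat_exp_def)
  ultimately show ?thesis by blast
qed

section \<open>Calculus of smooth functions on half-spaces\<close>

lemma smooth_on_coinduct:
  assumes cont: "\<And>f. f \<in> \<S> \<Longrightarrow> continuous_on S f"
    and deriv: "\<And>f b. f \<in> \<S> \<Longrightarrow> b \<in> B \<Longrightarrow> \<exists>f'\<in>\<S>. \<forall>y\<in>S \<inter> half_space_interior B b0.
      ((\<lambda>t. f (y + t *\<^sub>R b)) has_vector_derivative f' y) (at 0)"
    and f: "f \<in> \<S>"
  shows "smooth_on B b0 S f"
proof -
  obtain d where d: "\<And>f b. f \<in> \<S> \<Longrightarrow> b \<in> B \<Longrightarrow> d f b \<in> \<S> \<and> (\<forall>y\<in>S \<inter> half_space_interior B b0.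
      ((\<lambda>t. f (y + t *\<^sub>R b)) has_vector_derivative d f b y) (at 0))"
    using deriv by metis
  \<comment> \<open>Derivatives are chosen once for every member of the family; folding along the
    list applies the head last, as \<open>is_jet\<close> prescribes.\<close>
  define D where "D \<alpha> = foldr (\<lambda>b g. d g b) \<alpha> f" for \<alpha>
  have DS: "D \<alpha> \<in> \<S>" if "\<alpha> \<in> lists B" for \<alpha>
    using that by (induction \<alpha>) (use d f in \<open>auto simp: D_def\<close>)
  have "is_jet B b0 S f D"
    unfolding is_jet_def
  proof (intro conjI ballI)
    fix \<alpha> b y assume "\<alpha> \<in> lists B" "b \<in> B" "y \<in> S \<inter> half_space_interior B b0"
    then show "((\<lambda>t. D \<alpha> (y + t *\<^sub>R b)) has_vector_derivative D (b # \<alpha>) y) (at 0)"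
      using d[OF DS] by (simp add: D_def)
  qed (use DS cont in \<open>auto simp: D_def\<close>)
  then show ?thesis unfolding smooth_on_def by blast
qed

lemma smooth_on_algebra_hull:
  assumes cont: "\<And>g. g \<in> G \<Longrightarrow> continuous_on S g"
    and deriv: "\<And>g b. g \<in> G \<Longrightarrow> b \<in> B \<Longrightarrow> \<exists>g'\<in>algebra_hull G. \<forall>y\<in>S \<inter> half_space_interior B b0.
      ((\<lambda>t. g (y + t *\<^sub>R b)) has_vector_derivative g' y) (at 0)"
    and f: "f \<in> algebra_hull G"
  shows "smooth_on B b0 S f"
proof (rule smooth_on_coinduct[OF _ _ f])
  fix f assume "f \<in> algebra_hull G"
  then show "continuous_on S f" by induction (auto intro: cont continuous_intros)
next
  fix f b assume f: "f \<in> algebra_hull G" and b: "b \<in> B"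
  show "\<exists>f'\<in>algebra_hull G. \<forall>y\<in>S \<inter> half_space_interior B b0.
      ((\<lambda>t. f (y + t *\<^sub>R b)) has_vector_derivative f' y) (at 0)"
    using deriv[OF _ b]
  proof (rule algebra_hull_derivation[OF _ _ _ _ f])
    fix f f' g g' :: "'a \<Rightarrow> real"
    assume f: "\<forall>y\<in>S \<inter> half_space_interior B b0. ((\<lambda>t. f (y + t *\<^sub>R b)) has_vector_derivative f' y) (at 0)"
      and g: "\<forall>y\<in>S \<inter> half_space_interior B b0. ((\<lambda>t. g (y + t *\<^sub>R b)) has_vector_derivative g' y) (at 0)"
    show "\<forall>y\<in>S \<inter> half_space_interior B b0.
        ((\<lambda>t. f (y + t *\<^sub>R b) + g (y + t *\<^sub>R b)) has_vector_derivative f' y + g' y) (at 0)"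
      using f g by (auto intro: has_vector_derivative_add)
    show "\<forall>y\<in>S \<inter> half_space_interior B b0.
        ((\<lambda>t. f (y + t *\<^sub>R b) * g (y + t *\<^sub>R b)) has_vector_derivative f' y * g y + f y * g' y) (at 0)"
    proof
      fix y assume "y \<in> S \<inter> half_space_interior B b0"
      then show "((\<lambda>t. f (y + t *\<^sub>R b) * g (y + t *\<^sub>R b)) has_vector_derivative f' y * g y + f y * g' y) (at 0)"
        using has_vector_derivative_mult[OF bspec[OF f] bspec[OF g], of y y] by (simp add: add.commute)
    qed
  qed auto
qed

lemma is_jetD:
  assumes "is_jet B b0 S f D"
  shows "\<And>y. y \<in> S \<Longrightarrow> D [] y = f y" "\<And>\<alpha>. \<alpha> \<in> lists B \<Longrightarrow> continuous_on S (D \<alpha>)"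
    "\<And>\<alpha> b y. \<alpha> \<in> lists B \<Longrightarrow> b \<in> B \<Longrightarrow> y \<in> S \<Longrightarrow> y \<in> half_space_interior B b0 \<Longrightarrow>
       ((\<lambda>t. D \<alpha> (y + t *\<^sub>R b)) has_vector_derivative D (b # \<alpha>) y) (at 0)"
  using assms by (auto simp: is_jet_def)

lemma smooth_on_cong: "(\<And>y. y \<in> S \<Longrightarrow> f y = g y) \<Longrightarrow> smooth_on B b0 S f \<longleftrightarrow> smooth_on B b0 S g"
  by (simp add: smooth_on_def is_jet_def)

lemma smooth_on_subset:
  assumes "smooth_on B b0 S f" and T: "T \<subseteq> S"
  shows "smooth_on B b0 T f"
proof -
  obtain D where D: "is_jet B b0 S f D" using assms by (auto simp: smooth_on_def)
  have "is_jet B b0 T f D"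
    unfolding is_jet_def
  proof (intro conjI ballI)
    fix y assume "y \<in> T"
    then show "D [] y = f y" using is_jetD(1)[OF D] T by blast
  next
    fix \<alpha> assume "\<alpha> \<in> lists B"
    then show "continuous_on T (D \<alpha>)" using continuous_on_subset[OF is_jetD(2)[OF D] T] by blast
  next
    fix \<alpha> b y assume "\<alpha> \<in> lists B" "b \<in> B" "y \<in> T \<inter> half_space_interior B b0"
    then show "((\<lambda>t. D \<alpha> (y + t *\<^sub>R b)) has_vector_derivative D (b # \<alpha>) y) (at 0)"
      using T by (intro is_jetD(3)[OF D]) auto
  qed
  then show ?thesis unfolding smooth_on_def by blast
qed

lemma smooth_on_const: "smooth_on B b0 S (\<lambda>_. c)"
  unfolding smooth_on_def is_jet_def
  by (rule exI[of _ "\<lambda>\<alpha> _. if \<alpha> = [] then c else 0"]) simp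

lemma smooth_on_bounded_linear:
  assumes L: "bounded_linear L" and f: "smooth_on B b0 S f"
  shows "smooth_on B b0 S (\<lambda>y. L (f y))"
proof -
  obtain D where D: "is_jet B b0 S f D" using f by (auto simp: smooth_on_def)
  have "is_jet B b0 S (\<lambda>y. L (f y)) (\<lambda>\<alpha> y. L (D \<alpha> y))"
    unfolding is_jet_def
  proof (intro conjI ballI)
    fix y assume "y \<in> S"
    then show "L (D [] y) = L (f y)" using is_jetD(1)[OF D] by simp
  next
    fix \<alpha> assume "\<alpha> \<in> lists B"
    then show "continuous_on S (\<lambda>y. L (D \<alpha> y))"
      by (intro bounded_linear.continuous_on[OF L] is_jetD(2)[OF D])
  next
    fix \<alpha> b y assume "\<alpha> \<in> lists B" "b \<in> B" "y \<in> S \<inter> half_space_interior B b0"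
    then show "((\<lambda>t. L (D \<alpha> (y + t *\<^sub>R b))) has_vector_derivative L (D (b # \<alpha>) y)) (at 0)"
      by (intro bounded_linear.has_vector_derivative[OF L] is_jetD(3)[OF D]) auto
  qed
  then show ?thesis unfolding smooth_on_def by blast
qed

lemma smooth_on_add:
  assumes f: "smooth_on B b0 S f" and g: "smooth_on B b0 S g"
  shows "smooth_on B b0 S (\<lambda>y. f y + g y)"
proof -
  obtain D E where D: "is_jet B b0 S f D" "is_jet B b0 S g E" using f g by (auto simp: smooth_on_def)
  have "is_jet B b0 S (\<lambda>y. f y + g y) (\<lambda>\<alpha> y. D \<alpha> y + E \<alpha> y)"
    unfolding is_jet_def
  proof (intro conjI ballI)
    fix y assume "y \<in> S"
    then show "D [] y + E [] y = f y + g y" using is_jetD(1)[OF D(1)] is_jetD(1)[OF D(2)] by simp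
  next
    fix \<alpha> assume "\<alpha> \<in> lists B"
    then show "continuous_on S (\<lambda>y. D \<alpha> y + E \<alpha> y)"
      by (intro continuous_on_add is_jetD(2)[OF D(1)] is_jetD(2)[OF D(2)])
  next
    fix \<alpha> b y assume "\<alpha> \<in> lists B" "b \<in> B" "y \<in> S \<inter> half_space_interior B b0"
    then show "((\<lambda>t. D \<alpha> (y + t *\<^sub>R b) + E \<alpha> (y + t *\<^sub>R b)) has_vector_derivative
        D (b # \<alpha>) y + E (b # \<alpha>) y) (at 0)"
      by (intro has_vector_derivative_add is_jetD(3)[OF D(1)] is_jetD(3)[OF D(2)]) auto
  qed
  then show ?thesis unfolding smooth_on_def by blast
qed

lemma smooth_on_sum:
  "(\<And>i. i \<in> I \<Longrightarrow> smooth_on B b0 S (f i)) \<Longrightarrow> smooth_on B b0 S (\<lambda>y. \<Sum>i\<in>I. f i y)"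
  by (induction I rule: infinite_finite_induct) (simp_all add: smooth_on_const smooth_on_add)

text \<open>The jets of both factors generate an algebra closed under directional
  derivatives.\<close>

lemma smooth_on_mult:
  fixes f g :: "'m::euclidean_space \<Rightarrow> real"
  assumes f: "smooth_on B b0 S f" and g: "smooth_on B b0 S g"
  shows "smooth_on B b0 S (\<lambda>y. f y * g y)"
proof -
  obtain D E where D: "is_jet B b0 S f D" "is_jet B b0 S g E" using f g by (auto simp: smooth_on_def)
  define G where "G = D ` lists B \<union> E ` lists B"
  have "(\<lambda>y. D [] y * E [] y) \<in> algebra_hull G"
    by (intro algebra_hull.intros) (auto simp: G_def)
  then have "smooth_on B b0 S (\<lambda>y. D [] y * E [] y)"
  proof (rule smooth_on_algebra_hull[rotated -1])
    fix h b assume "h \<in> G" "b \<in> B"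
    then consider \<alpha> where "\<alpha> \<in> lists B" "h = D \<alpha>" | \<alpha> where "\<alpha> \<in> lists B" "h = E \<alpha>" by (auto simp: G_def)
    then show "\<exists>g'\<in>algebra_hull G. \<forall>y\<in>S \<inter> half_space_interior B b0.
      ((\<lambda>t. h (y + t *\<^sub>R b)) has_vector_derivative g' y) (at 0)"
    proof cases
      case 1
      then have "D (b # \<alpha>) \<in> algebra_hull G" using \<open>b \<in> B\<close>
        by (intro algebra_hull.gen) (auto simp: G_def simp del: in_lists_conv_set)
      then show ?thesis using is_jetD(3)[OF D(1)] 1 \<open>b \<in> B\<close> by blast
    next
      case 2
      then have "E (b # \<alpha>) \<in> algebra_hull G" using \<open>b \<in> B\<close>
        by (intro algebra_hull.gen) (auto simp: G_def simp del: in_lists_conv_set)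
      then show ?thesis using is_jetD(3)[OF D(2)] 2 \<open>b \<in> B\<close> by blast
    qed
  qed (use is_jetD(2)[OF D(1)] is_jetD(2)[OF D(2)] in \<open>auto simp: G_def\<close>)
  then show ?thesis using smooth_on_cong[of S "\<lambda>y. D [] y * E [] y" "\<lambda>y. f y * g y"]
      is_jetD(1)[OF D(1)] is_jetD(1)[OF D(2)] by simp
qed

text \<open>Generators are the jets of \<open>f\<close> and its compositions with all members of
  \<open>H\<close>, so the chain rule stays inside the hull.\<close>

lemma smooth_on_compose:
  fixes f :: "'m::euclidean_space \<Rightarrow> real"
  assumes f: "smooth_on B b0 S f" and H: "derivative_closed H" and h: "h \<in> H"
  shows "smooth_on B b0 S (\<lambda>y. h (f y))"
proof -
  obtain D where D: "is_jet B b0 S f D" using f by (auto simp: smooth_on_def)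
  define G where "G = D ` lists B \<union> (\<lambda>h y. h (D [] y)) ` H"
  have "(\<lambda>y. h (D [] y)) \<in> algebra_hull G"
    using h by (intro algebra_hull.gen) (auto simp: G_def)
  then have "smooth_on B b0 S (\<lambda>y. h (D [] y))"
  proof (rule smooth_on_algebra_hull[rotated -1])
    fix k assume "k \<in> G"
    then consider \<alpha> where "\<alpha> \<in> lists B" "k = D \<alpha>" | h where "h \<in> H" "k = (\<lambda>y. h (D [] y))" by (auto simp: G_def)
    then show "continuous_on S k"
    proof cases
      case 2
      have "continuous_on UNIV h"
        using H 2 unfolding derivative_closed_def
        by (meson DERIV_isCont continuous_at_imp_continuous_on)
      then show ?thesis using 2 continuous_on_compose2[of UNIV h S "D []"] is_jetD(2)[OF D, of "[]"] by simp
    qed (use is_jetD(2)[OF D] in auto)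
  next
    fix k b assume "k \<in> G" "b \<in> B"
    then consider \<alpha> where "\<alpha> \<in> lists B" "k = D \<alpha>" | h where "h \<in> H" "k = (\<lambda>y. h (D [] y))" by (auto simp: G_def)
    then show "\<exists>g'\<in>algebra_hull G. \<forall>y\<in>S \<inter> half_space_interior B b0.
      ((\<lambda>t. k (y + t *\<^sub>R b)) has_vector_derivative g' y) (at 0)"
    proof cases
      case 1
      then have "D (b # \<alpha>) \<in> algebra_hull G" using \<open>b \<in> B\<close>
        by (intro algebra_hull.gen) (auto simp: G_def simp del: in_lists_conv_set)
      then show ?thesis using is_jetD(3)[OF D] 1 \<open>b \<in> B\<close> by blast
    next
      case 2
      then obtain h' where h': "h' \<in> H" "\<And>x. (h has_real_derivative h' x) (at x)"
        using H unfolding derivative_closed_def by blast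
      have hull: "(\<lambda>y. D [b] y * h' (D [] y)) \<in> algebra_hull G"
        using h' \<open>b \<in> B\<close> by (intro algebra_hull.mult algebra_hull.gen) (auto simp: G_def)
      have der: "((\<lambda>t. k (y + t *\<^sub>R b)) has_vector_derivative D [b] y * h' (D [] y)) (at 0)"
        if y: "y \<in> S \<inter> half_space_interior B b0" for y
      proof -
        have "((\<lambda>t. D [] (y + t *\<^sub>R b)) has_real_derivative D [b] y) (at 0)"
          using is_jetD(3)[OF D, of "[]" b y] y \<open>b \<in> B\<close>
          by (simp add: has_real_derivative_iff_has_vector_derivative)
        from DERIV_chain2[OF h'(2) this] show ?thesis
          using 2 by (simp add: has_real_derivative_iff_has_vector_derivative mult.commute)
      qed
      show ?thesis by (rule bexI[OF ballI hull]) (rule der)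
    qed
  qed
  moreover have "smooth_on B b0 S (\<lambda>y. h (D [] y)) \<longleftrightarrow> smooth_on B b0 S (\<lambda>y. h (f y))"
    by (rule smooth_on_cong) (simp add: is_jetD(1)[OF D])
  ultimately show ?thesis by simp
qed

lemma smooth_on_scaleR:
  fixes v :: "'m::euclidean_space \<Rightarrow> 'k::euclidean_space"
  assumes f: "smooth_on B b0 S f" and v: "smooth_on B b0 S v"
  shows "smooth_on B b0 S (\<lambda>y. f y *\<^sub>R v y)"
proof -
  have "smooth_on B b0 S (\<lambda>y. \<Sum>i\<in>Basis. (f y * (v y \<bullet> i)) *\<^sub>R i)"
    by (intro smooth_on_sum smooth_on_bounded_linear[OF bounded_linear_scaleR_left] smooth_on_mult f
        smooth_on_bounded_linear[OF bounded_linear_inner_left] v)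
  moreover have "(\<Sum>i\<in>Basis. (f y * (v y \<bullet> i)) *\<^sub>R i) = f y *\<^sub>R v y" for y
    by (subst (2) euclidean_representation[of "v y", symmetric]) (simp add: scaleR_sum_right)
  ultimately show ?thesis by simp
qed

lemma eventually_in_half_space:
  assumes S: "openin (top_of_set (half_space B b0)) S" and y: "y \<in> S" "y \<in> half_space_interior B b0" and b: "b \<in> B"
  shows "\<forall>\<^sub>F t in nhds 0. y + t *\<^sub>R b \<in> S"
proof -
  obtain U where U: "open U" "S = half_space B b0 \<inter> U" using S by (auto simp: openin_open)
  have lim: "((\<lambda>t::real. y + t *\<^sub>R b) \<longlongrightarrow> y + 0 *\<^sub>R b) (nhds 0)"
    by (intro tendsto_intros filterlim_ident)
  then have "\<forall>\<^sub>F t in nhds 0. y + t *\<^sub>R b \<in> U"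
    using U y by (intro topological_tendstoD) auto
  moreover have "\<forall>\<^sub>F t in nhds 0. b0 \<in> B \<longrightarrow> 0 < (y + t *\<^sub>R b) \<bullet> b0"
  proof (cases "b0 \<in> B")
    case True
    have "((\<lambda>t::real. (y + t *\<^sub>R b) \<bullet> b0) \<longlongrightarrow> (y + 0 *\<^sub>R b) \<bullet> b0) (nhds 0)"
      by (rule tendsto_inner[OF lim tendsto_const])
    then have "\<forall>\<^sub>F t in nhds 0. 0 < (y + t *\<^sub>R b) \<bullet> b0"
      using True y(2) by (intro order_tendstoD(1)) (auto simp: half_space_interior_def)
    then show ?thesis by (rule eventually_mono) simp
  qed simp
  ultimately show ?thesis
  proof eventually_elim
    case (elim t)
    then show ?case using y(2) b U(2)
      by (auto simp: half_space_def half_space_interior_def span_add span_scale span_base)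
  qed
qed

text \<open>On the interior the jet arises by differentiating zero. A boundary point is approached
  along the inward direction \<open>b0\<close>, and continuity of the jet up to the boundary carries
  the value over.\<close>

lemma is_jet_zero:
  fixes f :: "'m::euclidean_space \<Rightarrow> 'f::real_normed_vector"
  assumes D: "is_jet B b0 S f D" and T: "openin (top_of_set (half_space B b0)) T" "T \<subseteq> S"
    and f0: "\<And>y. y \<in> T \<Longrightarrow> f y = 0" and B: "B \<subseteq> Basis" and \<alpha>: "\<alpha> \<in> lists B" and y: "y \<in> T"
  shows "D \<alpha> y = 0"
  using \<alpha> y
proof (induction arbitrary: y)
  case Nil
  then show ?case using is_jetD(1)[OF D] T f0 by auto
next
  case (Cons b \<alpha>)
  have int: "D (b # \<alpha>) z = 0" if z: "z \<in> T" "z \<in> half_space_interior B b0" for z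
  proof -
    have "\<forall>\<^sub>F t in nhds 0. D \<alpha> (z + t *\<^sub>R b) = 0"
      using eventually_in_half_space[OF T(1) z Cons.hyps(1)] by (rule eventually_mono) (rule Cons.IH)
    then have "((\<lambda>t. D \<alpha> (z + t *\<^sub>R b)) has_vector_derivative 0) (at 0) \<longleftrightarrow>
       ((\<lambda>t::real. 0) has_vector_derivative (0::'f)) (at 0)"
      by (intro has_vector_derivative_cong_ev) (auto dest: eventually_nhds_x_imp_x)
    then have "((\<lambda>t. D \<alpha> (z + t *\<^sub>R b)) has_vector_derivative 0) (at 0)" by simp
    then show ?thesis
      using is_jetD(3)[OF D, of \<alpha> b z] z T(2) Cons.hyps by (auto dest: vector_derivative_unique_at)
  qed
  show ?case
  proof (cases "b0 \<in> B")
    case False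
    have "y \<in> half_space B b0" using openin_subset[OF T(1)] Cons.prems by auto
    then show ?thesis using int[OF Cons.prems] False by (simp add: half_space_def half_space_interior_def)
  next
    case True
    obtain U where U: "open U" "T = half_space B b0 \<inter> U" using T(1) by (auto simp: openin_open)
    define u where "u n = y + (1 / real (Suc n)) *\<^sub>R b0" for n
    have "(\<lambda>n. y + (1 / real (Suc n)) *\<^sub>R b0) \<longlonglongrightarrow> y + 0 *\<^sub>R b0"
      by (intro tendsto_intros LIMSEQ_inverse_real_of_nat[unfolded inverse_eq_divide])
    then have lim: "u \<longlonglongrightarrow> y" by (simp add: u_def[abs_def])
    have ev: "\<forall>\<^sub>F n in sequentially. u n \<in> U"
      using lim U Cons.prems by (intro topological_tendstoD) auto
    have hs: "u n \<in> half_space B b0" "u n \<in> half_space_interior B b0" for n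
    proof -
      have "y \<in> span B" "0 \<le> y \<bullet> b0" using Cons.prems U True by (auto simp: half_space_def)
      moreover have "0 < u n \<bullet> b0"
        using calculation True B by (auto simp: u_def inner_add_left add_nonneg_pos)
      ultimately show "u n \<in> half_space B b0" "u n \<in> half_space_interior B b0"
        using True by (auto simp: half_space_def half_space_interior_def u_def span_add span_scale span_base)
    qed
    have evT: "\<forall>\<^sub>F n in sequentially. u n \<in> T" using ev by (rule eventually_mono) (use hs U in auto)
    have "continuous_on T (D (b # \<alpha>))"
      using is_jetD(2)[OF D, of "b # \<alpha>"] Cons.hyps T(2) by (auto intro: continuous_on_subset)
    then have "(\<lambda>n. D (b # \<alpha>) (u n)) \<longlonglongrightarrow> D (b # \<alpha>) y"
      using continuous_on_tendsto_compose[OF _ lim Cons.prems evT] by blast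
    moreover have "(\<lambda>n. D (b # \<alpha>) (u n)) \<longlonglongrightarrow> 0"
      by (rule tendsto_eventually) (use evT in \<open>auto elim!: eventually_mono intro: int hs\<close>)
    ultimately show ?thesis by (rule LIMSEQ_unique)
  qed
qed

text \<open>By \<open>is_jet_zero\<close> the jets of \<open>f\<close> on \<open>S1\<close> vanish
  on the overlap, so they glue with zero; both parts are relatively open, which makes continuity and
  derivatives local.\<close>

lemma smooth_on_extend_zero:
  fixes f :: "'m::euclidean_space \<Rightarrow> 'f::real_normed_vector"
  assumes S1: "openin (top_of_set (half_space B b0)) S1" and S2: "openin (top_of_set (half_space B b0)) S2"
    and f: "smooth_on B b0 S1 f" and f0: "\<And>y. y \<in> S2 \<Longrightarrow> f y = 0" and B: "B \<subseteq> Basis"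
  shows "smooth_on B b0 (S1 \<union> S2) f"
proof -
  obtain D where D: "is_jet B b0 S1 f D" using f by (auto simp: smooth_on_def)
  define E where "E \<alpha> y = (if y \<in> S1 then D \<alpha> y else 0)" for \<alpha> y
  have E1: "E \<alpha> y = D \<alpha> y" if "y \<in> S1" for \<alpha> y using that by (simp add: E_def)
  have E2: "E \<alpha> y = 0" if "y \<in> S2" "\<alpha> \<in> lists B" for \<alpha> y
  proof (cases "y \<in> S1")
    case True
    have "D \<alpha> y = 0"
      by (rule is_jet_zero[OF D openin_Int[OF S1 S2] _ _ B that(2)]) (use f0 that True in auto)
    then show ?thesis using True by (simp add: E1)
  qed (simp add: E_def)
  have "is_jet B b0 (S1 \<union> S2) f E"
    unfolding is_jet_def
  proof (intro conjI ballI)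
    fix y assume "y \<in> S1 \<union> S2"
    then show "E [] y = f y" using E2[of y "[]"] f0 is_jetD(1)[OF D] by (cases "y \<in> S1") (auto simp: E1)
  next
    fix \<alpha> assume \<alpha>: "\<alpha> \<in> lists B"
    have sub: "S1 \<union> S2 \<subseteq> half_space B b0" using openin_subset[OF S1] openin_subset[OF S2] by simp
    have "continuous_on S1 (E \<alpha>)"
      using is_jetD(2)[OF D \<alpha>] by (rule continuous_on_eq) (simp add: E1)
    moreover have "continuous_on S2 (E \<alpha>)"
      by (rule continuous_on_eq[OF continuous_on_const]) (simp add: E2 \<alpha>)
    ultimately show "continuous_on (S1 \<union> S2) (E \<alpha>)"
      using openin_subset_trans[OF S1 _ sub] openin_subset_trans[OF S2 _ sub]
      by (intro continuous_on_Un_local_open) auto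
  next
    fix \<alpha> b y assume \<alpha>: "\<alpha> \<in> lists B" and b: "b \<in> B" and "y \<in> (S1 \<union> S2) \<inter> half_space_interior B b0"
    then have y: "y \<in> S1 \<or> y \<in> S2" "y \<in> half_space_interior B b0" by auto
    show "((\<lambda>t. E \<alpha> (y + t *\<^sub>R b)) has_vector_derivative E (b # \<alpha>) y) (at 0)"
    proof (cases "y \<in> S1")
      case True
      have "\<forall>\<^sub>F t in nhds 0. E \<alpha> (y + t *\<^sub>R b) = D \<alpha> (y + t *\<^sub>R b)"
        using eventually_in_half_space[OF S1 True y(2) b] by (rule eventually_mono) (rule E1)
      then have "((\<lambda>t. E \<alpha> (y + t *\<^sub>R b)) has_vector_derivative D (b # \<alpha>) y) (at 0) \<longleftrightarrow>
         ((\<lambda>t. D \<alpha> (y + t *\<^sub>R b)) has_vector_derivative D (b # \<alpha>) y) (at 0)"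
        by (intro has_vector_derivative_cong_ev) (auto dest: eventually_nhds_x_imp_x)
      then show ?thesis using is_jetD(3)[OF D \<alpha> b True y(2)] True by (simp add: E1)
    next
      case False
      then have y2: "y \<in> S2" using y by simp
      have "\<forall>\<^sub>F t in nhds 0. E \<alpha> (y + t *\<^sub>R b) = 0"
        using eventually_in_half_space[OF S2 y2 y(2) b] by (rule eventually_mono) (rule E2[OF _ \<alpha>])
      then have "((\<lambda>t. E \<alpha> (y + t *\<^sub>R b)) has_vector_derivative 0) (at 0) \<longleftrightarrow>
         ((\<lambda>t::real. 0) has_vector_derivative (0::'f)) (at 0)"
        by (intro has_vector_derivative_cong_ev) (auto dest: eventually_nhds_x_imp_x)
      then show ?thesis using E2[OF y2, of "b # \<alpha>"] \<alpha> b by simp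
    qed
  qed
  then show ?thesis unfolding smooth_on_def by blast
qed

section \<open>Commutators of bounded operators and the projective unitary Lie algebra\<close>

abbreviation comm :: "('h::real_normed_vector \<Rightarrow>\<^sub>L 'h) \<Rightarrow> ('h \<Rightarrow>\<^sub>L 'h) \<Rightarrow> 'h \<Rightarrow>\<^sub>L 'h" where
  "comm A B \<equiv> (A o\<^sub>L B) - (B o\<^sub>L A)"

lemmas blinfun_compose_simps =
  bounded_bilinear.add_left[OF bounded_bilinear_blinfun_compose]
  bounded_bilinear.add_right[OF bounded_bilinear_blinfun_compose]
  bounded_bilinear.diff_left[OF bounded_bilinear_blinfun_compose]
  bounded_bilinear.diff_right[OF bounded_bilinear_blinfun_compose]
  bounded_bilinear.scaleR_left[OF bounded_bilinear_blinfun_compose]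
  bounded_bilinear.scaleR_right[OF bounded_bilinear_blinfun_compose]
  bounded_bilinear.zero_left[OF bounded_bilinear_blinfun_compose]
  bounded_bilinear.zero_right[OF bounded_bilinear_blinfun_compose]
  bounded_bilinear.minus_left[OF bounded_bilinear_blinfun_compose]
  bounded_bilinear.minus_right[OF bounded_bilinear_blinfun_compose]

lemma comm_add_left: "comm (A + B) C = comm A C + comm B C"
  and comm_add_right: "comm A (B + C) = comm A B + comm A C"
  and comm_scale_left: "comm (r *\<^sub>R A) B = r *\<^sub>R comm A B"
  and comm_scale_right: "comm A (r *\<^sub>R B) = r *\<^sub>R comm A B"
  and comm_anti: "comm A B = - comm B A"
  by (simp_all add: blinfun_compose_simps scaleR_diff_right)

lemma comm_jacobi: "comm A (comm B C) = comm (comm A B) C + comm B (comm A C)"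
  by (rule blinfun_eqI) (simp add: minus_blinfun.rep_eq plus_blinfun.rep_eq blinfun.diff_right)

lemma norm_comm_le: "norm (comm A B) \<le> 2 * norm A * norm B"
proof -
  have "norm (comm A B) \<le> norm (A o\<^sub>L B) + norm (B o\<^sub>L A)" by (rule norm_triangle_ineq4)
  also have "\<dots> \<le> norm A * norm B + norm B * norm A" by (intro add_mono norm_blinfun_compose)
  finally show ?thesis by simp
qed

lemma cinner_add_left: "cinner (x + y) z = cinner x z + cinner y (z::'h::complex_hilbert_space)"
  by (subst (1 2 3) cinner_commute) (simp add: cinner_add_right)

lemma cinner_scaleC_left: "cinner (a *\<^sub>C x) y = cnj a * cinner x (y::'h::complex_hilbert_space)"
  by (subst (1 2) cinner_commute) (simp add: cinner_scaleC_right)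

lemma cinner_scaleR_right: "cinner x (r *\<^sub>R y) = of_real r * cinner x (y::'h::complex_hilbert_space)"
  by (simp add: cinner_scaleC_right flip: scaleC_of_real)

lemma cinner_scaleR_left: "cinner (r *\<^sub>R x) y = of_real r * cinner x (y::'h::complex_hilbert_space)"
  by (simp add: cinner_scaleC_left flip: scaleC_of_real)

lemma cinner_zero_right: "cinner x (0::'h::complex_hilbert_space) = 0"
  using cinner_scaleR_right[of x 0 0] by simp

lemma cinner_minus_right: "cinner x (- y) = - cinner x (y::'h::complex_hilbert_space)"
  using cinner_scaleR_right[of x "-1" y] by simp

lemma cinner_diff_right: "cinner x (y - z) = cinner x y - cinner x (z::'h::complex_hilbert_space)"
  using cinner_add_right[of x y "- z"] by (simp add: cinner_minus_right)

lemma cinner_diff_left: "cinner (x - y) z = cinner x z - cinner y (z::'h::complex_hilbert_space)"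
  by (subst (1 2 3) cinner_commute) (simp add: cinner_diff_right)

lemma Re_cinner_le: "Re (cinner x y) \<le> norm x * norm (y::'h::complex_hilbert_space)"
proof -
  have "complex_of_real ((norm (x + y))\<^sup>2) = of_real ((norm x)\<^sup>2) + cinner x y + cinner y x + of_real ((norm y)\<^sup>2)"
    unfolding cinner_self[symmetric] by (simp add: cinner_add_left cinner_add_right)
  then have "Re (complex_of_real ((norm (x + y))\<^sup>2))
      = Re (of_real ((norm x)\<^sup>2) + cinner x y + cinner y x + of_real ((norm y)\<^sup>2))" by (rule arg_cong)
  moreover have "Re (cinner y x) = Re (cinner x y)" by (subst cinner_commute) simp
  ultimately have "(norm (x + y))\<^sup>2 = (norm x)\<^sup>2 + 2 * Re (cinner x y) + (norm y)\<^sup>2" by simp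
  moreover have "(norm (x + y))\<^sup>2 \<le> (norm x + norm y)\<^sup>2" by (intro power_mono norm_triangle_ineq) simp
  ultimately show ?thesis by (simp add: power2_sum)
qed

lemma norm_scaleC_ii: "norm (\<i> *\<^sub>C x) = norm (x::'h::complex_hilbert_space)"
proof -
  have "complex_of_real ((norm (\<i> *\<^sub>C x))\<^sup>2) = complex_of_real ((norm x)\<^sup>2)"
    unfolding cinner_self[symmetric] by (simp add: cinner_scaleC_left cinner_scaleC_right)
  then have "(norm (\<i> *\<^sub>C x))\<^sup>2 = (norm x)\<^sup>2" by (simp only: of_real_eq_iff)
  then show ?thesis by simp
qed

lemma Im_cinner_le: "\<bar>Im (cinner x y)\<bar> \<le> norm x * norm (y::'h::complex_hilbert_space)"
proof -
  have "Re (cinner x (\<i> *\<^sub>C y)) = - Im (cinner x y)" by (simp add: cinner_scaleC_right)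
  moreover have "Re (cinner x (\<i> *\<^sub>C (- y))) = Im (cinner x y)" by (simp add: cinner_scaleC_right cinner_minus_right)
  ultimately show ?thesis
    using Re_cinner_le[of x "\<i> *\<^sub>C y"] Re_cinner_le[of x "\<i> *\<^sub>C (- y)"] by (simp add: norm_scaleC_ii)
qed

lemma blinfun_zeroI_cinner:
  fixes A :: "'h::complex_hilbert_space \<Rightarrow>\<^sub>L 'h"
  assumes "\<And>x y. Re (cinner x (A y)) = 0"
  shows "A = 0"
proof (rule blinfun_eqI)
  fix y
  have "(norm (A y))\<^sup>2 = Re (cinner (A y) (A y))" by (simp add: cinner_self)
  also have "\<dots> = 0" by (rule assms)
  finally show "A y = blinfun_apply 0 y" by simp
qed

definition ii_op :: "'h::complex_hilbert_space \<Rightarrow>\<^sub>L 'h" where "ii_op = Blinfun (\<lambda>x. \<i> *\<^sub>C x)"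

lemma scaleC_scaleR: "a *\<^sub>C (r *\<^sub>R x) = r *\<^sub>R (a *\<^sub>C (x::'h::complex_hilbert_space))"
  by (simp add: scaleC_scaleC mult.commute flip: scaleC_of_real)

lemma ii_op_apply [simp]: "ii_op x = \<i> *\<^sub>C x"
proof -
  have "bounded_linear (\<lambda>x::'a. \<i> *\<^sub>C x)"
    by (rule bounded_linear_intro[of _ 1])
      (simp_all add: scaleC_add_right norm_scaleC_ii scaleC_scaleR)
  then show ?thesis by (simp add: ii_op_def bounded_linear_Blinfun_apply)
qed

lemma imaginary_scalars_eq: "imaginary_scalars = range (\<lambda>r. r *\<^sub>R ii_op)"
proof -
  have "(\<forall>x. A x = (\<i> * complex_of_real r) *\<^sub>C x) \<longleftrightarrow> A = r *\<^sub>R ii_op" for A :: "'a \<Rightarrow>\<^sub>L 'a" and r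
  proof -
    have "(\<i> * complex_of_real r) *\<^sub>C x = (r *\<^sub>R ii_op) x" for x :: 'a
      by (simp add: mult.commute[of \<i>] scaleR_blinfun.rep_eq scaleC_of_real flip: scaleC_scaleC)
    then show ?thesis by (auto intro: blinfun_eqI)
  qed
  then show ?thesis by (auto simp: imaginary_scalars_def)
qed

lemma subspace_imaginary_scalars: "subspace imaginary_scalars"
proof -
  have "linear (\<lambda>r. r *\<^sub>R ii_op)" by (intro linearI) (simp_all add: scaleR_add_left)
  then show ?thesis unfolding imaginary_scalars_eq by (intro linear_subspace_image subspace_UNIV)
qed

lemmas imaginary_scalars_simps [simp] =
  subspace_0[OF subspace_imaginary_scalars] 

lemma imaginary_scalars_nonempty: "imaginary_scalars \<noteq> {}"
  using subspace_0[OF subspace_imaginary_scalars] by blast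

lemmas imaginary_scalars_add = subspace_add[OF subspace_imaginary_scalars]
lemmas imaginary_scalars_diff = subspace_diff[OF subspace_imaginary_scalars]
lemmas imaginary_scalars_scale = subspace_scale[OF subspace_imaginary_scalars]
lemmas imaginary_scalars_neg = subspace_neg[OF subspace_imaginary_scalars]

abbreviation skew :: "('h::complex_hilbert_space \<Rightarrow>\<^sub>L 'h) set" where
  "skew \<equiv> carrier unitary_lie"

lemma skew_iff: "A \<in> skew \<longleftrightarrow> (\<forall>a x. A (a *\<^sub>C x) = a *\<^sub>C A x) \<and> (\<forall>x y. cinner (A x) y = - cinner x (A y))"
  by (simp add: unitary_lie_def)

lemma unitary_lie_simps [simp]:
  "vadd unitary_lie = (+)" "vzero unitary_lie = 0" "vscale unitary_lie = scaleR" "lbr unitary_lie = comm"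
  by (simp_all add: unitary_lie_def fun_eq_iff)

lemma subspace_skew: "subspace (skew :: ('h::complex_hilbert_space \<Rightarrow>\<^sub>L 'h) set)"
proof (rule subspaceI)
  show "0 \<in> (skew :: ('h \<Rightarrow>\<^sub>L 'h) set)" by (simp add: skew_iff scaleC_scaleR[of _ 0 0, simplified] cinner_zero_right cinner_scaleR_left[of 0 0, simplified])
next
  fix A B :: "'h \<Rightarrow>\<^sub>L 'h" assume "A \<in> skew" "B \<in> skew"
  then show "A + B \<in> skew"
    by (simp add: skew_iff plus_blinfun.rep_eq scaleC_add_right cinner_add_left cinner_add_right)
next
  fix r and A :: "'h \<Rightarrow>\<^sub>L 'h" assume "A \<in> skew"
  then show "r *\<^sub>R A \<in> skew"
    by (simp add: skew_iff scaleR_blinfun.rep_eq scaleC_scaleR cinner_scaleR_left cinner_scaleR_right)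
qed

lemmas skew_add = subspace_add[OF subspace_skew]
lemmas skew_scale = subspace_scale[OF subspace_skew]
lemmas skew_sum = subspace_sum[OF subspace_skew]

lemma skew_comm:
  assumes "A \<in> skew" "B \<in> skew"
  shows "comm A B \<in> skew"
proof -
  have A: "A (a *\<^sub>C x) = a *\<^sub>C A x" "cinner (A x) y = - cinner x (A y)" for a x y
    using assms(1) by (auto simp: skew_iff)
  have B: "B (a *\<^sub>C x) = a *\<^sub>C B x" "cinner (B x) y = - cinner x (B y)" for a x y
    using assms(2) by (auto simp: skew_iff)
  have m: "a *\<^sub>C (x - y) = a *\<^sub>C x - a *\<^sub>C y" for a and x y :: 'a
    using scaleC_add_right[of a "x - y" y] by (simp add: algebra_simps)
  show ?thesis unfolding skew_iff
    by (simp add: minus_blinfun.rep_eq A B m cinner_diff_left cinner_diff_right)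
qed

lemma imaginary_scalars_skew: "imaginary_scalars \<subseteq> skew"
proof -
  have "ii_op \<in> (skew :: ('a \<Rightarrow>\<^sub>L 'a) set)"
    by (simp add: skew_iff scaleC_scaleC mult.commute cinner_scaleC_left cinner_scaleC_right)
  then show ?thesis by (auto simp: imaginary_scalars_eq intro: skew_scale)
qed

lemma comm_imaginary:
  assumes A: "A \<in> skew" and S: "S \<in> imaginary_scalars"
  shows "comm A S = 0"
proof -
  obtain r where S: "S = r *\<^sub>R ii_op" using S by (auto simp: imaginary_scalars_eq)
  have "comm A ii_op = 0"
    by (rule blinfun_eqI) (use A in \<open>simp add: skew_iff minus_blinfun.rep_eq\<close>)
  then show ?thesis unfolding S comm_scale_right by simp
qed

text \<open>Wielandt's argument: if \<open>[A, B] = Z\<close> is scalar then \<open>[A\<^sup>n, B] = n Z A\<^sup>n\<^sup>-\<^sup>1\<close>, and comparing norms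
  forces \<open>Z = 0\<close>.\<close>

lemma scalar_commutator_zero:
  fixes A B :: "'h::complex_hilbert_space \<Rightarrow>\<^sub>L 'h"
  assumes A: "A \<in> skew" and Z: "comm A B \<in> imaginary_scalars"
  shows "comm A B = 0"
proof (rule ccontr)
  assume nz: "comm A B \<noteq> 0"
  obtain r where r: "comm A B = r *\<^sub>R ii_op" using Z by (auto simp: imaginary_scalars_eq)
  then have r0: "r \<noteq> 0" using nz by auto
  define Pw where "Pw n = (((o\<^sub>L) A) ^^ n) id_blinfun" for n
  have Pw: "Pw 0 = id_blinfun" "Pw (Suc n) = A o\<^sub>L Pw n" for n by (simp_all add: Pw_def)
  have AB: "A (B x) = B (A x) + r *\<^sub>R (\<i> *\<^sub>C x)" for x
  proof -
    have "comm A B x = r *\<^sub>R (\<i> *\<^sub>C x)" unfolding r by (simp add: scaleR_blinfun.rep_eq)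
    then show ?thesis by (simp add: minus_blinfun.rep_eq algebra_simps)
  qed
  have Aii: "A (\<i> *\<^sub>C x) = \<i> *\<^sub>C A x" for x using A by (simp add: skew_iff)
  have key: "Pw (Suc n) (B x) = B (Pw (Suc n) x) + (real (Suc n) * r) *\<^sub>R (\<i> *\<^sub>C Pw n x)" for n x
  proof (induction n)
    case 0
    then show ?case by (simp add: Pw AB)
  next
    case (Suc n)
    have "Pw (Suc (Suc n)) (B x) = A (B (Pw (Suc n) x) + (real (Suc n) * r) *\<^sub>R (\<i> *\<^sub>C Pw n x))"
      using Suc by (simp add: Pw)
    also have "\<dots> = B (Pw (Suc (Suc n)) x) + r *\<^sub>R (\<i> *\<^sub>C Pw (Suc n) x) + (real (Suc n) * r) *\<^sub>R (\<i> *\<^sub>C Pw (Suc n) x)"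
      by (simp add: Pw blinfun.add_right blinfun.scaleR_right AB Aii)
    also have "\<dots> = B (Pw (Suc (Suc n)) x) + (real (Suc (Suc n)) * r) *\<^sub>R (\<i> *\<^sub>C Pw (Suc n) x)"
    proof -
      have "real (Suc (Suc n)) * r = r + real (Suc n) * r" by (simp add: algebra_simps)
      then show ?thesis by (simp only: scaleR_add_left add.assoc)
    qed
    finally show ?case .
  qed
  \<comment> \<open>No power of \<open>A\<close> vanishes: otherwise \<open>key\<close> would make
    the preceding power vanish as well, down to the identity, while a nonzero commutator forces a
    nonzero space.\<close>
  have pos: "Pw n \<noteq> 0" for n
  proof (induction n)
    case 0
    have "(ii_op :: 'h \<Rightarrow>\<^sub>L 'h) \<noteq> 0" using nz r by auto
    then obtain x :: 'h where "\<i> *\<^sub>C x \<noteq> 0" using blinfun_eqI[of "ii_op" 0] by auto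
    then have "x \<noteq> 0" using norm_scaleC_ii[of x] by auto
    then have "blinfun_apply id_blinfun x \<noteq> blinfun_apply 0 x" by simp
    then show ?case unfolding Pw by metis
  next
    case (Suc n)
    show ?case
    proof
      assume "Pw (Suc n) = 0"
      then have "(real (Suc n) * r) *\<^sub>R (\<i> *\<^sub>C Pw n x) = 0" for x using key[of n x] by simp
      then have "\<i> *\<^sub>C Pw n x = 0" for x using r0 by simp
      then have "Pw n x = 0" for x using norm_scaleC_ii[of "Pw n x"] by simp
      then have "Pw n = 0" by (intro blinfun_eqI) simp
      then show False using Suc by simp
    qed
  qed
  \<comment> \<open>Norms are taken in \<open>key\<close>, and the common factor
    \<open>norm (Pw n)\<close> is cancelled.\<close>
  have bound: "real (Suc n) * \<bar>r\<bar> \<le> 2 * norm A * norm B" for n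
  proof -
    have "norm (real (Suc n) *\<^sub>R (\<bar>r\<bar> *\<^sub>R Pw n)) \<le> 2 * norm A * norm B * norm (Pw n)"
    proof (rule norm_blinfun_bound)
      fix x
      have n1: "norm (Pw (Suc n)) \<le> norm A * norm (Pw n)" unfolding Pw by (rule norm_blinfun_compose)
      have "norm ((real (Suc n) * r) *\<^sub>R (\<i> *\<^sub>C Pw n x)) = norm (Pw (Suc n) (B x) - B (Pw (Suc n) x))"
        unfolding key by simp
      also have "\<dots> \<le> norm (Pw (Suc n) (B x)) + norm (B (Pw (Suc n) x))" by (rule norm_triangle_ineq4)
      also have "\<dots> \<le> norm (Pw (Suc n)) * (norm B * norm x) + norm B * (norm (Pw (Suc n)) * norm x)"
        by (intro add_mono order_trans[OF norm_blinfun] mult_left_mono norm_blinfun norm_ge_zero)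
      also have "\<dots> = norm (Pw (Suc n)) * (2 * norm B * norm x)" by simp
      also have "\<dots> \<le> norm A * norm (Pw n) * (2 * norm B * norm x)" by (intro mult_right_mono n1) simp
      finally show "norm ((real (Suc n) *\<^sub>R (\<bar>r\<bar> *\<^sub>R Pw n)) x) \<le> 2 * norm A * norm B * norm (Pw n) * norm x"
        by (simp add: scaleR_blinfun.rep_eq norm_scaleC_ii abs_mult mult_ac)
    qed simp
    then show ?thesis using pos[of n] by (simp add: mult.assoc[symmetric])
  qed
  obtain n where "2 * norm A * norm B < real n * \<bar>r\<bar>"
    using reals_Archimedean3[of "\<bar>r\<bar>"] r0 by (auto simp: mult.commute)
  moreover have "real n * \<bar>r\<bar> \<le> real (Suc n) * \<bar>r\<bar>" by (rule mult_right_mono) simp_all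
  ultimately show False using bound[of n] by linarith
qed

text \<open>Subtract the multiple of \<open>ii_op\<close> given by the imaginary part of the
  expectation value in a fixed unit vector, which is one on \<open>ii_op\<close> itself. Each of the
  two terms contributes \<open>norm A\<close> to the bound. On the zero space the identity
  serves.\<close>

lemma linear_lift_exists:
  "\<exists>lft :: ('h::complex_hilbert_space \<Rightarrow>\<^sub>L 'h) \<Rightarrow> ('h \<Rightarrow>\<^sub>L 'h). linear lft \<and> (\<forall>S\<in>imaginary_scalars. lft S = 0) \<and>
     (\<forall>A. A - lft A \<in> imaginary_scalars) \<and> (\<forall>A. norm (lft A) \<le> 2 * norm A)"
proof (cases "\<exists>v::'h. v \<noteq> 0")
  case False
  then have "A = 0" for A :: "'h \<Rightarrow>\<^sub>L 'h" by (intro blinfun_eqI) metis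
  then have "linear (\<lambda>A :: 'h \<Rightarrow>\<^sub>L 'h. A) \<and> (\<forall>S\<in>imaginary_scalars. S = (0 :: 'h \<Rightarrow>\<^sub>L 'h)) \<and>
     (\<forall>A :: 'h \<Rightarrow>\<^sub>L 'h. A - A \<in> imaginary_scalars) \<and> (\<forall>A :: 'h \<Rightarrow>\<^sub>L 'h. norm A \<le> 2 * norm A)"
    by (simp add: linear_id[unfolded id_def])
  then show ?thesis by (intro exI[of _ "\<lambda>A. A"])
next
  case True
  then obtain w :: 'h where w: "w \<noteq> 0" by blast
  define v where "v = (1 / norm w) *\<^sub>R w"
  have v: "norm v = 1" using w by (simp add: v_def)
  define c where "c A = Im (cinner v (blinfun_apply A v))" for A
  have c_lin: "c (A + A') = c A + c A'" "c (r *\<^sub>R A) = r * c A" for A A' r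
    by (simp_all add: c_def plus_blinfun.rep_eq scaleR_blinfun.rep_eq cinner_add_right cinner_scaleR_right)
  have c_ii: "c ii_op = 1" using cinner_self[of v] v by (simp add: c_def cinner_scaleC_right)
  have c_le: "\<bar>c A\<bar> \<le> norm A" for A
    using order_trans[OF Im_cinner_le[of v "A v"]] norm_blinfun[of A v] v by (simp add: c_def)
  have ii_le: "norm (ii_op :: 'h \<Rightarrow>\<^sub>L 'h) \<le> 1"
    by (rule norm_blinfun_bound) (simp_all add: norm_scaleC_ii)
  define lft where "lft A = A - c A *\<^sub>R ii_op" for A
  have "linear lft" by (rule linearI) (simp_all add: lft_def c_lin scaleR_diff_right algebra_simps)
  moreover have "lft S = 0" if "S \<in> imaginary_scalars" for S
    using that by (auto simp: imaginary_scalars_eq lft_def c_lin c_ii)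
  moreover have "A - lft A \<in> imaginary_scalars" for A by (auto simp: lft_def imaginary_scalars_eq)
  moreover have "norm (lft A) \<le> 2 * norm A" for A
  proof -
    have "norm (lft A) \<le> norm A + \<bar>c A\<bar> * norm (ii_op :: 'h \<Rightarrow>\<^sub>L 'h)"
      unfolding lft_def using norm_triangle_ineq4[of A "c A *\<^sub>R ii_op"] by simp
    also have "\<dots> \<le> norm A + norm A * 1" by (intro add_mono mult_mono c_le ii_le) auto
    finally show ?thesis by simp
  qed
  ultimately show ?thesis by blast
qed

section \<open>The quotient by imaginary scalars and its norm\<close>

abbreviation coset :: "('h::complex_hilbert_space \<Rightarrow>\<^sub>L 'h) \<Rightarrow> ('h \<Rightarrow>\<^sub>L 'h) set" where
  "coset \<equiv> proj_unitary_quotient_map"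

lemma mem_coset: "B \<in> coset A \<longleftrightarrow> B - A \<in> imaginary_scalars"
  by (auto simp: proj_unitary_quotient_map_def lie_coset_def image_iff algebra_simps)
    (metis add.commute diff_add_cancel)

lemma coset_eq_iff: "coset A = coset B \<longleftrightarrow> A - B \<in> imaginary_scalars"
proof
  assume "coset A = coset B"
  then show "A - B \<in> imaginary_scalars" using mem_coset[of A A] mem_coset[of A B] by simp
next
  assume d: "A - B \<in> imaginary_scalars"
  have "C - A \<in> imaginary_scalars \<longleftrightarrow> C - B \<in> imaginary_scalars" for C
    using imaginary_scalars_add[OF _ d, of "C - A"] imaginary_scalars_diff[OF _ d, of "C - B"] by auto
  then show "coset A = coset B" by (auto simp: mem_coset)
qed

lemma proj_carrier: "carrier proj_unitary_lie = coset ` skew"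
  by (simp add: proj_unitary_lie_def lie_quotient_def proj_unitary_quotient_map_def)

lemma coset_subset_skew: "A \<in> skew \<Longrightarrow> B \<in> coset A \<Longrightarrow> B \<in> skew"
  using skew_add[of "B - A" A] imaginary_scalars_skew by (auto simp: mem_coset)

lemma proj_add: "vadd proj_unitary_lie (coset A) (coset B) = coset (A + B)"
proof -
  have "C - (A + B) \<in> imaginary_scalars \<longleftrightarrow> (\<exists>a b. C = a + b \<and> a - A \<in> imaginary_scalars \<and> b - B \<in> imaginary_scalars)" for C
  proof
    assume "C - (A + B) \<in> imaginary_scalars"
    then show "\<exists>a b. C = a + b \<and> a - A \<in> imaginary_scalars \<and> b - B \<in> imaginary_scalars"
      by (intro exI[of _ "C - B"] exI[of _ B]) (simp add: algebra_simps)
  next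
    assume "\<exists>a b. C = a + b \<and> a - A \<in> imaginary_scalars \<and> b - B \<in> imaginary_scalars"
    then obtain a b where "C = a + b" "a - A \<in> imaginary_scalars" "b - B \<in> imaginary_scalars" by blast
    then show "C - (A + B) \<in> imaginary_scalars" using imaginary_scalars_add[of "a - A" "b - B"] by (simp add: algebra_simps)
  qed
  note e = this
  show ?thesis
    by (rule set_eqI) (simp only: mem_coset e, simp add: proj_unitary_lie_def lie_quotient_def mem_coset)
qed

lemma proj_scale: "vscale proj_unitary_lie r (coset A) = coset (r *\<^sub>R A)"
proof -
  have "C - r *\<^sub>R A \<in> imaginary_scalars \<longleftrightarrow> (\<exists>a i. C = r *\<^sub>R a + i \<and> a - A \<in> imaginary_scalars \<and> i \<in> imaginary_scalars)" for C
  proof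
    assume "C - r *\<^sub>R A \<in> imaginary_scalars"
    then show "\<exists>a i. C = r *\<^sub>R a + i \<and> a - A \<in> imaginary_scalars \<and> i \<in> imaginary_scalars"
      by (intro exI[of _ A] exI[of _ "C - r *\<^sub>R A"]) simp
  next
    assume "\<exists>a i. C = r *\<^sub>R a + i \<and> a - A \<in> imaginary_scalars \<and> i \<in> imaginary_scalars"
    then obtain a i where "C = r *\<^sub>R a + i" "a - A \<in> imaginary_scalars" "i \<in> imaginary_scalars" by blast
    then show "C - r *\<^sub>R A \<in> imaginary_scalars"
      using imaginary_scalars_add[OF imaginary_scalars_scale[of "a - A" r], of i] by (simp add: algebra_simps)
  qed
  note e = this
  show ?thesis
    by (rule set_eqI) (simp only: mem_coset e, simp add: proj_unitary_lie_def lie_quotient_def mem_coset)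
qed

lemma proj_bracket:
  assumes A: "A \<in> skew" and B: "B \<in> skew"
  shows "lbr proj_unitary_lie (coset A) (coset B) = coset (comm A B)"
proof -
  have c: "comm a b = comm A B" if "a - A \<in> imaginary_scalars" "b - B \<in> imaginary_scalars" for a b
  proof -
    have b: "b \<in> skew" using coset_subset_skew[OF B] that by (simp add: mem_coset)
    have "comm A (b - B) = 0" by (rule comm_imaginary[OF A that(2)])
    moreover have "comm (a - A) b = 0" by (subst comm_anti) (simp only: comm_imaginary[OF b that(1)] neg_0_equal_iff_equal minus_zero)
    ultimately show ?thesis
      using comm_add_left[of A "a - A" b] comm_add_right[of A B "b - B"] by simp
  qed
  have "C - comm A B \<in> imaginary_scalars \<longleftrightarrow>
    (\<exists>a b i. C = comm a b + i \<and> a - A \<in> imaginary_scalars \<and> b - B \<in> imaginary_scalars \<and> i \<in> imaginary_scalars)" for C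
  proof
    assume "C - comm A B \<in> imaginary_scalars"
    then show "\<exists>a b i. C = comm a b + i \<and> a - A \<in> imaginary_scalars \<and> b - B \<in> imaginary_scalars \<and> i \<in> imaginary_scalars"
      by (intro exI[of _ A] exI[of _ B] exI[of _ "C - comm A B"]) simp
  next
    assume "\<exists>a b i. C = comm a b + i \<and> a - A \<in> imaginary_scalars \<and> b - B \<in> imaginary_scalars \<and> i \<in> imaginary_scalars"
    then obtain a b i where abi: "C = comm a b + i" "a - A \<in> imaginary_scalars" "b - B \<in> imaginary_scalars"
      "i \<in> imaginary_scalars" by blast
    show "C - comm A B \<in> imaginary_scalars" unfolding abi(1) c[OF abi(2,3)] using abi(4) by simp
  qed
  note e = this
  show ?thesis
    by (rule set_eqI) (simp only: mem_coset e, simp add: proj_unitary_lie_def lie_quotient_def mem_coset)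
qed

lemma quotient_norm_eq: "quotient_norm (coset A) = (INF S\<in>imaginary_scalars. norm (A + S))"
  by (simp add: quotient_norm_def proj_unitary_quotient_map_def lie_coset_def image_image)

lemma quotient_norm_le: "S \<in> imaginary_scalars \<Longrightarrow> quotient_norm (coset A) \<le> norm (A + S)"
  unfolding quotient_norm_eq by (rule cINF_lower) (auto intro: bdd_belowI[of _ 0])

lemma quotient_norm_ge:
  "(\<And>S. S \<in> imaginary_scalars \<Longrightarrow> c \<le> norm (A + S)) \<Longrightarrow> c \<le> quotient_norm (coset A)"
  unfolding quotient_norm_eq by (rule cINF_greatest) (use imaginary_scalars_nonempty in auto)

text \<open>An estimate valid for all representatives passes to the infimum; the factor zero, which
  cannot be divided away, is settled by the representative \<open>A\<close> itself.\<close>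

lemma le_quotient_norm:
  assumes "0 \<le> M" "\<And>S. S \<in> imaginary_scalars \<Longrightarrow> c \<le> M * norm (A + S)"
  shows "c \<le> M * quotient_norm (coset A)"
proof (cases "M = 0")
  case True
  then show ?thesis using assms(2)[OF subspace_0[OF subspace_imaginary_scalars]] by simp
next
  case False
  then have "c / M \<le> quotient_norm (coset A)"
    using assms by (intro quotient_norm_ge) (simp add: divide_le_eq mult.commute)
  then show ?thesis using False assms(1) by (simp add: divide_le_eq mult.commute)
qed

lemma quotient_norm_triangle:
  fixes A B :: "'h::complex_hilbert_space \<Rightarrow>\<^sub>L 'h"
  shows "quotient_norm (coset (A + B)) \<le> quotient_norm (coset A) + quotient_norm (coset B)"
proof -
  have "quotient_norm (coset (A + B)) - quotient_norm (coset A) \<le> quotient_norm (coset B)"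
  proof (rule quotient_norm_ge)
    fix T :: "'h \<Rightarrow>\<^sub>L 'h" assume T: "T \<in> imaginary_scalars"
    have "quotient_norm (coset (A + B)) - norm (B + T) \<le> quotient_norm (coset A)"
    proof (rule quotient_norm_ge)
      fix S :: "'h \<Rightarrow>\<^sub>L 'h" assume S: "S \<in> imaginary_scalars"
      have "quotient_norm (coset (A + B)) \<le> norm (A + B + (S + T))"
        by (rule quotient_norm_le[OF imaginary_scalars_add[OF S T]])
      also have "\<dots> \<le> norm (A + S) + norm (B + T)"
        using norm_triangle_ineq[of "A + S" "B + T"] by (simp add: algebra_simps)
      finally show "quotient_norm (coset (A + B)) - norm (B + T) \<le> norm (A + S)" by simp
    qed
    then show "quotient_norm (coset (A + B)) - quotient_norm (coset A) \<le> norm (B + T)" by simp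
  qed
  then show ?thesis by simp
qed

lemma proj_vdiff: "vdiff proj_unitary_lie (coset A) (coset B) = coset (A - B)"
  by (simp add: vdiff_def proj_scale proj_add)

lemma openin_proj_ball:
  assumes B: "B \<in> skew"
  shows "openin proj_unitary_topology {P \<in> carrier proj_unitary_lie. quotient_norm (vdiff proj_unitary_lie P (coset B)) < e}"
  unfolding proj_unitary_topology_def openin_seminorm_topology
proof (intro conjI ballI)
  fix P assume "P \<in> {P \<in> carrier proj_unitary_lie. quotient_norm (vdiff proj_unitary_lie P (coset B)) < e}"
  then obtain A where A: "A \<in> skew" "P = coset A" "quotient_norm (coset (A - B)) < e"
    by (auto simp: proj_carrier proj_vdiff)
  let ?d = "e - quotient_norm (coset (A - B))"
  have "{y \<in> carrier proj_unitary_lie. \<forall>p\<in>{quotient_norm}. p (vdiff proj_unitary_lie y P) < ?d}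
    \<subseteq> {P \<in> carrier proj_unitary_lie. quotient_norm (vdiff proj_unitary_lie P (coset B)) < e}"
  proof safe
    fix y assume y: "y \<in> carrier proj_unitary_lie" "\<forall>p\<in>{quotient_norm}. p (vdiff proj_unitary_lie y P) < ?d"
    then obtain C where C: "C \<in> skew" "y = coset C" by (auto simp: proj_carrier)
    have "quotient_norm (coset (C - B)) \<le> quotient_norm (coset (C - A)) + quotient_norm (coset (A - B))"
      using quotient_norm_triangle[of "C - A" "A - B"] by simp
    then show "quotient_norm (vdiff proj_unitary_lie y (coset B)) < e"
      using y(2) A(2) C(2) by (simp add: proj_vdiff)
  qed
  then show "\<exists>F d. finite F \<and> F \<subseteq> {quotient_norm} \<and> 0 < d \<and>
      {y \<in> carrier proj_unitary_lie. \<forall>p\<in>F. p (vdiff proj_unitary_lie y P) < d}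
      \<subseteq> {P \<in> carrier proj_unitary_lie. quotient_norm (vdiff proj_unitary_lie P (coset B)) < e}"
    using A(3) by (intro exI[of _ "{quotient_norm}"] exI[of _ ?d]) simp
qed auto

section \<open>Commutators of a projective representation\<close>

locale proj_rep =
  fixes L :: "'a lie_alg" and pb :: "'a \<Rightarrow> ('h::complex_hilbert_space \<Rightarrow>\<^sub>L 'h) set"
  assumes hom: "lie_hom L proj_unitary_lie pb"
    and zeroL: "vzero L \<in> carrier L"
    and addL: "x \<in> carrier L \<Longrightarrow> y \<in> carrier L \<Longrightarrow> vadd L x y \<in> carrier L"
    and scaleL: "x \<in> carrier L \<Longrightarrow> vscale L r x \<in> carrier L"
    and brL: "x \<in> carrier L \<Longrightarrow> y \<in> carrier L \<Longrightarrow> lbr L x y \<in> carrier L"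
    and scale_zeroL: "x \<in> carrier L \<Longrightarrow> vscale L 0 x = vzero L"
begin

definition rep :: "'a \<Rightarrow> 'h \<Rightarrow>\<^sub>L 'h" where "rep x = (SOME T. T \<in> skew \<and> coset T = pb x)"

lemma rep: "x \<in> carrier L \<Longrightarrow> rep x \<in> skew" "x \<in> carrier L \<Longrightarrow> coset (rep x) = pb x"
proof -
  assume "x \<in> carrier L"
  then have "pb x \<in> coset ` skew" using hom by (auto simp: lie_hom_def proj_carrier)
  then have "\<exists>T. T \<in> skew \<and> coset T = pb x" by auto
  from someI_ex[OF this] show "rep x \<in> skew" "coset (rep x) = pb x" by (simp_all add: rep_def)
qed

lemma pb_add: "x \<in> carrier L \<Longrightarrow> y \<in> carrier L \<Longrightarrow> pb (vadd L x y) = coset (rep x + rep y)"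
  using hom by (simp add: lie_hom_def proj_add flip: rep(2))

lemma pb_scale: "x \<in> carrier L \<Longrightarrow> pb (vscale L r x) = coset (r *\<^sub>R rep x)"
  using hom by (simp add: lie_hom_def proj_scale flip: rep(2))

lemma pb_br: "x \<in> carrier L \<Longrightarrow> y \<in> carrier L \<Longrightarrow> pb (lbr L x y) = coset (comm (rep x) (rep y))"
  using hom by (simp add: lie_hom_def proj_bracket rep flip: rep(2))

lemma pb_zero: "pb (vzero L) = coset 0"
  using pb_scale[OF zeroL, of 0] scale_zeroL[OF zeroL] by simp

lemma comm_right_cong:
  assumes "T \<in> skew" "coset U = coset U'"
  shows "comm T U = comm T U'"
proof -
  have "comm T (U - U') = 0" using assms by (intro comm_imaginary) (simp_all add: coset_eq_iff)
  then show ?thesis using comm_add_right[of T "U - U'" U'] by simp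
qed

lemma comm_left_cong:
  assumes "T \<in> skew" "coset U = coset U'"
  shows "comm U T = comm U' T"
  unfolding comm_anti[of U] comm_anti[of U'] by (simp only: comm_right_cong[OF assms])

text \<open>Representatives differ by scalars, which commute with skew-hermitian operators, so the
  form depends on \<open>pb\<close> alone although \<open>rep\<close> is an arbitrary choice. Its
  bilinearity rests on that.\<close>

definition com :: "'a \<Rightarrow> 'a \<Rightarrow> 'h \<Rightarrow>\<^sub>L 'h" where "com x y = comm (rep x) (rep y)"

lemma com_anti: "com x y = - com y x"
  unfolding com_def by (rule comm_anti)

lemma com_right:
  assumes "x \<in> carrier L" "y \<in> carrier L" "coset T = pb y"
  shows "com x y = comm (rep x) T"
  unfolding com_def by (rule comm_right_cong) (simp_all add: rep assms)

lemma com_add_right: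
  "x \<in> carrier L \<Longrightarrow> y \<in> carrier L \<Longrightarrow> z \<in> carrier L \<Longrightarrow> com x (vadd L y z) = com x y + com x z"
  using com_right[of x "vadd L y z" "rep y + rep z"] by (simp add: addL pb_add comm_add_right com_def)

lemma com_scale_right: "x \<in> carrier L \<Longrightarrow> y \<in> carrier L \<Longrightarrow> com x (vscale L r y) = r *\<^sub>R com x y"
  using com_right[of x "vscale L r y" "r *\<^sub>R rep y"] by (simp add: scaleL pb_scale comm_scale_right com_def)

lemma com_add_left:
  "x \<in> carrier L \<Longrightarrow> y \<in> carrier L \<Longrightarrow> z \<in> carrier L \<Longrightarrow> com (vadd L x y) z = com x z + com y z"
  using com_add_right[of z x y] com_anti[of "vadd L x y" z] com_anti[of x z] com_anti[of y z] by simp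

lemma com_scale_left: "x \<in> carrier L \<Longrightarrow> y \<in> carrier L \<Longrightarrow> com (vscale L r x) y = r *\<^sub>R com x y"
  using com_scale_right[of y x r] com_anti[of "vscale L r x" y] com_anti[of x y] by simp

lemma com_br_right:
  "x \<in> carrier L \<Longrightarrow> y \<in> carrier L \<Longrightarrow> z \<in> carrier L \<Longrightarrow> com x (lbr L y z) = comm (rep x) (com y z)"
  unfolding com_def[of y z] by (rule com_right) (simp_all add: brL pb_br)

lemma com_jacobi:
  assumes "x \<in> carrier L" "y \<in> carrier L" "z \<in> carrier L"
  shows "com x (lbr L y z) = com (lbr L x y) z + com y (lbr L x z)"
proof -
  have "com (lbr L x y) z = - comm (rep z) (com x y)"
    using com_anti[of "lbr L x y" z] com_br_right[of z x y] assms by simp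
  also have "\<dots> = comm (com x y) (rep z)" by (rule comm_anti[symmetric])
  finally have 1: "com (lbr L x y) z = comm (comm (rep x) (rep y)) (rep z)" unfolding com_def[of x y] .
  have 2: "com x (lbr L y z) = comm (rep x) (comm (rep y) (rep z))"
    "com y (lbr L x z) = comm (rep y) (comm (rep x) (rep z))"
    using com_br_right[of x y z] com_br_right[of y x z] assms unfolding com_def[of y z] com_def[of x z] by simp_all
  show ?thesis unfolding 1 2 by (rule comm_jacobi)
qed

text \<open>The projective representation only shows that the commutator is a scalar; Wielandt's
  argument makes it zero. This is the decisive use of boundedness.\<close>

lemma com_zero: "x \<in> carrier L \<Longrightarrow> y \<in> carrier L \<Longrightarrow> lbr L x y = vzero L \<Longrightarrow> com x y = 0"
  unfolding com_def
proof (rule scalar_commutator_zero)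
  assume "x \<in> carrier L" "y \<in> carrier L" "lbr L x y = vzero L"
  then have "coset (comm (rep x) (rep y)) = coset 0" using pb_br[of x y] pb_zero by simp
  then show "comm (rep x) (rep y) \<in> imaginary_scalars" by (simp add: coset_eq_iff)
qed (rule rep)

end

section \<open>Sections of bundles of compact Lie algebras\<close>

text \<open>The bracket is controlled on \<open>V\<close> only; after composing with a projection it
  is a bilinear polynomial in coordinates.\<close>

lemma (in compact_lie) smooth_on_br:
  fixes v w :: "'m::euclidean_space \<Rightarrow> 'k"
  assumes v: "smooth_on B b0 S v" "\<And>y. y \<in> S \<Longrightarrow> v y \<in> V" and w: "smooth_on B b0 S w" "\<And>y. y \<in> S \<Longrightarrow> w y \<in> V"
  shows "smooth_on B b0 S (\<lambda>y. br (v y) (w y))"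
proof -
  obtain P where P: "linear P" "\<And>v. P v \<in> V" "\<And>v. v \<in> V \<Longrightarrow> P v = v"
    by (rule subspace_projection[OF sub]) blast
  have bil: "bilinear (\<lambda>x y. br (P x) (P y))"
    unfolding bilinear_def using P(2)
    by (auto intro!: linearI simp: linear_add[OF P(1)] linear_cmul[OF P(1)]
        br_add_left br_add_right br_scale_left br_scale_right)
  have exp: "br (P x) (P y) = (\<Sum>(i,j)\<in>Basis \<times> Basis. ((x \<bullet> i) * (y \<bullet> j)) *\<^sub>R br (P i) (P j))" for x y
  proof -
    have "br (P x) (P y) = br (P (\<Sum>i\<in>Basis. (x \<bullet> i) *\<^sub>R i)) (P (\<Sum>j\<in>Basis. (y \<bullet> j) *\<^sub>R j))"
      by (simp add: euclidean_representation)
    also have "\<dots> = (\<Sum>(i,j)\<in>Basis \<times> Basis. br (P ((x \<bullet> i) *\<^sub>R i)) (P ((y \<bullet> j) *\<^sub>R j)))"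
      by (rule bilinear_sum[OF bil])
    finally show ?thesis
      by (simp add: bilinear_lmul[OF bil] bilinear_rmul[OF bil] mult.commute)
  qed
  have "smooth_on B b0 S (\<lambda>y. \<Sum>(i,j)\<in>Basis \<times> Basis. ((v y \<bullet> i) * (w y \<bullet> j)) *\<^sub>R br (P i) (P j))"
    unfolding split_def
    by (intro smooth_on_sum smooth_on_bounded_linear[OF bounded_linear_scaleR_left] smooth_on_mult
        smooth_on_bounded_linear[OF bounded_linear_inner_left] v w)
  then show ?thesis
    by (rule smooth_on_cong[THEN iffD1, rotated]) (use v w P(3) exp in metis)
qed

locale compact_bundle = lie_algebra_bundle X B b0 atlas K kk br trivs + compact_lie kk br N
  for X :: "'x topology" and B :: "'m::euclidean_space set" and b0 :: 'm
    and atlas :: "('x set \<times> ('x \<Rightarrow> 'm)) set"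
    and K :: "'x \<Rightarrow> 'v lie_alg" and kk :: "'k::euclidean_space set" and br :: "'k \<Rightarrow> 'k \<Rightarrow> 'k"
    and trivs :: "('x set \<times> ('x \<Rightarrow> 'v \<Rightarrow> 'k)) set" and N :: "'k \<Rightarrow> real"
begin

section \<open>Smooth functions and bump functions on the manifold\<close>

abbreviation "half \<equiv> half_space B b0"
abbreviation "GG \<equiv> sections X B b0 atlas K trivs"
abbreviation "Gc \<equiv> compact_sections X B b0 atlas K trivs"

lemma chart_inj: "(U, \<phi>) \<in> atlas \<Longrightarrow> inj_on \<phi> U"
proof -
  assume a: "(U, \<phi>) \<in> atlas"
  have "U \<subseteq> topspace X" using chart_domain[OF a] openin_subset by blast
  then show ?thesis
    using homeomorphic_imp_injective_map[OF chart_homeomorphism[OF a]] by (simp add: inf.absorb2)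
qed

lemma chart_inv: "(U, \<phi>) \<in> atlas \<Longrightarrow> x \<in> U \<Longrightarrow> inv_into U \<phi> (\<phi> x) = x"
  by (rule inv_into_f_f[OF chart_inj])

lemma chart_inv_in: "(U, \<phi>) \<in> atlas \<Longrightarrow> y \<in> \<phi> ` (U \<inter> W) \<Longrightarrow> inv_into U \<phi> y \<in> U \<inter> W"
  using chart_inv by auto

lemma chart_subset: "(U, \<phi>) \<in> atlas \<Longrightarrow> U \<subseteq> topspace X"
  using chart_domain openin_subset by blast

lemma triv_subset: "(W, \<Phi>) \<in> trivs \<Longrightarrow> W \<subseteq> topspace X"
  using triv_domain openin_subset by blast

lemma chart_open_image:
  assumes a: "(U, \<phi>) \<in> atlas" and O: "openin X O'" "O' \<subseteq> U"
  shows "openin (top_of_set half) (\<phi> ` O')"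
proof -
  have "openin (subtopology X U) O'" using O by (simp add: openin_open_subtopology[OF chart_domain[OF a]])
  then have "openin (top_of_set (\<phi> ` U)) (\<phi> ` O')"
    using homeomorphic_map_openness_eq[OF chart_homeomorphism[OF a]] chart_subset[OF a]
      homeomorphic_imp_open_map[OF chart_homeomorphism[OF a]] by (auto simp: open_map_def)
  then show ?thesis using chart_range[OF a] openin_trans by blast
qed

text \<open>Compact sets are closed in a Hausdorff space, so the part in \<open>W\<close> and the
  complement of \<open>C\<close> form an open cover to which \<open>smooth_on_extend_zero\<close>
  applies.\<close>

lemma smooth_chart_extend_zero:
  fixes h :: "'m \<Rightarrow> 'f::real_normed_vector"
  assumes a: "(U, \<phi>) \<in> atlas" and O: "openin X O'" and W: "openin X W" and C: "compactin X C" "C \<subseteq> W"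
    and h: "smooth_on B b0 (\<phi> ` (U \<inter> O' \<inter> W)) h" and h0: "\<And>x. x \<in> U \<inter> O' - C \<Longrightarrow> h (\<phi> x) = 0"
  shows "smooth_on B b0 (\<phi> ` (U \<inter> O')) h"
proof -
  have cl: "closedin X C" by (rule compactin_imp_closedin[OF hausdorff C(1)])
  have 1: "openin (top_of_set half) (\<phi> ` (U \<inter> O' \<inter> W))"
    by (rule chart_open_image[OF a]) (use chart_domain[OF a] O W in auto)
  have 2: "openin (top_of_set half) (\<phi> ` (U \<inter> O' - C))"
    by (rule chart_open_image[OF a]) (use chart_domain[OF a] O cl in \<open>auto intro: openin_diff\<close>)
  have "smooth_on B b0 (\<phi> ` (U \<inter> O' \<inter> W) \<union> \<phi> ` (U \<inter> O' - C)) h"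
    by (rule smooth_on_extend_zero[OF 1 2 h _ coordinates]) (use h0 in auto)
  moreover have "\<phi> ` (U \<inter> O' \<inter> W) \<union> \<phi> ` (U \<inter> O' - C) = \<phi> ` (U \<inter> O')" using C(2) by blast
  ultimately show ?thesis by simp
qed

definition smf :: "('x \<Rightarrow> 'f::real_normed_vector) \<Rightarrow> bool" where
  "smf f \<longleftrightarrow> (\<forall>(U, \<phi>)\<in>atlas. smooth_on B b0 (\<phi> ` U) (\<lambda>y. f (inv_into U \<phi> y)))"

text \<open>Compact support inside \<open>W\<close> is witnessed by some compact set and not by the
  closure of the nonzero set, so that sums are handled by uniting witnesses.\<close>

definition supp_in :: "'x set \<Rightarrow> ('x \<Rightarrow> 'f::zero) \<Rightarrow> bool" where
  "supp_in W f \<longleftrightarrow> (\<exists>C. compactin X C \<and> C \<subseteq> W \<and> (\<forall>x\<in>topspace X - C. f x = 0))"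

lemma smfD: "smf f \<Longrightarrow> (U, \<phi>) \<in> atlas \<Longrightarrow> smooth_on B b0 (\<phi> ` U) (\<lambda>y. f (inv_into U \<phi> y))"
  by (auto simp: smf_def)

lemma smf_on: "smf f \<Longrightarrow> (U, \<phi>) \<in> atlas \<Longrightarrow> smooth_on B b0 (\<phi> ` (U \<inter> W)) (\<lambda>y. f (inv_into U \<phi> y))"
  using smooth_on_subset[OF smfD, of f U \<phi> "\<phi> ` (U \<inter> W)"] by auto

lemma smf_const: "smf (\<lambda>_. c)"
  by (auto simp: smf_def smooth_on_const)

lemma smf_add: "smf f \<Longrightarrow> smf g \<Longrightarrow> smf (\<lambda>x. f x + g x)"
  by (auto simp: smf_def intro: smooth_on_add)

lemma smf_mult: "smf f \<Longrightarrow> smf g \<Longrightarrow> smf (\<lambda>x. f x * g x :: real)"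
  by (auto simp: smf_def intro: smooth_on_mult)

lemma smf_linear: "bounded_linear T \<Longrightarrow> smf f \<Longrightarrow> smf (\<lambda>x. T (f x))"
  by (auto simp: smf_def intro: smooth_on_bounded_linear)

lemma smf_extend_zero:
  assumes W: "openin X W" and f: "supp_in W f"
    and sm: "\<And>U \<phi>. (U, \<phi>) \<in> atlas \<Longrightarrow> smooth_on B b0 (\<phi> ` (U \<inter> W)) (\<lambda>y. f (inv_into U \<phi> y))"
  shows "smf f"
  unfolding smf_def
proof clarify
  fix U \<phi> assume a: "(U, \<phi>) \<in> atlas"
  obtain C where C: "compactin X C" "C \<subseteq> W" "\<And>x. x \<in> topspace X - C \<Longrightarrow> f x = 0"
    using f by (auto simp: supp_in_def)
  have UW: "U \<inter> topspace X = U" using chart_subset[OF a] by blast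
  have "smooth_on B b0 (\<phi> ` (U \<inter> topspace X)) (\<lambda>y. f (inv_into U \<phi> y))"
  proof (rule smooth_chart_extend_zero[OF a openin_topspace W C(1,2)])
    show "smooth_on B b0 (\<phi> ` (U \<inter> topspace X \<inter> W)) (\<lambda>y. f (inv_into U \<phi> y))"
      unfolding UW by (rule sm[OF a])
    show "f (inv_into U \<phi> (\<phi> x)) = 0" if "x \<in> U \<inter> topspace X - C" for x
      using that chart_inv[OF a] C(3) by auto
  qed
  then show "smooth_on B b0 (\<phi> ` U) (\<lambda>y. f (inv_into U \<phi> y))" unfolding UW .
qed

text \<open>Two cutoffs are produced together because \<rho> has to be accompanied by a compactly
  supported \<zeta> that is one wherever \<rho> is nonzero. Both are the same smooth step applied to
  multiples of the squared chart distance.\<close>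

lemma bump_exists:
  assumes W: "openin X W" and x0: "x0 \<in> W"
  shows "\<exists>\<rho> \<zeta> M. smf \<rho> \<and> smf \<zeta> \<and> supp_in W \<rho> \<and> supp_in W \<zeta> \<and> (\<forall>x. \<zeta> x * \<rho> x = (\<rho> x :: real)) \<and>
    openin X M \<and> x0 \<in> M \<and> (\<forall>x\<in>M. \<rho> x = 1)"
proof -
  have "x0 \<in> (\<Union>(U, \<phi>)\<in>atlas. U)" unfolding charts_cover using W x0 openin_subset by blast
  then obtain U \<phi> where a: "(U, \<phi>) \<in> atlas" and x0U: "x0 \<in> U" by auto
  note UX = chart_subset[OF a]
  define y0 where "y0 = \<phi> x0"
  have "openin (top_of_set half) (\<phi> ` (U \<inter> W))"
    by (rule chart_open_image[OF a]) (use chart_domain[OF a] W in auto)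
  then obtain Q where Q: "open Q" "\<phi> ` (U \<inter> W) = half \<inter> Q" by (auto simp: openin_open)
  have "y0 \<in> half \<inter> Q" using Q x0 x0U by (auto simp: y0_def)
  then obtain r where r: "0 < r" "cball y0 r \<subseteq> Q" using Q(1) open_contains_cball by blast
  define q where "q x = (norm (\<phi> x - y0))\<^sup>2" for x
  obtain H h where H: "derivative_closed H" "h \<in> H" "\<And>x. x \<le> 1 \<Longrightarrow> h x = 1" "\<And>x. 2 \<le> x \<Longrightarrow> h x = (0::real)"
    using smooth_step_exists by blast
  \<comment> \<open>Compactness of \<open>C\<close> rests on the half-space being closed, which also
    covers points on the boundary of the manifold.\<close>
  define C where "C = inv_into U \<phi> ` (half \<inter> cball y0 r)"
  have half_closed: "closed half"
  proof -
    have "half = span B \<inter> {y. b0 \<in> B \<longrightarrow> 0 \<le> y \<bullet> b0}" by (auto simp: half_space_def)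
    moreover have "closed {y. b0 \<in> B \<longrightarrow> 0 \<le> y \<bullet> b0}"
      by (cases "b0 \<in> B") (simp_all add: inner_commute[of _ b0] closed_halfspace_ge)
    ultimately show ?thesis by (simp add: closed_Int closed_span)
  qed
  have sub: "half \<inter> cball y0 r \<subseteq> \<phi> ` (U \<inter> W)" using Q r by auto
  have CW: "C \<subseteq> U \<inter> W" unfolding C_def using sub chart_inv_in[OF a] by blast
  have compC: "compactin X C"
  proof -
    obtain g where g: "homeomorphic_maps (subtopology X U) (top_of_set (\<phi> ` U)) \<phi> g"
      using chart_homeomorphism[OF a] homeomorphic_map_maps by blast
    have gi: "g (\<phi> x) = x" if "x \<in> U" for x using g that UX by (auto simp: homeomorphic_maps_def)
    have "C = g ` (half \<inter> cball y0 r)"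
      unfolding C_def by (rule image_cong[OF refl]) (use sub gi chart_inv[OF a] in auto)
    moreover have "compact (half \<inter> cball y0 r)" by (rule closed_Int_compact[OF half_closed compact_cball])
    then have "compactin (top_of_set (\<phi> ` U)) (half \<inter> cball y0 r)"
      using sub by (auto simp: compactin_subtopology)
    moreover have "continuous_map (top_of_set (\<phi> ` U)) (subtopology X U) g" using g by (simp add: homeomorphic_maps_def)
    ultimately have "compactin (subtopology X U) C" using image_compactin by metis
    then show ?thesis by (simp add: compactin_subtopology)
  qed
  have qC: "x \<in> C" if "x \<in> U" "q x < r\<^sup>2" for x
  proof -
    have "norm (\<phi> x - y0) < r" using that(2) r(1) unfolding q_def by (metis less_imp_le power2_less_imp_less)
    then have "\<phi> x \<in> cball y0 r" by (simp add: dist_norm norm_minus_commute)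
    moreover have "\<phi> x \<in> half" using chart_range[OF a] that(1) openin_subset by fastforce
    ultimately show ?thesis unfolding C_def using chart_inv[OF a that(1)] by (metis IntI imageI)
  qed
  \<comment> \<open>For \<open>c = 4 / r\<^sup>2\<close> the cutoff is one up to
    \<open>q = (r / 2)\<^sup>2\<close> and zero from \<open>r\<^sup>2 / 2\<close> on; for
    \<open>c = 2 / r\<^sup>2\<close> it is one up to \<open>r\<^sup>2 / 2\<close> and zero from
    \<open>r\<^sup>2\<close> on. So the second is one wherever the first is nonzero.\<close>
  define bmp where "bmp c x = (if x \<in> U then h (c * q x) else 0)" for c x
  have bmp0: "bmp c x = 0" if "2 / r\<^sup>2 \<le> c" "x \<notin> C" for c x
  proof (cases "x \<in> U")
    case True
    then have "r\<^sup>2 \<le> q x" using qC that(2) by force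
    then have "2 / r\<^sup>2 * r\<^sup>2 \<le> c * q x" using that(1) r(1) by (intro mult_mono) (auto simp: order_trans[OF _ that(1)])
    then show ?thesis using H(4) r(1) by (simp add: bmp_def)
  qed (simp add: bmp_def)
  have supp: "supp_in (U \<inter> W) (bmp c)" if "2 / r\<^sup>2 \<le> c" for c
    unfolding supp_in_def using compC CW bmp0[OF that] by blast
  have smooth: "smf (bmp c)" if c: "2 / r\<^sup>2 \<le> c" for c
  proof (rule smf_extend_zero[OF chart_domain[OF a]])
    show "supp_in U (bmp c)" using supp[OF c] by (auto simp: supp_in_def)
    fix V \<psi> assume b: "(V, \<psi>) \<in> atlas"
    \<comment> \<open>In another chart the squared distance is a polynomial in the components of the
      transition map.\<close>
    let ?F = "\<lambda>y. \<phi> (inv_into V \<psi> y) + (- y0)"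
    have F: "smooth_on B b0 (\<psi> ` (V \<inter> U)) ?F"
      using charts_compatible[OF b a] by (intro smooth_on_add smooth_on_const) (simp add: o_def)
    have "smooth_on B b0 (\<psi> ` (V \<inter> U)) (\<lambda>y. h (c * (\<Sum>i\<in>Basis. (?F y \<bullet> i) * (?F y \<bullet> i))))"
      by (intro smooth_on_compose[OF _ H(1,2)] smooth_on_mult[OF smooth_on_const] smooth_on_sum smooth_on_mult
          smooth_on_bounded_linear[OF bounded_linear_inner_left] F)
    then show "smooth_on B b0 (\<psi> ` (V \<inter> U)) (\<lambda>y. bmp c (inv_into V \<psi> y))"
    proof (rule smooth_on_cong[THEN iffD1, rotated])
      fix y assume "y \<in> \<psi> ` (V \<inter> U)"
      then have "inv_into V \<psi> y \<in> U" using chart_inv_in[OF b] by blast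
      moreover have "(\<Sum>i\<in>Basis. (?F y \<bullet> i) * (?F y \<bullet> i)) = q (inv_into V \<psi> y)"
        unfolding q_def power2_norm_eq_inner by (subst euclidean_inner) simp
      ultimately show "h (c * (\<Sum>i\<in>Basis. (?F y \<bullet> i) * (?F y \<bullet> i))) = bmp c (inv_into V \<psi> y)"
        by (simp add: bmp_def)
    qed
  qed
  have suppW: "supp_in W (bmp c)" if "2 / r\<^sup>2 \<le> c" for c
    using supp[OF that] by (auto simp: supp_in_def)
  define M where "M = {x \<in> U. \<phi> x \<in> ball y0 (r / 2)}"
  have "openin (subtopology X U) M"
  proof -
    have "continuous_map (subtopology X U) (top_of_set (\<phi> ` U)) \<phi>"
      using chart_homeomorphism[OF a] by (rule homeomorphic_imp_continuous_map)
    then have "continuous_map (subtopology X U) euclidean \<phi>" using continuous_map_in_subtopology by blast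
    then have "openin (subtopology X U) {x \<in> topspace (subtopology X U). \<phi> x \<in> ball y0 (r / 2)}"
      by (rule openin_continuous_map_preimage) simp
    moreover have "{x \<in> topspace (subtopology X U). \<phi> x \<in> ball y0 (r / 2)} = M"
      using UX by (auto simp: M_def)
    ultimately show ?thesis by simp
  qed
  then have M: "openin X M" using chart_domain[OF a] by (simp add: openin_open_subtopology)
  have "bmp (4 / r\<^sup>2) x = 1" if "x \<in> M" for x
  proof -
    have "norm (\<phi> x - y0) < r / 2" using that by (simp add: M_def dist_norm norm_minus_commute)
    then have "q x \<le> (r / 2)\<^sup>2" unfolding q_def by (intro power_mono) auto
    then have "4 / r\<^sup>2 * q x \<le> 1" using r(1) by (simp add: field_simps power2_eq_square)
    then show ?thesis using H(3) that by (simp add: bmp_def M_def)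
  qed
  moreover have "bmp (2 / r\<^sup>2) x * bmp (4 / r\<^sup>2) x = bmp (4 / r\<^sup>2) x" for x
  proof (cases "x \<in> U \<and> 4 / r\<^sup>2 * q x < 2")
    case True
    then have "2 / r\<^sup>2 * q x \<le> 1" by simp
    then show ?thesis using True H(3) by (simp add: bmp_def)
  next
    case False
    then have "bmp (4 / r\<^sup>2) x = 0" using H(4) by (auto simp: bmp_def)
    then show ?thesis by simp
  qed
  moreover have "x0 \<in> M" using x0U r(1) by (simp add: M_def y0_def)
  moreover have "2 / r\<^sup>2 \<le> 4 / r\<^sup>2" by (simp add: divide_right_mono)
  ultimately show ?thesis
    using smooth[of "4 / r\<^sup>2"] smooth[of "2 / r\<^sup>2"] suppW[of "4 / r\<^sup>2"] suppW[of "2 / r\<^sup>2"] M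
    by (intro exI[of _ "bmp (4 / r\<^sup>2)"] exI[of _ "bmp (2 / r\<^sup>2)"] exI[of _ M]) simp
qed

end

context compact_bundle
begin

section \<open>The Lie algebra of compactly supported sections\<close>

lemma triv_hom:
  assumes "(W, \<Phi>) \<in> trivs" "x \<in> W"
  shows "s \<in> carrier (K x) \<Longrightarrow> \<Phi> x s \<in> kk"
    "s \<in> carrier (K x) \<Longrightarrow> t \<in> carrier (K x) \<Longrightarrow> \<Phi> x (vadd (K x) s t) = \<Phi> x s + \<Phi> x t"
    "s \<in> carrier (K x) \<Longrightarrow> \<Phi> x (vscale (K x) r s) = r *\<^sub>R \<Phi> x s"
    "s \<in> carrier (K x) \<Longrightarrow> t \<in> carrier (K x) \<Longrightarrow> \<Phi> x (lbr (K x) s t) = br (\<Phi> x s) (\<Phi> x t)"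
  using triv_iso[OF assms] by (auto simp: lie_iso_def lie_hom_def subspace_lie_def)

lemma triv_bij: "(W, \<Phi>) \<in> trivs \<Longrightarrow> x \<in> W \<Longrightarrow> bij_betw (\<Phi> x) (carrier (K x)) kk"
  using triv_iso by (auto simp: lie_iso_def subspace_lie_def)

lemma triv_inj: "(W, \<Phi>) \<in> trivs \<Longrightarrow> x \<in> W \<Longrightarrow> s \<in> carrier (K x) \<Longrightarrow> t \<in> carrier (K x) \<Longrightarrow>
    \<Phi> x s = \<Phi> x t \<Longrightarrow> s = t"
  using triv_bij by (auto simp: bij_betw_def inj_on_def)

lemma triv_inv:
  assumes "(W, \<Phi>) \<in> trivs" "x \<in> W"
  shows "v \<in> kk \<Longrightarrow> inv_into (carrier (K x)) (\<Phi> x) v \<in> carrier (K x)"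
    "v \<in> kk \<Longrightarrow> \<Phi> x (inv_into (carrier (K x)) (\<Phi> x) v) = v"
    "s \<in> carrier (K x) \<Longrightarrow> inv_into (carrier (K x)) (\<Phi> x) (\<Phi> x s) = s"
  using triv_bij[OF assms] by (auto simp: bij_betw_def inv_into_into f_inv_into_f)

lemma fibre_closed:
  assumes "x \<in> topspace X"
  shows "vzero (K x) \<in> carrier (K x)"
    "s \<in> carrier (K x) \<Longrightarrow> t \<in> carrier (K x) \<Longrightarrow> vadd (K x) s t \<in> carrier (K x)"
    "s \<in> carrier (K x) \<Longrightarrow> vscale (K x) r s \<in> carrier (K x)"
    "s \<in> carrier (K x) \<Longrightarrow> t \<in> carrier (K x) \<Longrightarrow> lbr (K x) s t \<in> carrier (K x)"
    "s \<in> carrier (K x) \<Longrightarrow> vscale (K x) 0 s = vzero (K x)"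
  using fibre_lie[OF assms] by (simp_all add: lie_algebra_def)

lemma triv_zero: "(W, \<Phi>) \<in> trivs \<Longrightarrow> x \<in> W \<Longrightarrow> \<Phi> x (vzero (K x)) = 0"
proof -
  assume t: "(W, \<Phi>) \<in> trivs" "x \<in> W"
  then have x: "x \<in> topspace X" using triv_subset by blast
  show ?thesis
    using triv_hom(3)[OF t fibre_closed(1)[OF x], of 0] fibre_closed(5)[OF x fibre_closed(1)[OF x]] by simp
qed

lemma triv_cover:
  assumes "x \<in> topspace X"
  shows "\<exists>W \<Phi>. (W, \<Phi>) \<in> trivs \<and> x \<in> W"
proof -
  have "x \<in> (\<Union>(W, \<Phi>)\<in>trivs. W)" unfolding trivs_cover by (rule assms)
  then show ?thesis by auto
qed

lemma fibre_eqI: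
  assumes "x \<in> topspace X" "s \<in> carrier (K x)" "t \<in> carrier (K x)"
    "\<And>W \<Phi>. (W, \<Phi>) \<in> trivs \<Longrightarrow> x \<in> W \<Longrightarrow> \<Phi> x s = \<Phi> x t"
  shows "s = t"
  using triv_cover[OF assms(1)] triv_inj assms by metis

lemma fibre_zero_ops:
  assumes x: "x \<in> topspace X"
  shows "vadd (K x) (vzero (K x)) (vzero (K x)) = vzero (K x)" "vscale (K x) r (vzero (K x)) = vzero (K x)"
    "s \<in> carrier (K x) \<Longrightarrow> lbr (K x) (vzero (K x)) s = vzero (K x)"
    "s \<in> carrier (K x) \<Longrightarrow> lbr (K x) s (vzero (K x)) = vzero (K x)"
proof -
  note c = fibre_closed[OF x]
  show "vadd (K x) (vzero (K x)) (vzero (K x)) = vzero (K x)"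
    by (rule fibre_eqI[OF x]) (simp_all add: c triv_hom triv_zero)
  show "vscale (K x) r (vzero (K x)) = vzero (K x)"
    by (rule fibre_eqI[OF x]) (simp_all add: c triv_hom triv_zero)
  show "lbr (K x) (vzero (K x)) s = vzero (K x)" if "s \<in> carrier (K x)"
    by (rule fibre_eqI[OF x]) (use that in \<open>simp_all add: c triv_hom triv_zero br_zero\<close>)
  show "lbr (K x) s (vzero (K x)) = vzero (K x)" if "s \<in> carrier (K x)"
    by (rule fibre_eqI[OF x]) (use that in \<open>simp_all add: c triv_hom triv_zero br_0\<close>)
qed

lemma Gc_ops:
  "vadd Gc s t = (\<lambda>x\<in>topspace X. vadd (K x) (s x) (t x))"
  "vzero Gc = (\<lambda>x\<in>topspace X. vzero (K x))"
  "vscale Gc r s = (\<lambda>x\<in>topspace X. vscale (K x) r (s x))"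
  "lbr Gc s t = (\<lambda>x\<in>topspace X. lbr (K x) (s x) (t x))"
  by (simp_all add: compact_sections_def sections_def Let_def)

text \<open>For compact \<open>C\<close> this agrees with containment of the support in
  \<open>C\<close>, as compact sets are closed (\<open>support_subset_iff\<close>).\<close>

definition Gam :: "'x set \<Rightarrow> ('x \<Rightarrow> 'v) set" where
  "Gam C = {s \<in> carrier Gc. \<forall>x\<in>topspace X - C. s x = vzero (K x)}"

lemma support_subset_iff:
  assumes "compactin X C" "s \<in> (\<Pi>\<^sub>E x\<in>topspace X. carrier (K x))"
  shows "section_support X K s \<subseteq> C \<longleftrightarrow> (\<forall>x\<in>topspace X - C. s x = vzero (K x))"
proof
  assume "section_support X K s \<subseteq> C"
  moreover have "{x \<in> topspace X. s x \<noteq> vzero (K x)} \<subseteq> section_support X K s"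
    unfolding section_support_def by (rule closure_of_subset) auto
  ultimately show "\<forall>x\<in>topspace X - C. s x = vzero (K x)" by blast
next
  assume "\<forall>x\<in>topspace X - C. s x = vzero (K x)"
  then show "section_support X K s \<subseteq> C"
    unfolding section_support_def using compactin_imp_closedin[OF hausdorff assms(1)]
    by (intro closure_of_minimal) auto
qed

lemma compact_support_iff:
  assumes "s \<in> (\<Pi>\<^sub>E x\<in>topspace X. carrier (K x))"
  shows "compactin X (section_support X K s) \<longleftrightarrow> (\<exists>C. compactin X C \<and> (\<forall>x\<in>topspace X - C. s x = vzero (K x)))"
proof
  assume "compactin X (section_support X K s)"
  then show "\<exists>C. compactin X C \<and> (\<forall>x\<in>topspace X - C. s x = vzero (K x))"
    using support_subset_iff[OF _ assms] by blast
next
  assume "\<exists>C. compactin X C \<and> (\<forall>x\<in>topspace X - C. s x = vzero (K x))"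
  then obtain C where "compactin X C" "section_support X K s \<subseteq> C"
    using support_subset_iff[OF _ assms] by blast
  then show "compactin X (section_support X K s)"
    by (rule closed_compactin) (simp add: section_support_def)
qed

lemma carrier_GG: "s \<in> carrier GG \<longleftrightarrow> s \<in> (\<Pi>\<^sub>E x\<in>topspace X. carrier (K x)) \<and>
     (\<forall>(U, \<phi>)\<in>atlas. \<forall>(W, \<Phi>)\<in>trivs. smooth_on B b0 (\<phi> ` (U \<inter> W)) (\<lambda>y. \<Phi> (inv_into U \<phi> y) (s (inv_into U \<phi> y))))"
  by (auto simp: sections_def local_dom_def local_rep_def Let_def split: prod.splits)

lemma carrier_Gc_GG: "s \<in> carrier Gc \<longleftrightarrow> s \<in> carrier GG \<and> compactin X (section_support X K s)"
  by (simp add: compact_sections_def Let_def)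

lemma carrier_Gc: "s \<in> carrier Gc \<longleftrightarrow> s \<in> (\<Pi>\<^sub>E x\<in>topspace X. carrier (K x)) \<and>
     (\<forall>(U, \<phi>)\<in>atlas. \<forall>(W, \<Phi>)\<in>trivs. smooth_on B b0 (\<phi> ` (U \<inter> W)) (\<lambda>y. \<Phi> (inv_into U \<phi> y) (s (inv_into U \<phi> y)))) \<and>
     (\<exists>C. compactin X C \<and> (\<forall>x\<in>topspace X - C. s x = vzero (K x)))"
  unfolding carrier_Gc_GG carrier_GG using compact_support_iff by blast

lemma Gc_fibre: "s \<in> carrier Gc \<Longrightarrow> x \<in> topspace X \<Longrightarrow> s x \<in> carrier (K x)"
  by (auto simp: carrier_Gc PiE_iff)

lemma Gc_undefined: "s \<in> carrier Gc \<Longrightarrow> x \<notin> topspace X \<Longrightarrow> s x = undefined"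
  by (auto simp: carrier_Gc PiE_iff extensional_def)

lemma Gc_smooth: "s \<in> carrier Gc \<Longrightarrow> (U, \<phi>) \<in> atlas \<Longrightarrow> (W, \<Phi>) \<in> trivs \<Longrightarrow>
    smooth_on B b0 (\<phi> ` (U \<inter> W)) (\<lambda>y. \<Phi> (inv_into U \<phi> y) (s (inv_into U \<phi> y)))"
  by (auto simp: carrier_Gc)

lemma Gc_Gam: "s \<in> carrier Gc \<Longrightarrow> \<exists>C. compactin X C \<and> s \<in> Gam C"
  by (auto simp: carrier_Gc Gam_def)

lemma Gc_eqI:
  assumes "s \<in> carrier Gc" "t \<in> carrier Gc" "\<And>x. x \<in> topspace X \<Longrightarrow> s x = t x"
  shows "s = t"
  using assms Gc_undefined by (intro ext) metis

lemma GcI: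
  assumes "\<And>x. x \<in> topspace X \<Longrightarrow> s x \<in> carrier (K x)"
    and "\<And>U \<phi> W \<Phi>. (U, \<phi>) \<in> atlas \<Longrightarrow> (W, \<Phi>) \<in> trivs \<Longrightarrow>
      smooth_on B b0 (\<phi> ` (U \<inter> W)) (\<lambda>y. \<Phi> (inv_into U \<phi> y) (s (inv_into U \<phi> y)))"
    and "compactin X C" "\<And>x. x \<in> topspace X - C \<Longrightarrow> s x = vzero (K x)"
  shows "restrict s (topspace X) \<in> carrier Gc"
  unfolding carrier_Gc
proof (intro conjI)
  show "restrict s (topspace X) \<in> (\<Pi>\<^sub>E x\<in>topspace X. carrier (K x))" using assms(1) by auto
  show "\<exists>C. compactin X C \<and> (\<forall>x\<in>topspace X - C. restrict s (topspace X) x = vzero (K x))"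
    using assms(3,4) by auto
  show "\<forall>(U, \<phi>)\<in>atlas. \<forall>(W, \<Phi>)\<in>trivs. smooth_on B b0 (\<phi> ` (U \<inter> W))
      (\<lambda>y. \<Phi> (inv_into U \<phi> y) (restrict s (topspace X) (inv_into U \<phi> y)))"
  proof clarify
    fix U \<phi> W \<Phi> assume a: "(U, \<phi>) \<in> atlas" "(W, \<Phi>) \<in> trivs"
    show "smooth_on B b0 (\<phi> ` (U \<inter> W)) (\<lambda>y. \<Phi> (inv_into U \<phi> y) (restrict s (topspace X) (inv_into U \<phi> y)))"
      by (rule smooth_on_cong[THEN iffD1, OF _ assms(2)[OF a]])
        (use chart_inv_in[OF a(1)] triv_subset[OF a(2)] in auto)
  qed
qed

lemma Gc_zero: "vzero Gc \<in> carrier Gc"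
  unfolding Gc_ops
proof (rule GcI[of _ "{}"])
  fix U \<phi> W \<Phi> assume a: "(U, \<phi>) \<in> atlas" "(W, \<Phi>) \<in> trivs"
  show "smooth_on B b0 (\<phi> ` (U \<inter> W)) (\<lambda>y. \<Phi> (inv_into U \<phi> y) (vzero (K (inv_into U \<phi> y))))"
    by (rule smooth_on_cong[THEN iffD1, OF _ smooth_on_const[of _ _ _ 0]])
      (use chart_inv_in[OF a(1)] triv_zero[OF a(2)] in auto)
qed (auto simp: fibre_closed)

lemma Gc_add:
  assumes s: "s \<in> carrier Gc" and t: "t \<in> carrier Gc"
  shows "vadd Gc s t \<in> carrier Gc"
proof -
  obtain C D where C: "compactin X C" "s \<in> Gam C" and D: "compactin X D" "t \<in> Gam D" using Gc_Gam s t by metis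
  show ?thesis unfolding Gc_ops
  proof (rule GcI[of _ "C \<union> D"])
    fix U \<phi> W \<Phi> assume a: "(U, \<phi>) \<in> atlas" "(W, \<Phi>) \<in> trivs"
    show "smooth_on B b0 (\<phi> ` (U \<inter> W)) (\<lambda>y. \<Phi> (inv_into U \<phi> y)
        (vadd (K (inv_into U \<phi> y)) (s (inv_into U \<phi> y)) (t (inv_into U \<phi> y))))"
      by (rule smooth_on_cong[THEN iffD1, OF _ smooth_on_add[OF Gc_smooth[OF s a] Gc_smooth[OF t a]]])
        (use chart_inv_in[OF a(1)] triv_subset[OF a(2)] Gc_fibre[OF s] Gc_fibre[OF t] triv_hom(2)[OF a(2)] in \<open>auto 0 3\<close>)
  qed (use C D s t in \<open>auto simp: fibre_closed Gc_fibre Gam_def fibre_zero_ops compactin_Un\<close>)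
qed

definition fmul :: "('x \<Rightarrow> real) \<Rightarrow> ('x \<Rightarrow> 'v) \<Rightarrow> 'x \<Rightarrow> 'v" where
  "fmul f s = (\<lambda>x\<in>topspace X. vscale (K x) (f x) (s x))"

lemma Gam_fmul:
  assumes f: "smf f" and C: "compactin X C" and s: "s \<in> Gam C"
  shows "fmul f s \<in> Gam C"
proof -
  have s': "s \<in> carrier Gc" using s by (simp add: Gam_def)
  have "fmul f s \<in> carrier Gc"
    unfolding fmul_def
  proof (rule GcI[of _ C])
    fix U \<phi> W \<Phi> assume a: "(U, \<phi>) \<in> atlas" "(W, \<Phi>) \<in> trivs"
    show "smooth_on B b0 (\<phi> ` (U \<inter> W)) (\<lambda>y. \<Phi> (inv_into U \<phi> y)
        (vscale (K (inv_into U \<phi> y)) (f (inv_into U \<phi> y)) (s (inv_into U \<phi> y))))"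
      by (rule smooth_on_cong[THEN iffD1, OF _ smooth_on_scaleR[OF smf_on[OF f a(1)] Gc_smooth[OF s' a]]])
        (use chart_inv_in[OF a(1)] triv_subset[OF a(2)] Gc_fibre[OF s'] triv_hom(3)[OF a(2)] in \<open>auto 0 3\<close>)
  qed (use C s s' in \<open>auto simp: fibre_closed Gc_fibre Gam_def fibre_zero_ops\<close>)
  then show ?thesis using s by (auto simp: Gam_def fmul_def fibre_zero_ops)
qed

lemma fmul_closed: "smf f \<Longrightarrow> s \<in> carrier Gc \<Longrightarrow> fmul f s \<in> carrier Gc"
  using Gc_Gam Gam_fmul by (metis (no_types, lifting) Gam_def mem_Collect_eq)

lemma vscale_fmul: "vscale Gc r s = fmul (\<lambda>_. r) s"
  by (simp add: Gc_ops fmul_def)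

lemma Gc_scale: "s \<in> carrier Gc \<Longrightarrow> vscale Gc r s \<in> carrier Gc"
  unfolding vscale_fmul by (rule fmul_closed[OF smf_const])

lemma Gam_br:
  assumes C: "compactin X C" and s: "s \<in> Gam C" and t: "t \<in> carrier Gc"
  shows "lbr Gc s t \<in> Gam C"
proof -
  have s': "s \<in> carrier Gc" using s by (simp add: Gam_def)
  have "lbr Gc s t \<in> carrier Gc" unfolding Gc_ops
  proof (rule GcI[of _ C])
    fix U \<phi> W \<Phi> assume a: "(U, \<phi>) \<in> atlas" "(W, \<Phi>) \<in> trivs"
    show "smooth_on B b0 (\<phi> ` (U \<inter> W)) (\<lambda>y. \<Phi> (inv_into U \<phi> y)
        (lbr (K (inv_into U \<phi> y)) (s (inv_into U \<phi> y)) (t (inv_into U \<phi> y))))"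
      by (rule smooth_on_cong[THEN iffD1, OF _ smooth_on_br[OF Gc_smooth[OF s' a] _ Gc_smooth[OF t a]]])
        (use chart_inv_in[OF a(1)] triv_subset[OF a(2)] Gc_fibre[OF s'] Gc_fibre[OF t] triv_hom(1,4)[OF a(2)] in \<open>auto 0 3\<close>)
  qed (use C s s' t in \<open>auto simp: fibre_closed Gc_fibre Gam_def fibre_zero_ops\<close>)
  then show ?thesis using s t by (auto simp: Gam_def Gc_ops fibre_zero_ops Gc_fibre)
qed

lemma Gc_br: "s \<in> carrier Gc \<Longrightarrow> t \<in> carrier Gc \<Longrightarrow> lbr Gc s t \<in> carrier Gc"
  using Gc_Gam Gam_br by (metis (no_types, lifting) Gam_def mem_Collect_eq)

lemma Gc_scale_zero: "s \<in> carrier Gc \<Longrightarrow> vscale Gc 0 s = vzero Gc"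
  unfolding Gc_ops using Gc_fibre fibre_closed(5) by (auto simp: fun_eq_iff)

section \<open>Sections supported in a single trivialisation\<close>

definition lvec :: "'x set \<Rightarrow> ('x \<Rightarrow> 'k) set" where
  "lvec W = {v. smf v \<and> supp_in W v \<and> (\<forall>x. v x \<in> kk)}"

definition lsec :: "'x set \<Rightarrow> ('x \<Rightarrow> 'v \<Rightarrow> 'k) \<Rightarrow> ('x \<Rightarrow> 'k) \<Rightarrow> 'x \<Rightarrow> 'v" where
  "lsec W \<Phi> v = (\<lambda>x\<in>topspace X. if x \<in> W then inv_into (carrier (K x)) (\<Phi> x) (v x) else vzero (K x))"

lemma lsec_fibre:
  assumes "(W, \<Phi>) \<in> trivs" "\<And>x. v x \<in> kk" "x \<in> topspace X"
  shows "lsec W \<Phi> v x \<in> carrier (K x)" "x \<in> W \<Longrightarrow> \<Phi> x (lsec W \<Phi> v x) = v x"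
    "x \<notin> W \<Longrightarrow> lsec W \<Phi> v x = vzero (K x)"
  using assms triv_inv[OF assms(1)] fibre_closed(1) by (auto simp: lsec_def)

text \<open>Smoothness has to be seen in every other trivialisation. Transition maps are fibrewise
  linear and smooth on constant vectors, so expanding \<open>v\<close> in coordinates gives a finite
  sum of smooth products over \<open>W\<close>; away from \<open>C\<close> the section is
  zero.\<close>

lemma lsec_Gam:
  assumes t: "(W, \<Phi>) \<in> trivs" and v: "smf v" "\<And>x. v x \<in> kk" and C: "compactin X C" "C \<subseteq> W"
    and v0: "\<And>x. x \<in> topspace X - C \<Longrightarrow> v x = 0"
  shows "lsec W \<Phi> v \<in> Gam C"
proof -
  note f = lsec_fibre[OF t v(2)]
  have z: "lsec W \<Phi> v x = vzero (K x)" if x: "x \<in> topspace X - C" for x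
  proof (cases "x \<in> W")
    case True
    then show ?thesis
      using triv_inj[OF t True f(1)] x f(2)[of x] v0[OF x] triv_zero[OF t True] fibre_closed(1)[of x] by auto
  qed (use x f in auto)
  obtain P where P: "linear P" "\<And>v. P v \<in> kk" "\<And>v. v \<in> kk \<Longrightarrow> P v = v"
    by (rule subspace_projection[OF sub]) blast
  have "restrict (lsec W \<Phi> v) (topspace X) \<in> carrier Gc"
  proof (rule GcI[of _ C])
    fix U \<phi> W' \<Psi> assume a: "(U, \<phi>) \<in> atlas" and t': "(W', \<Psi>) \<in> trivs"
    let ?I = "inv_into U \<phi>"
    \<comment> \<open>Coordinate vectors need not lie in the typical fibre, so they are projected
      into it first.\<close>
    let ?T = "\<lambda>i x. \<Psi> x (inv_into (carrier (K x)) (\<Phi> x) (P i))"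
    show "smooth_on B b0 (\<phi> ` (U \<inter> W')) (\<lambda>y. \<Psi> (?I y) (lsec W \<Phi> v (?I y)))"
    proof (rule smooth_chart_extend_zero[OF a triv_domain[OF t'] triv_domain[OF t] C])
      show "\<Psi> (?I (\<phi> x)) (lsec W \<Phi> v (?I (\<phi> x))) = 0" if "x \<in> U \<inter> W' - C" for x
        using that z chart_inv[OF a] triv_subset[OF t'] triv_zero[OF t'] by auto
      have T: "smooth_on B b0 (\<phi> ` (U \<inter> W' \<inter> W)) (\<lambda>y. ?T i (?I y))" for i
        using trivs_compatible[OF t t' a P(2), of i] by (simp add: Let_def Int_commute Int_left_commute)
      have vs: "smooth_on B b0 (\<phi> ` (U \<inter> W' \<inter> W)) (\<lambda>y. v (?I y))"
        using smf_on[OF v(1) a, of "W' \<inter> W"] by (simp add: Int_assoc)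
      have "smooth_on B b0 (\<phi> ` (U \<inter> W' \<inter> W)) (\<lambda>y. \<Sum>i\<in>Basis. (v (?I y) \<bullet> i) *\<^sub>R ?T i (?I y))"
        by (intro smooth_on_sum smooth_on_scaleR T smooth_on_bounded_linear[OF bounded_linear_inner_left] vs)
      then show "smooth_on B b0 (\<phi> ` (U \<inter> W' \<inter> W)) (\<lambda>y. \<Psi> (?I y) (lsec W \<Phi> v (?I y)))"
      proof (rule smooth_on_cong[THEN iffD1, rotated])
        fix y assume "y \<in> \<phi> ` (U \<inter> W' \<inter> W)"
        then have "?I y \<in> U \<inter> (W' \<inter> W)" using chart_inv_in[OF a, of y "W' \<inter> W"] by (simp add: Int_assoc)
        then obtain x where x: "x = ?I y" "x \<in> W" "x \<in> W'" "x \<in> topspace X" using triv_subset[OF t] by auto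
        define \<alpha> where "\<alpha> u = \<Psi> x (inv_into (carrier (K x)) (\<Phi> x) (P u))" for u
        have "linear \<alpha>"
        proof (rule linearI)
          fix u w r
          have "inv_into (carrier (K x)) (\<Phi> x) (P (u + w))
            = vadd (K x) (inv_into (carrier (K x)) (\<Phi> x) (P u)) (inv_into (carrier (K x)) (\<Phi> x) (P w))"
            by (rule triv_inj[OF t x(2)])
              (simp_all add: triv_inv[OF t x(2)] triv_hom[OF t x(2)] fibre_closed[OF x(4)] P(2) linear_add[OF P(1)])
          then show "\<alpha> (u + w) = \<alpha> u + \<alpha> w"
            by (simp add: \<alpha>_def triv_hom[OF t' x(3)] triv_inv[OF t x(2)] P(2))
          have "inv_into (carrier (K x)) (\<Phi> x) (P (r *\<^sub>R u)) = vscale (K x) r (inv_into (carrier (K x)) (\<Phi> x) (P u))"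
            by (rule triv_inj[OF t x(2)])
              (simp_all add: triv_inv[OF t x(2)] triv_hom[OF t x(2)] fibre_closed[OF x(4)] P(2) linear_cmul[OF P(1)])
          then show "\<alpha> (r *\<^sub>R u) = r *\<^sub>R \<alpha> u"
            by (simp add: \<alpha>_def triv_hom[OF t' x(3)] triv_inv[OF t x(2)] P(2))
        qed
        then have "\<alpha> (\<Sum>i\<in>Basis. (v x \<bullet> i) *\<^sub>R i) = (\<Sum>i\<in>Basis. (v x \<bullet> i) *\<^sub>R \<alpha> i)"
          by (simp add: linear_sum linear_cmul)
        then have "(\<Sum>i\<in>Basis. (v x \<bullet> i) *\<^sub>R \<alpha> i) = \<alpha> (v x)" by (simp add: euclidean_representation)
        also have "\<dots> = \<Psi> x (lsec W \<Phi> v x)" using x v(2) by (simp add: \<alpha>_def lsec_def P(3))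
        finally show "(\<Sum>i\<in>Basis. (v (?I y) \<bullet> i) *\<^sub>R ?T i (?I y)) = \<Psi> (?I y) (lsec W \<Phi> v (?I y))"
          by (simp add: \<alpha>_def x(1))
      qed
    qed
  qed (use f C z in auto)
  moreover have "restrict (lsec W \<Phi> v) (topspace X) = lsec W \<Phi> v" by (simp add: lsec_def fun_eq_iff)
  ultimately show ?thesis using z by (simp add: Gam_def)
qed

lemma lvec_lsec:
  assumes t: "(W, \<Phi>) \<in> trivs" and v: "v \<in> lvec W"
  shows "lsec W \<Phi> v \<in> carrier Gc" "\<exists>C. compactin X C \<and> lsec W \<Phi> v \<in> Gam C"
proof -
  obtain C where "compactin X C" "C \<subseteq> W" "\<And>x. x \<in> topspace X - C \<Longrightarrow> v x = 0"
    using v by (auto simp: lvec_def supp_in_def)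
  then have "compactin X C \<and> lsec W \<Phi> v \<in> Gam C" using lsec_Gam[OF t] v by (auto simp: lvec_def)
  then show "lsec W \<Phi> v \<in> carrier Gc" "\<exists>C. compactin X C \<and> lsec W \<Phi> v \<in> Gam C" by (auto simp: Gam_def)
qed

end

text \<open>Alternating the two symmetries through all six orders of the arguments brings back the
  first order with a minus sign.\<close>

lemma sym_skew_zero:
  fixes e :: "'a \<Rightarrow> 'a \<Rightarrow> 'a \<Rightarrow> 'b::real_vector"
  assumes "\<And>x y z. x \<in> V \<Longrightarrow> y \<in> V \<Longrightarrow> z \<in> V \<Longrightarrow> e x y z = e x z y"
    and "\<And>x y z. x \<in> V \<Longrightarrow> y \<in> V \<Longrightarrow> z \<in> V \<Longrightarrow> e x y z = - e y x z"
    and V: "x \<in> V" "y \<in> V" "z \<in> V"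
  shows "e x y z = 0"
proof -
  have "e x y z = - e y x z" by (rule assms(2)[OF V])
  also have "e y x z = e y z x" by (rule assms(1)[OF V(2,1,3)])
  also have "\<dots> = - e z y x" by (rule assms(2)[OF V(2,3,1)])
  also have "e z y x = e z x y" by (rule assms(1)[OF V(3,2,1)])
  also have "\<dots> = - e x z y" by (rule assms(2)[OF V(3,1,2)])
  also have "e x z y = e x y z" by (rule assms(1)[OF V(1,3,2)])
  finally have "2 *\<^sub>R e x y z = 0" by (simp add: scaleR_2 eq_neg_iff_add_eq_0)
  then show ?thesis by simp
qed

context compact_lie
begin

definition der :: "'i set \<Rightarrow> ('i \<Rightarrow> 'k) \<Rightarrow> ('i \<Rightarrow> 'k) \<Rightarrow> 'k \<Rightarrow> 'k" where
  "der I p q x = (\<Sum>i\<in>I. br (p i) (br (q i) x))"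

lemma sum_closed: "(\<And>i. i \<in> I \<Longrightarrow> u i \<in> V) \<Longrightarrow> (\<Sum>i\<in>I. u i) \<in> V"
  by (rule subspace_sum[OF sub])

lemma additive_on_sum:
  fixes F :: "'k \<Rightarrow> 'b::real_vector"
  assumes "finite I" "\<And>x y. x \<in> V \<Longrightarrow> y \<in> V \<Longrightarrow> F (x + y) = F x + F y" "\<And>i. i \<in> I \<Longrightarrow> u i \<in> V"
  shows "F (\<Sum>i\<in>I. u i) = (\<Sum>i\<in>I. F (u i))"
  using assms(1,3)
proof (induction I)
  case empty
  have "F (0 + 0) = F 0 + F 0" by (rule assms(2)) simp_all
  then show ?case by simp
next
  case (insert i I)
  then show ?case by (simp add: assms(2) sum_closed)
qed

lemma casimirD:
  assumes "casimir I p q"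
  shows "finite I" "p i \<in> V" "q i \<in> V"
    "x \<in> V \<Longrightarrow> y \<in> V \<Longrightarrow> der I p q (br x y) = br x y"
    "x \<in> V \<Longrightarrow> y \<in> V \<Longrightarrow> br (x - der I p q x) y = 0"
  using assms unfolding casimir_def der_def by blast+

lemma der_closed: "casimir I p q \<Longrightarrow> x \<in> V \<Longrightarrow> der I p q x \<in> V"
  unfolding der_def by (rule sum_closed) (simp add: casimirD)

lemma der_add: "casimir I p q \<Longrightarrow> x \<in> V \<Longrightarrow> y \<in> V \<Longrightarrow> der I p q (x + y) = der I p q x + der I p q y"
  by (simp add: der_def br_add_right casimirD sum.distrib)

text \<open>The Casimir identity for cocycles with values in operators follows by applying matrix coefficients.\<close>

lemma casimir_operator:
  fixes \<theta> :: "'k \<Rightarrow> 'k \<Rightarrow> ('h::complex_hilbert_space \<Rightarrow>\<^sub>L 'h)"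
  assumes cas: "casimir I p q" and \<theta>: "central_cocycle \<theta>" and V: "x \<in> V" "y \<in> V"
  shows "\<theta> x y = (\<Sum>i\<in>I. \<theta> (p i) (br (q i) (br x y)))"
proof -
  have "\<theta> x y - (\<Sum>i\<in>I. \<theta> (p i) (br (q i) (br x y))) = 0"
  proof (rule blinfun_zeroI_cinner)
    fix u w :: 'h
    define L where "L T = Re (cinner u (blinfun_apply T w))" for T
    have L: "linear L"
      by (rule linearI) (simp_all add: L_def plus_blinfun.rep_eq scaleR_blinfun.rep_eq cinner_add_right cinner_scaleR_right)
    have "central_cocycle (\<lambda>x y. L (\<theta> x y))"
      unfolding central_cocycle_def
    proof (intro conjI ballI allI impI)
      fix x y z r assume V: "x \<in> V" "y \<in> V" "z \<in> V"
      have "\<theta> (x + y) z = \<theta> x z + \<theta> y z" using \<theta> V unfolding central_cocycle_def by blast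
      then show "L (\<theta> (x + y) z) = L (\<theta> x z) + L (\<theta> y z)" by (simp add: linear_add[OF L])
    next
      fix x y r assume V: "x \<in> V" "y \<in> V"
      have "\<theta> (r *\<^sub>R x) y = r *\<^sub>R \<theta> x y" using \<theta> V unfolding central_cocycle_def by blast
      then show "L (\<theta> (r *\<^sub>R x) y) = r *\<^sub>R L (\<theta> x y)" by (simp add: linear_cmul[OF L])
    next
      fix x y assume V: "x \<in> V" "y \<in> V"
      have "\<theta> x y = - \<theta> y x" using \<theta> V unfolding central_cocycle_def by blast
      from arg_cong[OF this, of L] show "L (\<theta> x y) = - L (\<theta> y x)" by (simp only: linear_neg[OF L])
    next
      fix r x y assume V: "r \<in> V" "x \<in> V" "y \<in> V"
      have "\<theta> r (br x y) = \<theta> (br r x) y + \<theta> x (br r y)" using \<theta> V unfolding central_cocycle_def by blast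
      from arg_cong[OF this, of L] show "L (\<theta> r (br x y)) = L (\<theta> (br r x) y) + L (\<theta> x (br r y))"
        by (simp only: linear_add[OF L])
    next
      fix z y assume "z \<in> V" "y \<in> V" "\<forall>w\<in>V. br z w = 0"
      then have "\<theta> z y = 0" using \<theta> unfolding central_cocycle_def by blast
      then show "L (\<theta> z y) = 0" by (simp add: linear_0[OF L])
    qed
    then have "L (\<theta> x y) = (\<Sum>i\<in>I. L (\<theta> (p i) (br (q i) (br x y))))"
      using cas V unfolding casimir_def by blast
    then have "L (\<theta> x y - (\<Sum>i\<in>I. \<theta> (p i) (br (q i) (br x y)))) = 0"
      by (simp add: linear_diff[OF L] linear_sum[OF L])
    then show "Re (cinner u (blinfun_apply (\<theta> x y - (\<Sum>i\<in>I. \<theta> (p i) (br (q i) (br x y)))) w)) = 0"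
      by (simp add: L_def)
  qed
  then show ?thesis by simp
qed

end

context compact_bundle
begin

definition lfun :: "'x set \<Rightarrow> ('x \<Rightarrow> real) set" where
  "lfun W = {f. smf f \<and> supp_in W f}"

lemma supp_in_cong: "supp_in W f \<Longrightarrow> (\<And>x. f x = 0 \<Longrightarrow> g x = 0) \<Longrightarrow> supp_in W g"
  unfolding supp_in_def by blast

lemma supp_in_add:
  fixes v w :: "'x \<Rightarrow> 'f::real_vector"
  assumes "supp_in W v" "supp_in W w"
  shows "supp_in W (\<lambda>x. v x + w x)"
proof -
  obtain C D where "compactin X C" "C \<subseteq> W" "\<forall>x\<in>topspace X - C. v x = 0"
    "compactin X D" "D \<subseteq> W" "\<forall>x\<in>topspace X - D. w x = 0"
    using assms by (auto simp: supp_in_def)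
  then show ?thesis unfolding supp_in_def by (intro exI[of _ "C \<union> D"]) (auto simp: compactin_Un)
qed

lemma lvec_add: "v \<in> lvec W \<Longrightarrow> w \<in> lvec W \<Longrightarrow> (\<lambda>x. v x + w x) \<in> lvec W"
  by (auto simp: lvec_def intro: smf_add supp_in_add)

lemma lvec_const:
  assumes "f \<in> lfun W" "T \<in> kk"
  shows "(\<lambda>x. f x *\<^sub>R T) \<in> lvec W"
proof -
  have "supp_in W (\<lambda>x. f x *\<^sub>R T)" by (rule supp_in_cong[of W f]) (use assms in \<open>auto simp: lfun_def\<close>)
  then show ?thesis using assms by (auto simp: lvec_def lfun_def intro: smf_linear[OF bounded_linear_scaleR_left])
qed

lemma smf_br:
  assumes "smf v" "\<And>x. v x \<in> kk" "smf w" "\<And>x. w x \<in> kk"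
  shows "smf (\<lambda>x. br (v x) (w x))"
  using assms by (auto simp: smf_def intro!: smooth_on_br)

lemma lvec_br:
  assumes "v \<in> lvec W" "w \<in> lvec W"
  shows "(\<lambda>x. br (v x) (w x)) \<in> lvec W"
proof -
  have "supp_in W (\<lambda>x. br (v x) (w x))"
    by (rule supp_in_cong[of W v]) (use assms in \<open>auto simp: lvec_def br_zero\<close>)
  then show ?thesis using assms by (auto simp: lvec_def intro: smf_br)
qed

lemma lvec_br_const: "v \<in> lvec W \<Longrightarrow> T \<in> kk \<Longrightarrow> (\<lambda>x. br T (v x)) \<in> lvec W"
proof -
  assume v: "v \<in> lvec W" and T: "T \<in> kk"
  have "supp_in W (\<lambda>x. br T (v x))" by (rule supp_in_cong[of W v]) (use v T in \<open>auto simp: lvec_def br_0\<close>)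
  then show ?thesis using v T by (auto simp: lvec_def intro: smf_br smf_const)
qed

lemma lvec_zero: "(\<lambda>x. 0) \<in> lvec W"
  by (auto simp: lvec_def smf_const supp_in_def intro!: exI[of _ "{}"])

lemma lvec_sum: "(\<And>a. a \<in> F \<Longrightarrow> v a \<in> lvec W) \<Longrightarrow> (\<lambda>x. \<Sum>a\<in>F. v a x) \<in> lvec W"
  by (induction F rule: infinite_finite_induct) (simp_all add: lvec_zero lvec_add)

lemma lvecD: "v \<in> lvec W \<Longrightarrow> v x \<in> kk"
  by (simp add: lvec_def)

lemma lfun_mult: "smf f \<Longrightarrow> g \<in> lfun W \<Longrightarrow> (\<lambda>x. f x * g x) \<in> lfun W"
  by (auto simp: lfun_def intro: smf_mult supp_in_cong)

lemma lfun_mult': "f \<in> lfun W \<Longrightarrow> g \<in> lfun W \<Longrightarrow> (\<lambda>x. f x * g x) \<in> lfun W"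
  by (rule lfun_mult) (auto simp: lfun_def)

lemma lfun_coord:
  assumes "v \<in> lvec W"
  shows "(\<lambda>x. v x \<bullet> a) \<in> lfun W"
proof -
  have "supp_in W (\<lambda>x. v x \<bullet> a)" by (rule supp_in_cong[of W v]) (use assms in \<open>auto simp: lvec_def\<close>)
  then show ?thesis using assms by (auto simp: lvec_def lfun_def intro: smf_linear[OF bounded_linear_inner_left])
qed

definition loc :: "'x set \<Rightarrow> ('x \<Rightarrow> 'v \<Rightarrow> 'k) \<Rightarrow> ('x \<Rightarrow> real) \<Rightarrow> ('x \<Rightarrow> 'v) \<Rightarrow> 'x \<Rightarrow> 'k" where
  "loc W \<Phi> f s x = (if x \<in> W then f x *\<^sub>R \<Phi> x (s x) else 0)"

lemma loc_lvec:
  assumes t: "(W, \<Phi>) \<in> trivs" and f: "f \<in> lfun W" and s: "s \<in> carrier Gc"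
  shows "loc W \<Phi> f s \<in> lvec W"
proof -
  have supp: "supp_in W (loc W \<Phi> f s)"
    by (rule supp_in_cong[of W f]) (use f in \<open>auto simp: lfun_def loc_def\<close>)
  have "smf (loc W \<Phi> f s)"
  proof (rule smf_extend_zero[OF triv_domain[OF t] supp])
    fix U \<phi> assume a: "(U, \<phi>) \<in> atlas"
    show "smooth_on B b0 (\<phi> ` (U \<inter> W)) (\<lambda>y. loc W \<Phi> f s (inv_into U \<phi> y))"
      by (rule smooth_on_cong[THEN iffD1, OF _ smooth_on_scaleR[OF smf_on[OF _ a] Gc_smooth[OF s a t]]])
        (use f chart_inv_in[OF a] in \<open>auto simp: loc_def lfun_def\<close>)
  qed
  moreover have "loc W \<Phi> f s x \<in> kk" for x
    using triv_hom(1)[OF t] triv_subset[OF t] Gc_fibre[OF s] by (auto simp: loc_def)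
  ultimately show ?thesis using supp by (simp add: lvec_def)
qed

lemma lsec_eqI:
  assumes t: "(W, \<Phi>) \<in> trivs" and v: "\<And>x. v x \<in> kk" and s: "\<And>x. x \<in> topspace X \<Longrightarrow> s x \<in> carrier (K x)"
    and "\<And>x. x \<notin> topspace X \<Longrightarrow> s x = undefined"
    and "\<And>x. x \<in> W \<Longrightarrow> \<Phi> x (s x) = v x" "\<And>x. x \<in> topspace X - W \<Longrightarrow> s x = vzero (K x)"
  shows "s = lsec W \<Phi> v"
proof
  fix x
  show "s x = lsec W \<Phi> v x"
  proof (cases "x \<in> topspace X")
    case True
    show ?thesis
    proof (cases "x \<in> W")
      case W: True
      show ?thesis by (rule triv_inj[OF t W s[OF True] lsec_fibre(1)[OF t v True]])
          (use lsec_fibre(2)[OF t v True W] assms(5)[OF W] in simp)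
    qed (use lsec_fibre(3)[OF t v True] True assms(6) in simp)
  qed (use assms(4) in \<open>simp add: lsec_def\<close>)
qed

lemma lsec_ops:
  assumes t: "(W, \<Phi>) \<in> trivs" and v: "\<And>x. v x \<in> kk" and w: "\<And>x. w x \<in> kk"
  shows "vadd Gc (lsec W \<Phi> v) (lsec W \<Phi> w) = lsec W \<Phi> (\<lambda>x. v x + w x)"
    "vscale Gc r (lsec W \<Phi> v) = lsec W \<Phi> (\<lambda>x. r *\<^sub>R v x)"
    "lbr Gc (lsec W \<Phi> v) (lsec W \<Phi> w) = lsec W \<Phi> (\<lambda>x. br (v x) (w x))"
proof -
  note V = lsec_fibre[OF t v] and W = lsec_fibre[OF t w]
  show "vadd Gc (lsec W \<Phi> v) (lsec W \<Phi> w) = lsec W \<Phi> (\<lambda>x. v x + w x)"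
  proof (rule lsec_eqI[OF t])
    fix x
    show "v x + w x \<in> kk" using v w by simp
    show "vadd Gc (lsec W \<Phi> v) (lsec W \<Phi> w) x \<in> carrier (K x)" if "x \<in> topspace X"
      using that by (simp add: Gc_ops fibre_closed V W)
    show "vadd Gc (lsec W \<Phi> v) (lsec W \<Phi> w) x = undefined" if "x \<notin> topspace X"
      using that by (simp add: Gc_ops)
    show "\<Phi> x (vadd Gc (lsec W \<Phi> v) (lsec W \<Phi> w) x) = v x + w x" if "x \<in> W"
    proof -
      have "x \<in> topspace X" using that triv_subset[OF t] by blast
      then show ?thesis using that by (simp add: Gc_ops triv_hom[OF t that] V W)
    qed
    show "vadd Gc (lsec W \<Phi> v) (lsec W \<Phi> w) x = vzero (K x)" if "x \<in> topspace X - W"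
      using that by (simp add: Gc_ops fibre_zero_ops fibre_closed V W)
  qed
  show "vscale Gc r (lsec W \<Phi> v) = lsec W \<Phi> (\<lambda>x. r *\<^sub>R v x)"
  proof (rule lsec_eqI[OF t])
    fix x
    show "r *\<^sub>R v x \<in> kk" using v w by simp
    show "vscale Gc r (lsec W \<Phi> v) x \<in> carrier (K x)" if "x \<in> topspace X"
      using that by (simp add: Gc_ops fibre_closed V W)
    show "vscale Gc r (lsec W \<Phi> v) x = undefined" if "x \<notin> topspace X"
      using that by (simp add: Gc_ops)
    show "\<Phi> x (vscale Gc r (lsec W \<Phi> v) x) = r *\<^sub>R v x" if "x \<in> W"
    proof -
      have "x \<in> topspace X" using that triv_subset[OF t] by blast
      then show ?thesis using that by (simp add: Gc_ops triv_hom[OF t that] V W)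
    qed
    show "vscale Gc r (lsec W \<Phi> v) x = vzero (K x)" if "x \<in> topspace X - W"
      using that by (simp add: Gc_ops fibre_zero_ops fibre_closed V W)
  qed
  show "lbr Gc (lsec W \<Phi> v) (lsec W \<Phi> w) = lsec W \<Phi> (\<lambda>x. br (v x) (w x))"
  proof (rule lsec_eqI[OF t])
    fix x
    show "br (v x) (w x) \<in> kk" using v w by simp
    show "lbr Gc (lsec W \<Phi> v) (lsec W \<Phi> w) x \<in> carrier (K x)" if "x \<in> topspace X"
      using that by (simp add: Gc_ops fibre_closed V W)
    show "lbr Gc (lsec W \<Phi> v) (lsec W \<Phi> w) x = undefined" if "x \<notin> topspace X"
      using that by (simp add: Gc_ops)
    show "\<Phi> x (lbr Gc (lsec W \<Phi> v) (lsec W \<Phi> w) x) = br (v x) (w x)" if "x \<in> W"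
    proof -
      have "x \<in> topspace X" using that triv_subset[OF t] by blast
      then show ?thesis using that by (simp add: Gc_ops triv_hom[OF t that] V W)
    qed
    show "lbr Gc (lsec W \<Phi> v) (lsec W \<Phi> w) x = vzero (K x)" if "x \<in> topspace X - W"
      using that by (simp add: Gc_ops fibre_zero_ops fibre_closed V W)
  qed
qed

text \<open>The section \<open>z\<close> may live outside \<open>W\<close>; bracketing with a
  section supported there sees only its restriction.\<close>

lemma lsec_br_right:
  assumes t: "(W, \<Phi>) \<in> trivs" and v: "\<And>x. v x \<in> kk" and z: "z \<in> carrier Gc"
  shows "lbr Gc (lsec W \<Phi> v) z = lsec W \<Phi> (\<lambda>x. if x \<in> W then br (v x) (\<Phi> x (z x)) else 0)"
proof (rule lsec_eqI[OF t])
  note V = lsec_fibre[OF t v] and Z = Gc_fibre[OF z]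
  fix x
  show "(if x \<in> W then br (v x) (\<Phi> x (z x)) else 0) \<in> kk"
  proof (cases "x \<in> W")
    case True
    then have "z x \<in> carrier (K x)" using triv_subset[OF t] Z by blast
    then show ?thesis using True triv_hom(1)[OF t True] v by simp
  qed simp
  show "lbr Gc (lsec W \<Phi> v) z x \<in> carrier (K x)" if "x \<in> topspace X"
    using that by (simp add: Gc_ops fibre_closed V Z)
  show "lbr Gc (lsec W \<Phi> v) z x = undefined" if "x \<notin> topspace X"
    using that by (simp add: Gc_ops)
  show "\<Phi> x (lbr Gc (lsec W \<Phi> v) z x) = (if x \<in> W then br (v x) (\<Phi> x (z x)) else 0)" if "x \<in> W"
  proof -
    have "x \<in> topspace X" using that triv_subset[OF t] by blast
    then show ?thesis using that by (simp add: Gc_ops triv_hom[OF t that] V Z)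
  qed
  show "lbr Gc (lsec W \<Phi> v) z x = vzero (K x)" if "x \<in> topspace X - W"
    using that by (simp add: Gc_ops fibre_zero_ops fibre_closed V Z)
qed

lemma fmul_lsec:
  assumes t: "(W, \<Phi>) \<in> trivs" and f: "f \<in> lfun W" and s: "s \<in> carrier Gc"
  shows "fmul f s = lsec W \<Phi> (loc W \<Phi> f s)"
proof (rule lsec_eqI[OF t])
  note c = Gc_fibre[OF s]
  fix x
  show "loc W \<Phi> f s x \<in> kk" using loc_lvec[OF t f s] by (rule lvecD)
  show "x \<in> topspace X \<Longrightarrow> fmul f s x \<in> carrier (K x)" by (simp add: fmul_def fibre_closed c)
  show "x \<notin> topspace X \<Longrightarrow> fmul f s x = undefined" by (simp add: fmul_def)
  show "x \<in> W \<Longrightarrow> \<Phi> x (fmul f s x) = loc W \<Phi> f s x"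
    using triv_subset[OF t] triv_hom(3)[OF t] c by (auto simp: fmul_def loc_def)
  show "fmul f s x = vzero (K x)" if "x \<in> topspace X - W"
  proof -
    have "f x = 0" using f that by (auto simp: lfun_def supp_in_def)
    then show ?thesis using that c by (simp add: fmul_def fibre_closed)
  qed
qed

lemma fmul_add:
  assumes s: "s \<in> carrier Gc" and fg: "smf f" "smf g"
  shows "fmul (\<lambda>x. f x + g x) s = vadd Gc (fmul f s) (fmul g s)"
proof (rule Gc_eqI)
  show "fmul (\<lambda>x. f x + g x) s \<in> carrier Gc" by (intro fmul_closed smf_add s fg)
  show "vadd Gc (fmul f s) (fmul g s) \<in> carrier Gc" by (intro Gc_add fmul_closed s fg)
  fix x assume x: "x \<in> topspace X"
  note c = Gc_fibre[OF s x]
  show "fmul (\<lambda>x. f x + g x) s x = vadd Gc (fmul f s) (fmul g s) x"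
    by (rule fibre_eqI[OF x]) (use x in \<open>simp_all add: fmul_def Gc_ops fibre_closed c triv_hom scaleR_add_left\<close>)
qed

lemma fmul_one:
  assumes s: "s \<in> Gam C" and f: "smf f" "\<And>x. x \<in> C \<Longrightarrow> f x = 1"
  shows "fmul f s = s"
proof (rule Gc_eqI)
  have s': "s \<in> carrier Gc" using s by (simp add: Gam_def)
  then show "fmul f s \<in> carrier Gc" "s \<in> carrier Gc" using fmul_closed f by auto
  fix x assume x: "x \<in> topspace X"
  show "fmul f s x = s x"
  proof (cases "x \<in> C")
    case True
    show ?thesis
      by (rule fibre_eqI[OF x])
        (use x f(2)[OF True] Gc_fibre[OF s' x] in \<open>simp_all add: fmul_def fibre_closed triv_hom\<close>)
  next
    case False
    then have "s x = vzero (K x)" using s x by (auto simp: Gam_def)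
    then show ?thesis using x by (simp add: fmul_def fibre_zero_ops)
  qed
qed

end

section \<open>The local commutator form\<close>

locale bundle_rep = compact_bundle X B b0 atlas K kk br trivs N +
    proj_rep "compact_sections X B b0 atlas K trivs" pb
  for X :: "'x topology" and B :: "'m::euclidean_space set" and b0 :: 'm
    and atlas :: "('x set \<times> ('x \<Rightarrow> 'm)) set"
    and K :: "'x \<Rightarrow> 'v lie_alg" and kk :: "'k::euclidean_space set" and br :: "'k \<Rightarrow> 'k \<Rightarrow> 'k"
    and trivs :: "('x set \<times> ('x \<Rightarrow> 'v \<Rightarrow> 'k)) set" and N :: "'k \<Rightarrow> real"
    and pb :: "('x \<Rightarrow> 'v) \<Rightarrow> ('h::complex_hilbert_space \<Rightarrow>\<^sub>L 'h) set" +
  fixes I :: "'i set" and p q :: "'i \<Rightarrow> 'k"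
  assumes cas: "casimir I p q"
begin

abbreviation pr :: "'k \<Rightarrow> 'k" where "pr \<equiv> der I p q"

context
  fixes W \<Phi>
  assumes t: "(W, \<Phi>) \<in> trivs"
begin

abbreviation c :: "('x \<Rightarrow> 'k) \<Rightarrow> ('x \<Rightarrow> 'k) \<Rightarrow> 'h \<Rightarrow>\<^sub>L 'h" where
  "c v w \<equiv> com (lsec W \<Phi> v) (lsec W \<Phi> w)"

lemma sec: "v \<in> lvec W \<Longrightarrow> lsec W \<Phi> v \<in> carrier Gc"
  by (rule lvec_lsec(1)[OF t])

lemma c_add_left:
  assumes "v \<in> lvec W" "v' \<in> lvec W" "w \<in> lvec W"
  shows "c (\<lambda>x. v x + v' x) w = c v w + c v' w"
  unfolding lsec_ops(1)[OF t lvecD[OF assms(1)] lvecD[OF assms(2)], symmetric]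
  by (intro com_add_left sec assms)

lemma c_anti: "c v w = - c w v"
  by (rule com_anti)

lemma c_add_right:
  assumes "v \<in> lvec W" "w \<in> lvec W" "w' \<in> lvec W"
  shows "c v (\<lambda>x. w x + w' x) = c v w + c v w'"
  unfolding lsec_ops(1)[OF t lvecD[OF assms(2)] lvecD[OF assms(3)], symmetric]
  by (intro com_add_right sec assms)

lemma c_scale_left:
  assumes "v \<in> lvec W" "w \<in> lvec W"
  shows "c (\<lambda>x. r *\<^sub>R v x) w = r *\<^sub>R c v w"
  unfolding lsec_ops(2)[OF t lvecD[OF assms(1)] lvecD[OF assms(1)], symmetric]
  by (intro com_scale_left sec assms)

lemma c_jacobi:
  assumes "u \<in> lvec W" "v \<in> lvec W" "w \<in> lvec W"
  shows "c u (\<lambda>x. br (v x) (w x)) = c (\<lambda>x. br (u x) (v x)) w + c v (\<lambda>x. br (u x) (w x))"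
  unfolding lsec_ops(3)[OF t lvecD[OF assms(2)] lvecD[OF assms(3)], symmetric]
    lsec_ops(3)[OF t lvecD[OF assms(1)] lvecD[OF assms(2)], symmetric]
    lsec_ops(3)[OF t lvecD[OF assms(1)] lvecD[OF assms(3)], symmetric]
  by (intro com_jacobi sec assms)

lemma lsec_zero: "lsec W \<Phi> (\<lambda>x. 0) = vzero Gc"
  unfolding Gc_ops(2)
  by (rule lsec_eqI[OF t, symmetric])
    (use triv_zero[OF t] triv_subset[OF t] fibre_closed(1) in auto)

lemma c_zero:
  assumes "v \<in> lvec W" "w \<in> lvec W" "\<And>x. br (v x) (w x) = 0"
  shows "c v w = 0"
proof (rule com_zero[OF sec[OF assms(1)] sec[OF assms(2)]])
  show "lbr Gc (lsec W \<Phi> v) (lsec W \<Phi> w) = vzero Gc"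
    unfolding lsec_ops(3)[OF t lvecD[OF assms(1)] lvecD[OF assms(2)]] assms(3) by (rule lsec_zero)
qed

lemma c_sum_left:
  assumes F: "finite F" and v: "\<And>a. a \<in> F \<Longrightarrow> v a \<in> lvec W" and w: "w \<in> lvec W"
  shows "c (\<lambda>x. \<Sum>a\<in>F. v a x) w = (\<Sum>a\<in>F. c (v a) w)"
  using F v
proof (induction F)
  case empty
  have "c (\<lambda>x. 0) w = 0" by (rule c_zero[OF lvec_zero w]) (use lvecD[OF w] br_zero in blast)
  then show ?case by simp
next
  case (insert a F)
  have "c (\<lambda>x. v a x + (\<Sum>a\<in>F. v a x)) w = c (v a) w + c (\<lambda>x. \<Sum>a\<in>F. v a x) w"
    by (rule c_add_left) (use insert.prems w in \<open>auto intro: lvec_sum\<close>)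
  then show ?case using insert by simp
qed

lemma c_sum_right:
  assumes "finite F" "\<And>a. a \<in> F \<Longrightarrow> v a \<in> lvec W" "w \<in> lvec W"
  shows "c w (\<lambda>x. \<Sum>a\<in>F. v a x) = (\<Sum>a\<in>F. c w (v a))"
proof -
  have "c w (\<lambda>x. \<Sum>a\<in>F. v a x) = - c (\<lambda>x. \<Sum>a\<in>F. v a x) w" by (rule c_anti)
  also have "c (\<lambda>x. \<Sum>a\<in>F. v a x) w = (\<Sum>a\<in>F. c (v a) w)" by (rule c_sum_left[OF assms])
  also have "- (\<Sum>a\<in>F. c (v a) w) = (\<Sum>a\<in>F. - c (v a) w)" by (simp add: sum_negf)
  also have "\<dots> = (\<Sum>a\<in>F. c w (v a))" by (rule sum.cong[OF refl]) (rule c_anti[symmetric])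
  finally show ?thesis .
qed

section \<open>The form on products of functions and constant vectors\<close>

abbreviation Om :: "('x \<Rightarrow> real) \<Rightarrow> ('x \<Rightarrow> real) \<Rightarrow> 'k \<Rightarrow> 'k \<Rightarrow> 'h \<Rightarrow>\<^sub>L 'h" where
  "Om f g T S \<equiv> c (\<lambda>x. f x *\<^sub>R T) (\<lambda>x. g x *\<^sub>R S)"

lemma br_scales: "T \<in> kk \<Longrightarrow> S \<in> kk \<Longrightarrow> br (r *\<^sub>R T) (s *\<^sub>R S) = (r * s) *\<^sub>R br T S"
  by (simp add: br_scale_left br_scale_right mult.commute)

lemma Om_add_left:
  assumes "f \<in> lfun W" "g \<in> lfun W" "T \<in> kk" "T' \<in> kk" "S \<in> kk"
  shows "Om f g (T + T') S = Om f g T S + Om f g T' S"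
  unfolding scaleR_add_right by (intro c_add_left lvec_const assms)

lemma Om_add_right:
  assumes "f \<in> lfun W" "g \<in> lfun W" "T \<in> kk" "S \<in> kk" "S' \<in> kk"
  shows "Om f g T (S + S') = Om f g T S + Om f g T S'"
  unfolding scaleR_add_right by (intro c_add_right lvec_const assms)

lemma Om_scale_left:
  assumes "f \<in> lfun W" "g \<in> lfun W" "T \<in> kk" "S \<in> kk"
  shows "Om f g (r *\<^sub>R T) S = r *\<^sub>R Om f g T S"
  unfolding scaleR_left_commute[of _ r] by (intro c_scale_left lvec_const assms)

lemma Om_central:
  assumes "f \<in> lfun W" "g \<in> lfun W" "T \<in> kk" "S \<in> kk" "br T S = 0"
  shows "Om f g T S = 0"
  by (rule c_zero) (use assms in \<open>simp_all add: lvec_const br_scales\<close>)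

text \<open>Polarisation of the vanishing on the commuting sections \<open>f T\<close> and
  \<open>g T\<close>. It excludes contributions symmetric in the constant vectors, such as those
  built from f dg.\<close>

lemma Om_skew:
  assumes "f \<in> lfun W" "g \<in> lfun W" "T \<in> kk" "S \<in> kk"
  shows "Om f g T S = - Om f g S T"
proof -
  have "Om f g (T + S) (T + S) = 0" by (rule Om_central) (use assms in \<open>simp_all add: br_same\<close>)
  moreover have "Om f g (T + S) (T + S) = Om f g T T + Om f g T S + (Om f g S T + Om f g S S)"
    using assms by (simp add: Om_add_left Om_add_right)
  moreover have "Om f g T T = 0" "Om f g S S = 0" using assms by (simp_all add: Om_central br_same)
  ultimately show ?thesis by (simp add: eq_neg_iff_add_eq_0)
qed

text \<open>The difference \<open>(1 - \<zeta>) g\<close> has zero product with \<open>f\<close>, so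
  the corresponding sections commute: the form is local.\<close>

lemma Om_cut:
  assumes f: "f \<in> lfun W" and g: "g \<in> lfun W" and z: "smf \<zeta>" "\<And>x. \<zeta> x * f x = f x" and T: "T \<in> kk" "S \<in> kk"
  shows "Om f (\<lambda>x. \<zeta> x * g x) T S = Om f g T S"
proof -
  let ?g1 = "\<lambda>x. \<zeta> x * g x" and ?g2 = "\<lambda>x. (1 + (-1) * \<zeta> x) * g x"
  have g1: "?g1 \<in> lfun W" by (rule lfun_mult[OF z(1) g])
  have g2: "?g2 \<in> lfun W" by (rule lfun_mult[OF smf_add[OF smf_const smf_mult[OF smf_const z(1)]] g])
  have "f x * ?g2 x = 0" for x using z(2)[of x] by (auto simp: algebra_simps)
  then have "Om f ?g2 T S = 0"
    by (intro c_zero lvec_const f g2 T) (simp add: br_scales T)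
  moreover have "c (\<lambda>x. f x *\<^sub>R T) (\<lambda>x. ?g1 x *\<^sub>R S + ?g2 x *\<^sub>R S) = Om f ?g1 T S + Om f ?g2 T S"
    by (intro c_add_right lvec_const f g1 g2 T)
  moreover have "?g1 x + ?g2 x = g x" for x by (simp add: algebra_simps)
  then have "(\<lambda>x. ?g1 x *\<^sub>R S + ?g2 x *\<^sub>R S) = (\<lambda>x. g x *\<^sub>R S)"
    by (simp only: scaleR_add_left[symmetric])
  ultimately show ?thesis by simp
qed

text \<open>Jacobi for \<open>\<zeta> R\<close>, \<open>f T\<close>, \<open>g S\<close>, where
  \<zeta> stands in for the constant function one, which need not be compactly supported. It
  disappears from one term by \<open>\<zeta> f = f\<close> and from the other by
  \<open>Om_cut\<close>.\<close>

lemma Om_cocycle: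
  assumes f: "f \<in> lfun W" and g: "g \<in> lfun W" and z: "\<zeta> \<in> lfun W" "\<And>x. \<zeta> x * f x = f x"
    and V: "R \<in> kk" "T \<in> kk" "S \<in> kk"
  shows "Om \<zeta> (\<lambda>x. f x * g x) R (br T S) = Om f g (br R T) S + Om f g T (br R S)"
proof -
  have "Om \<zeta> (\<lambda>x. f x * g x) R (br T S) = c (\<lambda>x. \<zeta> x *\<^sub>R R) (\<lambda>x. br (f x *\<^sub>R T) (g x *\<^sub>R S))"
    by (simp add: br_scales V)
  also have "\<dots> = c (\<lambda>x. br (\<zeta> x *\<^sub>R R) (f x *\<^sub>R T)) (\<lambda>x. g x *\<^sub>R S)
      + c (\<lambda>x. f x *\<^sub>R T) (\<lambda>x. br (\<zeta> x *\<^sub>R R) (g x *\<^sub>R S))"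
    by (intro c_jacobi lvec_const f g z V)
  also have "\<dots> = Om f g (br R T) S + Om f (\<lambda>x. \<zeta> x * g x) T (br R S)"
    by (simp add: br_scales V z(2))
  also have "Om f (\<lambda>x. \<zeta> x * g x) T (br R S) = Om f g T (br R S)"
    using z(1) by (intro Om_cut f g z(2) V br_closed) (simp add: lfun_def)
  finally show ?thesis .
qed

text \<open>The difference of both sides is skew and invariant, so it vanishes on brackets; both sides vanish on central
  elements since operators of commuting sections commute.\<close>

lemma Om_move:
  assumes f: "f \<in> lfun W" and g: "g \<in> lfun W" and z: "\<zeta> \<in> lfun W" "\<And>x. \<zeta> x * f x = f x"
    and V: "T \<in> kk" "S \<in> kk"
  shows "central_cocycle (Om \<zeta> (\<lambda>x. f x * g x))" "Om f g T S = Om \<zeta> (\<lambda>x. f x * g x) T S"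
proof -
  define h where "h x = f x * g x" for x
  have h: "h \<in> lfun W" unfolding h_def by (rule lfun_mult'[OF f g])
  have zh: "\<zeta> x * h x = h x" for x using z(2)[of x] by (simp add: h_def flip: mult.assoc)
  have coc1: "Om \<zeta> h R (br T S) = Om f g (br R T) S + Om f g T (br R S)"
    if "R \<in> kk" "T \<in> kk" "S \<in> kk" for R T S
    using Om_cocycle[OF f g z that] by (simp add: h_def[abs_def])
  \<comment> \<open>Exchanging the two sections and exchanging the two constant vectors each change
    the sign.\<close>
  have swap: "Om h \<zeta> T S = Om \<zeta> h T S" if "T \<in> kk" "S \<in> kk" for T S
    unfolding c_anti[of "\<lambda>x. h x *\<^sub>R T"] Om_skew[OF z(1) h that(2,1)] by simp
  have coc2: "Om \<zeta> h R (br T S) = Om \<zeta> h (br R T) S + Om \<zeta> h T (br R S)"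
    if V: "R \<in> kk" "T \<in> kk" "S \<in> kk" for R T S
  proof -
    \<comment> \<open>The cocycle identity is now used for the pair \<open>h\<close>, \<zeta>, with
      \<zeta> also as the auxiliary cutoff; this closes it up as an identity for one form.\<close>
    have hz: "h x * \<zeta> x = h x" for x using zh[of x] by (simp only: mult.commute)
    have "Om \<zeta> h R (br T S) = Om h \<zeta> (br R T) S + Om h \<zeta> T (br R S)"
      using Om_cocycle[OF h z(1) z(1) zh V] by (simp only: hz)
    then show ?thesis by (simp only: swap V br_closed)
  qed
  have cc: "central_cocycle (Om \<zeta> h)"
    unfolding central_cocycle_def
  proof (intro conjI ballI allI impI)
    fix z y assume "z \<in> kk" "y \<in> kk" "\<forall>w\<in>kk. br z w = 0"
    then show "Om \<zeta> h z y = 0" by (intro Om_central \<open>\<zeta> \<in> lfun W\<close> h) auto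
  qed (fact Om_add_left[OF z(1) h] Om_scale_left[OF z(1) h] Om_skew[OF z(1) h] coc2)+
  then show "central_cocycle (Om \<zeta> (\<lambda>x. f x * g x))" unfolding h_def .
  define D where "D T S = Om f g T S - Om \<zeta> h T S" for T S
  have D_add: "D (T + T') S = D T S + D T' S" if "T \<in> kk" "T' \<in> kk" "S \<in> kk" for T T' S
    using that by (simp add: D_def Om_add_left[OF f g] Om_add_left[OF z(1) h])
  have D_skew: "D T S = - D S T" if "T \<in> kk" "S \<in> kk" for T S
    unfolding D_def Om_skew[OF f g that] Om_skew[OF z(1) h that] by simp
  have D_inv: "D (br R T) S = - D T (br R S)" if "R \<in> kk" "T \<in> kk" "S \<in> kk" for R T S
  proof -
    have "Om f g (br R T) S + Om f g T (br R S) = Om \<zeta> h (br R T) S + Om \<zeta> h T (br R S)"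
      using coc1[OF that] coc2[OF that] by simp
    then show ?thesis by (simp add: D_def algebra_simps)
  qed
  have D_br: "D (br R T) S = 0" if V: "R \<in> kk" "T \<in> kk" "S \<in> kk" for R T S
  proof (rule sym_skew_zero[of kk "\<lambda>R T S. D (br R T) S", OF _ _ V])
    fix x y z assume "x \<in> kk" "y \<in> kk" "z \<in> kk"
    then show "D (br x y) z = D (br x z) y"
      using D_inv[of x y z] D_skew[of y "br x z"] by simp
  next
    fix x y z assume V: "x \<in> kk" "y \<in> kk" "z \<in> kk"
    have "D ((-1) *\<^sub>R br y x) z = - D (br y x) z"
      using V by (simp only: D_def Om_scale_left[OF f g] Om_scale_left[OF z(1) h] br_closed) simp
    then show "D (br x y) z = - D (br y x) z" using br_anti[OF V(1,2)] by simp
  qed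
  \<comment> \<open>\<open>T\<close> is split into a central element and a sum of brackets.\<close>
  have "D T S = D (T - pr T) S + D (pr T) S"
    using D_add[of "T - pr T" "pr T" S] V der_closed[OF cas] by simp
  also have "D (T - pr T) S = 0"
    unfolding D_def using V der_closed[OF cas V(1)] casimirD(5)[OF cas V]
    by (simp add: Om_central[OF f g] Om_central[OF z(1) h])
  also have "D (pr T) S = (\<Sum>i\<in>I. D (br (p i) (br (q i) T)) S)"
    unfolding der_def by (rule additive_on_sum) (use V casimirD[OF cas] D_add in auto)
  also have "\<dots> = 0" using V casimirD[OF cas] D_br by simp
  finally show "Om f g T S = Om \<zeta> (\<lambda>x. f x * g x) T S" by (simp add: D_def h_def[abs_def])
qed

text \<open>In coordinates both arguments are sums of functions times constant vectors.
  \<open>Om_move\<close> shifts all functions to the second slot, leaving a cocycle of the fibre to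
  which the Casimir identity applies; the coordinates are then summed up again.\<close>

lemma c_formula:
  assumes v: "v \<in> lvec W" and w: "w \<in> lvec W" and z: "\<zeta> \<in> lfun W" "\<And>x. \<zeta> x *\<^sub>R v x = v x"
  shows "c v w = (\<Sum>i\<in>I. c (\<lambda>x. \<zeta> x *\<^sub>R p i) (\<lambda>x. br (q i) (br (v x) (w x))))"
proof -
  obtain P where P: "linear P" "\<And>v. P v \<in> kk" "\<And>v. v \<in> kk \<Longrightarrow> P v = v"
    by (rule subspace_projection[OF sub]) blast
  note pq = casimirD[OF cas]
  let ?v = "\<lambda>a x. (v x \<bullet> a) *\<^sub>R P a" and ?w = "\<lambda>b x. (w x \<bullet> b) *\<^sub>R P b"
  have exp: "u = (\<Sum>a\<in>Basis. (u \<bullet> a) *\<^sub>R P a)" if "u \<in> kk" for u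
  proof -
    have "P (\<Sum>a\<in>Basis. (u \<bullet> a) *\<^sub>R a) = (\<Sum>a\<in>Basis. (u \<bullet> a) *\<^sub>R P a)"
      by (simp add: linear_sum[OF P(1)] linear_cmul[OF P(1)])
    then show ?thesis using P(3)[OF that] by (simp add: euclidean_representation)
  qed
  have ve: "v = (\<lambda>x. \<Sum>a\<in>Basis. ?v a x)" and we: "w = (\<lambda>x. \<Sum>b\<in>Basis. ?w b x)"
    using exp[OF lvecD[OF v]] exp[OF lvecD[OF w]] by (auto intro!: ext)
  have va: "?v a \<in> lvec W" and wb: "?w b \<in> lvec W" for a b
    by (intro lvec_const lfun_coord v w P(2))+
  have zf: "\<zeta> x * (v x \<bullet> a) = v x \<bullet> a" for x a
    using arg_cong[OF z(2)[of x], of "\<lambda>u. u \<bullet> a"] by simp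
  have br_exp: "br (q i) (br (v x) (w x)) = (\<Sum>a\<in>Basis. \<Sum>b\<in>Basis. ((v x \<bullet> a) * (w x \<bullet> b)) *\<^sub>R br (q i) (br (P a) (P b)))"
    for i x
  proof -
    have "br (q i) (br (v x) (w x)) = br (q i) (br (\<Sum>a\<in>Basis. ?v a x) (\<Sum>b\<in>Basis. ?w b x))"
      using fun_cong[OF ve, of x] fun_cong[OF we, of x] by simp
    also have "br (\<Sum>a\<in>Basis. ?v a x) (\<Sum>b\<in>Basis. ?w b x) = (\<Sum>a\<in>Basis. br (?v a x) (\<Sum>b\<in>Basis. ?w b x))"
      by (rule additive_on_sum[of _ "\<lambda>u. br u (\<Sum>b\<in>Basis. ?w b x)"])
        (use P(2) sum_closed[of Basis "\<lambda>b. ?w b x"] in \<open>simp_all add: br_add_left\<close>)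
    also have "\<dots> = (\<Sum>a\<in>Basis. \<Sum>b\<in>Basis. br (?v a x) (?w b x))"
      by (intro sum.cong refl additive_on_sum[of _ "\<lambda>u. br (?v _ x) u"])
        (use P(2) in \<open>simp_all add: br_add_right\<close>)
    also have "br (q i) (\<Sum>a\<in>Basis. \<Sum>b\<in>Basis. br (?v a x) (?w b x))
        = (\<Sum>a\<in>Basis. br (q i) (\<Sum>b\<in>Basis. br (?v a x) (?w b x)))"
      by (rule additive_on_sum) (use P(2) pq in \<open>auto simp: br_add_right intro!: sum_closed\<close>)
    also have "\<dots> = (\<Sum>a\<in>Basis. \<Sum>b\<in>Basis. br (q i) (br (?v a x) (?w b x)))"
      by (intro sum.cong refl additive_on_sum) (use P(2) pq in \<open>auto simp: br_add_right\<close>)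
    finally show ?thesis
      by (simp only: br_scales[OF P(2) P(2)] br_scale_right[OF pq(3) br_closed[OF P(2) P(2)]])
  qed
  have lv: "(\<lambda>x. ((v x \<bullet> a) * (w x \<bullet> b)) *\<^sub>R br (q i) (br (P a) (P b))) \<in> lvec W" for a b i
    by (intro lvec_const lfun_mult' lfun_coord v w br_closed P(2) pq)
  have zp: "(\<lambda>x. \<zeta> x *\<^sub>R p i) \<in> lvec W" for i by (intro lvec_const z pq)
  have "c v w = c (\<lambda>x. \<Sum>a\<in>Basis. ?v a x) (\<lambda>x. \<Sum>b\<in>Basis. ?w b x)" using ve we by simp
  also have "\<dots> = (\<Sum>a\<in>Basis. c (?v a) (\<lambda>x. \<Sum>b\<in>Basis. ?w b x))"
    by (rule c_sum_left) (use va wb in \<open>auto intro: lvec_sum\<close>)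
  also have "\<dots> = (\<Sum>a\<in>Basis. \<Sum>b\<in>Basis. c (?v a) (?w b))"
    by (intro sum.cong refl c_sum_right) (use va wb in auto)
  also have "\<dots> = (\<Sum>a\<in>Basis. \<Sum>b\<in>Basis. \<Sum>i\<in>I. Om \<zeta> (\<lambda>x. (v x \<bullet> a) * (w x \<bullet> b)) (p i) (br (q i) (br (P a) (P b))))"
  proof (intro sum.cong refl)
    fix a b :: 'k
    note m = Om_move[OF lfun_coord[OF v, of a] lfun_coord[OF w, of b] z(1) zf P(2)[of a] P(2)[of b]]
    show "c (?v a) (?w b) = (\<Sum>i\<in>I. Om \<zeta> (\<lambda>x. (v x \<bullet> a) * (w x \<bullet> b)) (p i) (br (q i) (br (P a) (P b))))"
      unfolding m(2) by (rule casimir_operator[OF cas m(1) P(2) P(2)])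
  qed
  also have "\<dots> = (\<Sum>i\<in>I. \<Sum>a\<in>Basis. \<Sum>b\<in>Basis. Om \<zeta> (\<lambda>x. (v x \<bullet> a) * (w x \<bullet> b)) (p i) (br (q i) (br (P a) (P b))))"
    by (subst sum.swap[of _ I]) (intro sum.cong refl sum.swap)
  also have "\<dots> = (\<Sum>i\<in>I. c (\<lambda>x. \<zeta> x *\<^sub>R p i) (\<lambda>x. br (q i) (br (v x) (w x))))"
  proof (intro sum.cong refl)
    fix i
    have "c (\<lambda>x. \<zeta> x *\<^sub>R p i) (\<lambda>x. br (q i) (br (v x) (w x)))
      = (\<Sum>a\<in>Basis. c (\<lambda>x. \<zeta> x *\<^sub>R p i) (\<lambda>x. \<Sum>b\<in>Basis. ((v x \<bullet> a) * (w x \<bullet> b)) *\<^sub>R br (q i) (br (P a) (P b))))"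
      unfolding br_exp by (rule c_sum_right) (use lv zp in \<open>auto intro: lvec_sum\<close>)
    also have "\<dots> = (\<Sum>a\<in>Basis. \<Sum>b\<in>Basis. Om \<zeta> (\<lambda>x. (v x \<bullet> a) * (w x \<bullet> b)) (p i) (br (q i) (br (P a) (P b))))"
      by (intro sum.cong refl c_sum_right) (use lv zp in auto)
    finally show "(\<Sum>a\<in>Basis. \<Sum>b\<in>Basis. Om \<zeta> (\<lambda>x. (v x \<bullet> a) * (w x \<bullet> b)) (p i) (br (q i) (br (P a) (P b))))
      = c (\<lambda>x. \<zeta> x *\<^sub>R p i) (\<lambda>x. br (q i) (br (v x) (w x)))" by simp
  qed
  finally show ?thesis .
qed

end

end

section \<open>Lifting projective representations\<close>

context compact_lie
begin

lemma der_central: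
  assumes cas: "casimir I p q" and "z \<in> V" "\<And>w. w \<in> V \<Longrightarrow> br z w = 0"
  shows "der I p q z = 0"
proof -
  have "br (q i) z = 0" for i using br_anti[of "q i" z] assms casimirD(3)[OF cas] by simp
  then show ?thesis using casimirD(2)[OF cas] by (simp add: der_def br_0)
qed

text \<open>The projection onto the derived algebra along the centre is intrinsic, hence commutes with
  automorphisms.\<close>

lemma der_automorphism:
  assumes cas: "casimir I p q"
    and closed: "\<And>x. x \<in> V \<Longrightarrow> \<alpha> x \<in> V"
    and add: "\<And>x y. x \<in> V \<Longrightarrow> y \<in> V \<Longrightarrow> \<alpha> (x + y) = \<alpha> x + \<alpha> y"
    and hom: "\<And>x y. x \<in> V \<Longrightarrow> y \<in> V \<Longrightarrow> \<alpha> (br x y) = br (\<alpha> x) (\<alpha> y)"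
    and surj: "\<And>y. y \<in> V \<Longrightarrow> \<exists>x\<in>V. \<alpha> x = y"
    and x: "x \<in> V"
  shows "\<alpha> (der I p q x) = der I p q (\<alpha> x)"
proof -
  note pq = casimirD[OF cas]
  define d where "d = der I p q x"
  have dV: "d \<in> V" unfolding d_def by (rule der_closed[OF cas x])
  have "\<alpha> (0 + 0) = \<alpha> 0 + \<alpha> 0" by (rule add) simp_all
  then have \<alpha>0: "\<alpha> 0 = 0" by simp
  have "\<alpha> x = \<alpha> (x - d) + \<alpha> d" using add[of "x - d" d] x dV by simp
  then have 1: "der I p q (\<alpha> x) = der I p q (\<alpha> (x - d)) + der I p q (\<alpha> d)"
    using der_add[OF cas] closed x dV by simp
  have 2: "der I p q (\<alpha> (x - d)) = 0"
  proof (rule der_central[OF cas])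
    show "\<alpha> (x - d) \<in> V" using closed x dV by simp
    fix w assume "w \<in> V"
    then obtain u where u: "u \<in> V" "w = \<alpha> u" using surj by blast
    have "br (x - d) u = 0" unfolding d_def by (rule pq(5)[OF x u(1)])
    then show "br (\<alpha> (x - d)) w = 0" using hom[of "x - d" u] u x dV \<alpha>0 by simp
  qed
  \<comment> \<open>An automorphism maps brackets to brackets, and \<open>der\<close> is the
    identity on them.\<close>
  have "\<alpha> d = (\<Sum>i\<in>I. \<alpha> (br (p i) (br (q i) x)))"
    unfolding d_def der_def by (rule additive_on_sum) (use pq x add in auto)
  then have e: "\<alpha> d = (\<Sum>i\<in>I. br (\<alpha> (p i)) (\<alpha> (br (q i) x)))"
    using hom pq x by simp
  have "der I p q (\<alpha> d) = (\<Sum>i\<in>I. der I p q (br (\<alpha> (p i)) (\<alpha> (br (q i) x))))"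
    unfolding e by (rule additive_on_sum) (use pq x closed der_add[OF cas] in auto)
  also have "\<dots> = \<alpha> d" unfolding e using pq x closed by simp
  finally show ?thesis using 1 2 by (simp add: d_def)
qed

end

context bundle_rep
begin

text \<open>The fibrewise projection onto the derived algebra. The trivialisation picked at each
  point is immaterial by \<open>der_automorphism\<close>.\<close>

definition prs :: "('x \<Rightarrow> 'v) \<Rightarrow> 'x \<Rightarrow> 'v" where
  "prs z = (\<lambda>x\<in>topspace X. let \<Phi> = (SOME \<Phi>. \<exists>W. (W, \<Phi>) \<in> trivs \<and> x \<in> W)
      in inv_into (carrier (K x)) (\<Phi> x) (pr (\<Phi> x (z x))))"

lemma prs_triv:
  assumes t: "(W, \<Psi>) \<in> trivs" and x: "x \<in> W" and z: "z \<in> carrier Gc"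
  shows "prs z x \<in> carrier (K x)" "\<Psi> x (prs z x) = pr (\<Psi> x (z x))"
proof -
  have xX: "x \<in> topspace X" using triv_subset[OF t] x by blast
  define \<Phi> where "\<Phi> = (SOME \<Phi>. \<exists>W. (W, \<Phi>) \<in> trivs \<and> x \<in> W)"
  have "\<exists>W. (W, \<Phi>) \<in> trivs \<and> x \<in> W" unfolding \<Phi>_def by (rule someI[of _ \<Psi>]) (use t x in blast)
  then obtain W' where t': "(W', \<Phi>) \<in> trivs" and x': "x \<in> W'" by blast
  note zx = Gc_fibre[OF z xX] and I = triv_inv[OF t' x'] and H = triv_hom[OF t' x']
    and cl = fibre_closed[OF xX]
  let ?J = "inv_into (carrier (K x)) (\<Phi> x)"
  have eq: "prs z x = ?J (pr (\<Phi> x (z x)))" using xX by (simp add: prs_def Let_def \<Phi>_def)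
  have prV: "pr (\<Phi> x (z x)) \<in> kk" by (rule der_closed[OF cas H(1)[OF zx]])
  show "prs z x \<in> carrier (K x)" unfolding eq by (rule I(1)[OF prV])
  define \<alpha> where "\<alpha> u = \<Psi> x (?J u)" for u
  have Jadd: "?J (u + w) = vadd (K x) (?J u) (?J w)" if "u \<in> kk" "w \<in> kk" for u w
    by (rule triv_inj[OF t' x']) (use that in \<open>simp_all add: I H cl\<close>)
  have Jbr: "?J (br u w) = lbr (K x) (?J u) (?J w)" if "u \<in> kk" "w \<in> kk" for u w
    by (rule triv_inj[OF t' x']) (use that in \<open>simp_all add: I H cl\<close>)
  have "\<alpha> (pr (\<Phi> x (z x))) = pr (\<alpha> (\<Phi> x (z x)))"
  proof (rule der_automorphism[OF cas])
    show "\<alpha> u \<in> kk" if "u \<in> kk" for u using that by (simp add: \<alpha>_def triv_hom[OF t x] I)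
    show "\<alpha> (u + w) = \<alpha> u + \<alpha> w" if "u \<in> kk" "w \<in> kk" for u w
      using that by (simp add: \<alpha>_def Jadd triv_hom[OF t x] I)
    show "\<alpha> (br u w) = br (\<alpha> u) (\<alpha> w)" if "u \<in> kk" "w \<in> kk" for u w
      using that by (simp add: \<alpha>_def Jbr triv_hom[OF t x] I)
    show "\<exists>u\<in>kk. \<alpha> u = w" if "w \<in> kk" for w
    proof (rule bexI[of _ "\<Phi> x (inv_into (carrier (K x)) (\<Psi> x) w)"])
      show "\<alpha> (\<Phi> x (inv_into (carrier (K x)) (\<Psi> x) w)) = w"
        using that by (simp add: \<alpha>_def I(3) triv_inv[OF t x])
      show "\<Phi> x (inv_into (carrier (K x)) (\<Psi> x) w) \<in> kk"
        using that by (simp add: H triv_inv[OF t x])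
    qed
  qed (rule H(1)[OF zx])
  then show "\<Psi> x (prs z x) = pr (\<Psi> x (z x))" by (simp add: \<alpha>_def eq I(3)[OF zx])
qed

lemma prs_Gam:
  assumes C: "compactin X C" and z: "z \<in> Gam C"
  shows "prs z \<in> Gam C"
proof -
  have z': "z \<in> carrier Gc" using z by (simp add: Gam_def)
  have f: "prs z x \<in> carrier (K x)" if "x \<in> topspace X" for x
    using triv_cover[OF that] prs_triv(1)[OF _ _ z'] by blast
  have zero: "prs z x = vzero (K x)" if "x \<in> topspace X - C" for x
  proof (rule fibre_eqI)
    show "x \<in> topspace X" "prs z x \<in> carrier (K x)" "vzero (K x) \<in> carrier (K x)"
      using that f fibre_closed(1) by auto
    fix W \<Psi> assume t: "(W, \<Psi>) \<in> trivs" "x \<in> W"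
    have "z x = vzero (K x)" using z that by (auto simp: Gam_def)
    then show "\<Psi> x (prs z x) = \<Psi> x (vzero (K x))"
      using prs_triv(2)[OF t z'] triv_zero[OF t] casimirD[OF cas] by (simp add: der_def br_0)
  qed
  have "restrict (prs z) (topspace X) \<in> carrier Gc"
  proof (rule GcI[OF f _ C zero])
    fix U \<phi> W \<Phi> assume a: "(U, \<phi>) \<in> atlas" "(W, \<Phi>) \<in> trivs"
    let ?u = "\<lambda>y. \<Phi> (inv_into U \<phi> y) (z (inv_into U \<phi> y))"
    have in_W: "inv_into U \<phi> y \<in> U \<inter> W" if "y \<in> \<phi> ` (U \<inter> W)" for y using chart_inv_in[OF a(1) that] .
    have u: "?u y \<in> kk" if "y \<in> \<phi> ` (U \<inter> W)" for y
      using in_W[OF that] triv_hom(1)[OF a(2)] Gc_fibre[OF z'] triv_subset[OF a(2)] by blast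
    have "smooth_on B b0 (\<phi> ` (U \<inter> W)) (\<lambda>y. \<Sum>i\<in>I. br (p i) (br (q i) (?u y)))"
      by (intro smooth_on_sum smooth_on_br smooth_on_const Gc_smooth[OF z' a] br_closed u casimirD[OF cas])
    then show "smooth_on B b0 (\<phi> ` (U \<inter> W)) (\<lambda>y. \<Phi> (inv_into U \<phi> y) (prs z (inv_into U \<phi> y)))"
    proof (rule smooth_on_cong[THEN iffD1, rotated])
      fix y assume "y \<in> \<phi> ` (U \<inter> W)"
      then show "(\<Sum>i\<in>I. br (p i) (br (q i) (?u y))) = \<Phi> (inv_into U \<phi> y) (prs z (inv_into U \<phi> y))"
        using prs_triv(2)[OF a(2) _ z', of "inv_into U \<phi> y"] in_W by (simp add: der_def)
    qed
  qed
  moreover have "restrict (prs z) (topspace X) = prs z" by (simp add: prs_def fun_eq_iff)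
  ultimately show ?thesis using zero by (simp add: Gam_def)
qed

lemma prs_closed: "z \<in> carrier Gc \<Longrightarrow> prs z \<in> carrier Gc"
  using Gc_Gam prs_Gam by (metis (no_types, lifting) Gam_def mem_Collect_eq)

text \<open>What a cutoff \<rho> contributes to the global operator. The last clause encodes that
  each \<open>\<Lambda> (rep z)\<close> is built from commutators whose first entries are supported
  in one compact set: any linear map reproducing such commutators has to fix it. Independence of
  choices is proved in this form.\<close>

definition good :: "('x \<Rightarrow> real) \<Rightarrow> (('h \<Rightarrow>\<^sub>L 'h) \<Rightarrow> ('h \<Rightarrow>\<^sub>L 'h)) \<Rightarrow> bool" where
  "good \<rho> \<Lambda> \<longleftrightarrow> smf \<rho> \<and> linear \<Lambda> \<and> (\<exists>M\<ge>0. \<forall>T. norm (\<Lambda> T) \<le> M * norm T) \<and>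
     (\<forall>T\<in>skew. \<Lambda> T \<in> skew) \<and> (\<forall>S\<in>imaginary_scalars. \<Lambda> S = 0) \<and>
     (\<forall>s\<in>carrier Gc. \<forall>u\<in>carrier Gc. com (fmul \<rho> s) u = \<Lambda> (com s u)) \<and>
     (\<forall>z\<in>carrier Gc. coset (\<Lambda> (rep z)) = pb (fmul \<rho> (prs z))) \<and>
     (\<exists>C. compactin X C \<and> (\<forall>\<Lambda>'. linear \<Lambda>' \<longrightarrow> (\<forall>s\<in>Gam C. \<forall>u\<in>carrier Gc. com s u = \<Lambda>' (com s u)) \<longrightarrow>
        (\<forall>z\<in>carrier Gc. \<Lambda>' (\<Lambda> (rep z)) = \<Lambda> (rep z))))"

lemma goodD:
  assumes "good \<rho> \<Lambda>"
  shows "smf \<rho>" "linear \<Lambda>" "\<exists>M\<ge>0. \<forall>T. norm (\<Lambda> T) \<le> M * norm T"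
    "\<And>T. T \<in> skew \<Longrightarrow> \<Lambda> T \<in> skew" "\<And>S. S \<in> imaginary_scalars \<Longrightarrow> \<Lambda> S = 0"
    "\<And>s u. s \<in> carrier Gc \<Longrightarrow> u \<in> carrier Gc \<Longrightarrow> com (fmul \<rho> s) u = \<Lambda> (com s u)"
    "\<And>z. z \<in> carrier Gc \<Longrightarrow> coset (\<Lambda> (rep z)) = pb (fmul \<rho> (prs z))"
    "\<exists>C. compactin X C \<and> (\<forall>\<Lambda>'. linear \<Lambda>' \<longrightarrow> (\<forall>s\<in>Gam C. \<forall>u\<in>carrier Gc. com s u = \<Lambda>' (com s u)) \<longrightarrow>
        (\<forall>z\<in>carrier Gc. \<Lambda>' (\<Lambda> (rep z)) = \<Lambda> (rep z)))"
  using assms unfolding good_def by blast+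

lemma Gam_mono: "C \<subseteq> D \<Longrightarrow> Gam C \<subseteq> Gam D"
  by (auto simp: Gam_def)

lemma pb_lsec_sum:
  assumes t: "(W, \<Phi>) \<in> trivs" and F: "finite F" and v: "\<And>i. i \<in> F \<Longrightarrow> v i \<in> lvec W"
    and T: "\<And>i. i \<in> F \<Longrightarrow> coset (T i) = pb (lsec W \<Phi> (v i))"
  shows "coset (\<Sum>i\<in>F. T i) = pb (lsec W \<Phi> (\<lambda>x. \<Sum>i\<in>F. v i x))"
  using F v T
proof (induction F)
  case empty
  then show ?case using pb_zero by (simp add: lsec_zero[OF t])
next
  case (insert i F)
  have s: "(\<lambda>x. \<Sum>i\<in>F. v i x) \<in> lvec W" using insert.prems by (intro lvec_sum) auto
  have vi: "v i \<in> lvec W" using insert.prems by simp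
  have "pb (lsec W \<Phi> (\<lambda>x. v i x + (\<Sum>i\<in>F. v i x)))
    = coset (rep (lsec W \<Phi> (v i)) + rep (lsec W \<Phi> (\<lambda>x. \<Sum>i\<in>F. v i x)))"
    unfolding lsec_ops(1)[OF t lvecD[OF vi] lvecD[OF s], symmetric]
    by (rule pb_add[OF sec[OF t vi] sec[OF t s]])
  also have "\<dots> = coset (T i + (\<Sum>i\<in>F. T i))"
  proof -
    have "coset (rep (lsec W \<Phi> (v i))) = coset (T i)"
      using insert.prems rep(2)[OF sec[OF t vi]] by simp
    moreover have "coset (rep (lsec W \<Phi> (\<lambda>x. \<Sum>i\<in>F. v i x))) = coset (\<Sum>i\<in>F. T i)"
      using insert rep(2)[OF sec[OF t s]] by simp
    ultimately show ?thesis by (simp add: proj_add[symmetric])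
  qed
  finally show ?case using insert.hyps by simp
qed

text \<open>The Casimir element acts by double commutators with \<open>\<zeta> p i\<close> and
  \<open>\<rho> q i\<close>. The weight \<rho> enters once and \<zeta> is one where \<rho> is
  nonzero, so the outcome is the Casimir identity multiplied by \<rho>; scalars are killed by the
  inner commutator.\<close>

lemma good_bump:
  assumes t: "(W, \<Phi>) \<in> trivs" and \<rho>: "\<rho> \<in> lfun W" and \<zeta>: "\<zeta> \<in> lfun W" and \<zeta>\<rho>: "\<And>x. \<zeta> x * \<rho> x = \<rho> x"
  shows "\<exists>\<Lambda>. good \<rho> \<Lambda>"
proof -
  note pq = casimirD[OF cas]
  define P where "P i = lsec W \<Phi> (\<lambda>x. \<zeta> x *\<^sub>R p i)" for i
  define Q where "Q i = lsec W \<Phi> (\<lambda>x. \<rho> x *\<^sub>R q i)" for i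
  have lP: "(\<lambda>x. \<zeta> x *\<^sub>R p i) \<in> lvec W" and lQ: "(\<lambda>x. \<rho> x *\<^sub>R q i) \<in> lvec W" for i
    by (intro lvec_const \<rho> \<zeta> pq)+
  have P: "P i \<in> carrier Gc" and Q: "Q i \<in> carrier Gc" for i
    unfolding P_def Q_def by (rule sec[OF t lP], rule sec[OF t lQ])
  define \<Lambda> where "\<Lambda> T = (\<Sum>i\<in>I. comm (rep (P i)) (comm (rep (Q i)) T))" for T
  have lin: "linear \<Lambda>"
    by (rule linearI) (simp_all only: \<Lambda>_def comm_add_right comm_scale_right sum.distrib scaleR_sum_right)
  have sm: "smf \<rho>" using \<rho> by (simp add: lfun_def)
  have bound: "norm (\<Lambda> T) \<le> (\<Sum>i\<in>I. 4 * norm (rep (P i)) * norm (rep (Q i))) * norm T" for T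
  proof -
    have "norm (\<Lambda> T) \<le> (\<Sum>i\<in>I. norm (comm (rep (P i)) (comm (rep (Q i)) T)))"
      unfolding \<Lambda>_def by (rule norm_sum)
    also have "\<dots> \<le> (\<Sum>i\<in>I. 4 * norm (rep (P i)) * norm (rep (Q i)) * norm T)"
    proof (rule sum_mono)
      fix i
      have "norm (comm (rep (P i)) (comm (rep (Q i)) T)) \<le> 2 * norm (rep (P i)) * norm (comm (rep (Q i)) T)"
        by (rule norm_comm_le)
      also have "\<dots> \<le> 2 * norm (rep (P i)) * (2 * norm (rep (Q i)) * norm T)"
        by (intro mult_left_mono norm_comm_le) simp
      finally show "norm (comm (rep (P i)) (comm (rep (Q i)) T)) \<le> 4 * norm (rep (P i)) * norm (rep (Q i)) * norm T"
        by simp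
    qed
    finally show ?thesis by (simp add: sum_distrib_right)
  qed
  have M0: "0 \<le> (\<Sum>i\<in>I. 4 * norm (rep (P i)) * norm (rep (Q i)))" by (rule sum_nonneg) simp
  have term_eq: "comm (rep (P i)) (comm (rep (Q i)) (rep z)) = com (P i) (lbr Gc (Q i) z)"
    if "z \<in> carrier Gc" for i z
    using com_br_right[OF P Q that] by (simp only: com_def)
  have dom: "\<rho> x = 0" if "x \<in> topspace X - W" for x using \<rho> that by (auto simp: lfun_def supp_in_def)
  have Qz: "lbr Gc (Q i) z = lsec W \<Phi> (\<lambda>x. br (q i) (loc W \<Phi> \<rho> z x))" if z: "z \<in> carrier Gc" for i z
  proof -
    have "(\<lambda>x. if x \<in> W then br (\<rho> x *\<^sub>R q i) (\<Phi> x (z x)) else 0) = (\<lambda>x. br (q i) (loc W \<Phi> \<rho> z x))"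
    proof
      fix x
      show "(if x \<in> W then br (\<rho> x *\<^sub>R q i) (\<Phi> x (z x)) else 0) = br (q i) (loc W \<Phi> \<rho> z x)"
      proof (cases "x \<in> W")
        case True
        then have "\<Phi> x (z x) \<in> kk" using triv_hom(1)[OF t] triv_subset[OF t] Gc_fibre[OF z] by blast
        then show ?thesis using True pq by (simp add: loc_def br_scale_left br_scale_right)
      qed (use pq in \<open>simp add: loc_def br_0\<close>)
    qed
    then show ?thesis unfolding Q_def by (simp only: lsec_br_right[OF t lvecD[OF lQ] z])
  qed
  have lz: "loc W \<Phi> \<rho> z \<in> lvec W" if "z \<in> carrier Gc" for z by (rule loc_lvec[OF t \<rho> that])
  have 1: "com (fmul \<rho> s) u = \<Lambda> (com s u)" if s: "s \<in> carrier Gc" and u: "u \<in> carrier Gc" for s u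
  proof -
    define v where "v = loc W \<Phi> \<rho> s"
    define w where "w = loc W \<Phi> \<zeta> u"
    have v: "v \<in> lvec W" unfolding v_def by (rule lz[OF s])
    have w: "w \<in> lvec W" unfolding w_def by (rule loc_lvec[OF t \<zeta> u])
    have fs: "fmul \<rho> s = lsec W \<Phi> v" unfolding v_def by (rule fmul_lsec[OF t \<rho> s])
    have fu: "fmul \<zeta> u = lsec W \<Phi> w" unfolding w_def by (rule fmul_lsec[OF t \<zeta> u])
    have z1: "smf \<zeta>" using \<zeta> by (simp add: lfun_def)
    \<comment> \<open>The part \<open>(1 - \<zeta>) u\<close> commutes with \<open>\<rho> s\<close>,
      so \<open>u\<close> may be replaced by \<open>\<zeta> u\<close>, which lives in the
      trivialisation.\<close>
    define \<eta> where "\<eta> x = 1 + (-1) * \<zeta> x" for x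
    have z2: "smf \<eta>" unfolding \<eta>_def by (rule smf_add[OF smf_const smf_mult[OF smf_const z1]])
    have "smf (\<lambda>x. \<zeta> x + \<eta> x)" by (rule smf_add[OF z1 z2])
    then have "u = fmul (\<lambda>x. \<zeta> x + \<eta> x) u"
      using fmul_one[of u "topspace X" "\<lambda>x. \<zeta> x + \<eta> x"] u by (simp add: Gam_def \<eta>_def)
    also have "\<dots> = vadd Gc (fmul \<zeta> u) (fmul \<eta> u)" by (rule fmul_add[OF u z1 z2])
    finally have us: "u = vadd Gc (fmul \<zeta> u) (fmul \<eta> u)" .
    have fuc: "fmul \<zeta> u \<in> carrier Gc" "fmul \<eta> u \<in> carrier Gc" "fmul \<rho> s \<in> carrier Gc"
      using fmul_closed u s z1 z2 sm by blast+
    have "com (fmul \<rho> s) (fmul \<eta> u) = 0"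
    proof (rule com_zero[OF fuc(3,2)], unfold fs lsec_br_right[OF t lvecD[OF v] fuc(2)] lsec_zero[OF t, symmetric],
        rule arg_cong[where f = "lsec W \<Phi>"], rule ext)
      fix x
      show "(if x \<in> W then br (v x) (\<Phi> x (fmul \<eta> u x)) else 0) = 0"
      proof (cases "x \<in> W")
        case True
        then have x: "x \<in> topspace X" using triv_subset[OF t] by blast
        note k = triv_hom(1)[OF t True Gc_fibre[OF s x]] triv_hom(1)[OF t True Gc_fibre[OF u x]]
        have e: "\<Phi> x (fmul \<eta> u x) = \<eta> x *\<^sub>R \<Phi> x (u x)"
          using x by (simp add: fmul_def triv_hom[OF t True] Gc_fibre[OF u])
        have "\<rho> x * \<eta> x = 0" using \<zeta>\<rho>[of x] by (auto simp: \<eta>_def algebra_simps)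
        then show ?thesis using True k e by (auto simp: v_def loc_def br_scale_left br_scale_right)
      qed simp
    qed
    then have "com (fmul \<rho> s) u = com (lsec W \<Phi> v) (lsec W \<Phi> w)"
      using com_add_right[OF fuc(3,1,2)] us fs fu by simp
    also have "\<dots> = (\<Sum>i\<in>I. com (lsec W \<Phi> (\<lambda>x. \<zeta> x *\<^sub>R p i)) (lsec W \<Phi> (\<lambda>x. br (q i) (br (v x) (w x)))))"
    proof (rule c_formula[OF t v w \<zeta>])
      show "\<zeta> x *\<^sub>R v x = v x" for x by (simp add: v_def loc_def \<zeta>\<rho>)
    qed
    also have "\<dots> = (\<Sum>i\<in>I. com (P i) (lbr Gc (Q i) (lbr Gc s u)))"
    proof (rule sum.cong[OF refl])
      fix i
      \<comment> \<open>The cutoffs combine as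
        \<open>\<rho> [s, u] = [\<rho> s, \<zeta> u]\<close>.\<close>
      have "loc W \<Phi> \<rho> (lbr Gc s u) x = br (v x) (w x)" for x
      proof (cases "x \<in> W")
        case True
        then have x: "x \<in> topspace X" using triv_subset[OF t] by blast
        note k = triv_hom(1)[OF t True Gc_fibre[OF s x]] triv_hom(1)[OF t True Gc_fibre[OF u x]]
        show ?thesis using True x k \<zeta>\<rho>[of x]
          by (simp add: loc_def v_def w_def Gc_ops triv_hom[OF t True] Gc_fibre[OF s] Gc_fibre[OF u]
              br_scale_left br_scale_right mult.commute)
      qed (simp add: loc_def v_def w_def br_0)
      then show "com (lsec W \<Phi> (\<lambda>x. \<zeta> x *\<^sub>R p i)) (lsec W \<Phi> (\<lambda>x. br (q i) (br (v x) (w x))))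
          = com (P i) (lbr Gc (Q i) (lbr Gc s u))"
        unfolding Qz[OF Gc_br[OF s u]] by (simp add: P_def)
    qed
    also have "\<dots> = (\<Sum>i\<in>I. comm (rep (P i)) (comm (rep (Q i)) (com s u)))"
    proof (rule sum.cong[OF refl])
      fix i
      have "com (P i) (lbr Gc (Q i) (lbr Gc s u)) = comm (rep (P i)) (com (Q i) (lbr Gc s u))"
        by (rule com_br_right[OF P Q Gc_br[OF s u]])
      also have "com (Q i) (lbr Gc s u) = comm (rep (Q i)) (com s u)" by (rule com_br_right[OF Q s u])
      finally show "com (P i) (lbr Gc (Q i) (lbr Gc s u)) = comm (rep (P i)) (comm (rep (Q i)) (com s u))" .
    qed
    finally show ?thesis by (simp only: \<Lambda>_def)
  qed
  have 2: "coset (\<Lambda> (rep z)) = pb (fmul \<rho> (prs z))" if z: "z \<in> carrier Gc" for z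
  proof -
    \<comment> \<open>Over \<open>W\<close> this is \<rho> times \<open>[p i, [q i, z]]\<close>,
      whose sum over \<open>i\<close> is \<rho> times the derived part of \<open>z\<close>.\<close>
    define v where "v i x = br (\<zeta> x *\<^sub>R p i) (br (q i) (loc W \<Phi> \<rho> z x))" for i x
    have w: "(\<lambda>x. br (q i) (loc W \<Phi> \<rho> z x)) \<in> lvec W" for i by (rule lvec_br_const[OF lz[OF z] pq(3)])
    have v: "v i \<in> lvec W" for i unfolding v_def by (rule lvec_br[OF lP w])
    have Ti: "coset (comm (rep (P i)) (comm (rep (Q i)) (rep z))) = pb (lsec W \<Phi> (v i))" for i
    proof -
      have "lbr Gc (P i) (lbr Gc (Q i) z) = lsec W \<Phi> (v i)"
        unfolding Qz[OF z] P_def v_def by (rule lsec_ops(3)[OF t lvecD[OF lP] lvecD[OF w]])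
      then have "pb (lsec W \<Phi> (v i)) = coset (com (P i) (lbr Gc (Q i) z))"
        using pb_br[OF P[of i] Gc_br[OF Q[of i] z]] by (simp add: com_def)
      then show ?thesis using term_eq[OF z] by (simp only:)
    qed
    have "coset (\<Lambda> (rep z)) = pb (lsec W \<Phi> (\<lambda>x. \<Sum>i\<in>I. v i x))"
      unfolding \<Lambda>_def by (rule pb_lsec_sum[OF t pq(1) v Ti])
    also have "lsec W \<Phi> (\<lambda>x. \<Sum>i\<in>I. v i x) = fmul \<rho> (prs z)"
      unfolding fmul_lsec[OF t \<rho> prs_closed[OF z]]
    proof (rule arg_cong[where f = "lsec W \<Phi>"], rule ext)
      fix x
      show "(\<Sum>i\<in>I. v i x) = loc W \<Phi> \<rho> (prs z) x"
      proof (cases "x \<in> W")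
        case True
        then have x: "x \<in> topspace X" using triv_subset[OF t] by blast
        note k = triv_hom(1)[OF t True Gc_fibre[OF z x]]
        have "v i x = \<rho> x *\<^sub>R br (p i) (br (q i) (\<Phi> x (z x)))" for i
          using True k pq \<zeta>\<rho>[of x] by (simp add: v_def loc_def br_scale_left br_scale_right)
        then show ?thesis using True prs_triv(2)[OF t True z] by (simp add: loc_def der_def scaleR_sum_right)
      qed (use pq in \<open>simp add: v_def loc_def br_0\<close>)
    qed
    finally show ?thesis .
  qed
  obtain C where C: "compactin X C" "C \<subseteq> W" "\<And>x. x \<in> topspace X - C \<Longrightarrow> \<zeta> x = 0"
    using \<zeta> by (auto simp: lfun_def supp_in_def)
  \<comment> \<open>The outer factors \<open>P i\<close> are all supported where \<zeta> is, which
    supplies the compact set of the last clause of \<open>good\<close>.\<close>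
  have PC: "P i \<in> Gam C" for i
    unfolding P_def by (rule lsec_Gam[OF t _ _ C(1,2)]) (use lP[of i] C(3) in \<open>auto simp: lvec_def\<close>)
  have 3: "\<Lambda>' (\<Lambda> (rep z)) = \<Lambda> (rep z)"
    if l: "linear \<Lambda>'" and f: "\<forall>s\<in>Gam C. \<forall>u\<in>carrier Gc. com s u = \<Lambda>' (com s u)" and z: "z \<in> carrier Gc" for \<Lambda>' z
  proof -
    have "\<Lambda> (rep z) = (\<Sum>i\<in>I. com (P i) (lbr Gc (Q i) z))" unfolding \<Lambda>_def by (simp only: term_eq[OF z])
    moreover have "\<Lambda>' (com (P i) (lbr Gc (Q i) z)) = com (P i) (lbr Gc (Q i) z)" for i
      using f PC Gc_br[OF Q z] by metis
    ultimately show ?thesis by (simp add: linear_sum[OF l])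
  qed
  have "good \<rho> \<Lambda>"
    unfolding good_def
  proof (intro conjI ballI)
    show "\<exists>M\<ge>0. \<forall>T. norm (\<Lambda> T) \<le> M * norm T" using bound M0 by blast
    show "\<Lambda> T \<in> skew" if "T \<in> skew" for T
      unfolding \<Lambda>_def by (intro skew_sum skew_comm rep P Q that)
    show "\<Lambda> S = 0" if "S \<in> imaginary_scalars" for S
    proof -
      have "comm (rep (Q i)) S = 0" for i by (rule comm_imaginary[OF rep(1)[OF Q] that])
      then have "\<Lambda> S = (\<Sum>i\<in>I. comm (rep (P i)) 0)" unfolding \<Lambda>_def by (simp only:)
      then show ?thesis by (simp add: blinfun_compose_simps)
    qed
    show "\<exists>C. compactin X C \<and> (\<forall>\<Lambda>'. linear \<Lambda>' \<longrightarrow> (\<forall>s\<in>Gam C. \<forall>u\<in>carrier Gc. com s u = \<Lambda>' (com s u)) \<longrightarrow>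
        (\<forall>z\<in>carrier Gc. \<Lambda>' (\<Lambda> (rep z)) = \<Lambda> (rep z)))"
      using C(1) 3 by blast
  qed (fact sm lin 1 2)+
  then show ?thesis by blast
qed

end

context bundle_rep
begin

lemma fmul_zero: "s \<in> carrier Gc \<Longrightarrow> fmul (\<lambda>_. 0) s = vzero Gc"
  unfolding vscale_fmul[symmetric] by (rule Gc_scale_zero)

lemma good_zero: "good (\<lambda>_. 0) (\<lambda>_. 0)"
  unfolding good_def
proof (intro conjI ballI)
  show "com (fmul (\<lambda>_. 0) s) u = 0" if "s \<in> carrier Gc" "u \<in> carrier Gc" for s u
    using that com_scale_left[OF that, of 0] by (simp add: vscale_fmul)
  show "coset 0 = pb (fmul (\<lambda>_. 0) (prs z))" if "z \<in> carrier Gc" for z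
    using fmul_zero[OF prs_closed[OF that]] pb_zero by simp
  show "\<exists>C. compactin X C \<and> (\<forall>\<Lambda>' :: ('h \<Rightarrow>\<^sub>L 'h) \<Rightarrow> ('h \<Rightarrow>\<^sub>L 'h). linear \<Lambda>' \<longrightarrow>
      (\<forall>s\<in>Gam C. \<forall>u\<in>carrier Gc. com s u = \<Lambda>' (com s u)) \<longrightarrow> (\<forall>z\<in>carrier Gc. \<Lambda>' 0 = 0))"
    by (rule exI[of _ "{}"]) (simp add: linear_0)
  show "\<exists>M\<ge>0. \<forall>T :: 'h \<Rightarrow>\<^sub>L 'h. norm (0 :: 'h \<Rightarrow>\<^sub>L 'h) \<le> M * norm T" by (rule exI[of _ 0]) simp
  show "linear (\<lambda>_ :: 'h \<Rightarrow>\<^sub>L 'h. 0 :: 'h \<Rightarrow>\<^sub>L 'h)" by (rule linearI) simp_all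
qed (simp_all add: smf_const subspace_0[OF subspace_skew])

text \<open>For the last clause the two compact sets are united: a map that reproduces commutators
  over the union does so over both parts.\<close>

lemma good_add:
  assumes g: "good \<rho> \<Lambda>" and h: "good \<sigma> \<Theta>"
  shows "good (\<lambda>x. \<rho> x + \<sigma> x) (\<lambda>T. \<Lambda> T + \<Theta> T)"
  unfolding good_def
proof (intro conjI ballI)
  note G = goodD[OF g] and H = goodD[OF h]
  show "smf (\<lambda>x. \<rho> x + \<sigma> x)" by (rule smf_add[OF G(1) H(1)])
  show "linear (\<lambda>T. \<Lambda> T + \<Theta> T)" by (rule linear_compose_add[OF G(2) H(2)])
  show "\<exists>M\<ge>0. \<forall>T. norm (\<Lambda> T + \<Theta> T) \<le> M * norm T"
  proof -
    obtain M L where M: "0 \<le> M" "\<And>T. norm (\<Lambda> T) \<le> M * norm T" and L: "0 \<le> L" "\<And>T. norm (\<Theta> T) \<le> L * norm T"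
      using G(3) H(3) by blast
    have "norm (\<Lambda> T + \<Theta> T) \<le> (M + L) * norm T" for T
      using norm_triangle_ineq[of "\<Lambda> T" "\<Theta> T"] M(2)[of T] L(2)[of T] by (simp add: distrib_right)
    then show ?thesis using M(1) L(1) by (intro exI[of _ "M + L"]) simp
  qed
  show "\<Lambda> T + \<Theta> T \<in> skew" if "T \<in> skew" for T using G(4) H(4) that by (intro skew_add)
  show "\<Lambda> S + \<Theta> S = 0" if "S \<in> imaginary_scalars" for S using G(5) H(5) that by simp
  show "com (fmul (\<lambda>x. \<rho> x + \<sigma> x) s) u = \<Lambda> (com s u) + \<Theta> (com s u)"
    if s: "s \<in> carrier Gc" and u: "u \<in> carrier Gc" for s u
    unfolding fmul_add[OF s G(1) H(1)] G(6)[OF s u, symmetric] H(6)[OF s u, symmetric]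
    by (rule com_add_left[OF fmul_closed[OF G(1) s] fmul_closed[OF H(1) s] u])
  show "coset (\<Lambda> (rep z) + \<Theta> (rep z)) = pb (fmul (\<lambda>x. \<rho> x + \<sigma> x) (prs z))" if z: "z \<in> carrier Gc" for z
  proof -
    note c = fmul_closed[OF G(1) prs_closed[OF z]] fmul_closed[OF H(1) prs_closed[OF z]]
    have "pb (fmul (\<lambda>x. \<rho> x + \<sigma> x) (prs z)) = coset (rep (fmul \<rho> (prs z)) + rep (fmul \<sigma> (prs z)))"
      unfolding fmul_add[OF prs_closed[OF z] G(1) H(1)] by (rule pb_add[OF c])
    also have "\<dots> = coset (\<Lambda> (rep z) + \<Theta> (rep z))"
      unfolding proj_add[symmetric] rep(2)[OF c(1)] rep(2)[OF c(2)] G(7)[OF z] H(7)[OF z] ..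
    finally show ?thesis by simp
  qed
  obtain C where C: "compactin X C"
    "\<forall>\<Lambda>'. linear \<Lambda>' \<longrightarrow> (\<forall>s\<in>Gam C. \<forall>u\<in>carrier Gc. com s u = \<Lambda>' (com s u)) \<longrightarrow>
        (\<forall>z\<in>carrier Gc. \<Lambda>' (\<Lambda> (rep z)) = \<Lambda> (rep z))" using G(8) by blast
  obtain D where D: "compactin X D"
    "\<forall>\<Lambda>'. linear \<Lambda>' \<longrightarrow> (\<forall>s\<in>Gam D. \<forall>u\<in>carrier Gc. com s u = \<Lambda>' (com s u)) \<longrightarrow>
        (\<forall>z\<in>carrier Gc. \<Lambda>' (\<Theta> (rep z)) = \<Theta> (rep z))" using H(8) by blast
  show "\<exists>C. compactin X C \<and> (\<forall>\<Lambda>'. linear \<Lambda>' \<longrightarrow> (\<forall>s\<in>Gam C. \<forall>u\<in>carrier Gc. com s u = \<Lambda>' (com s u)) \<longrightarrow>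
        (\<forall>z\<in>carrier Gc. \<Lambda>' (\<Lambda> (rep z) + \<Theta> (rep z)) = \<Lambda> (rep z) + \<Theta> (rep z)))"
  proof (intro exI[of _ "C \<union> D"] conjI allI impI ballI)
    show "compactin X (C \<union> D)" using C(1) D(1) by (rule compactin_Un)
    fix \<Lambda>' z assume l: "linear \<Lambda>'" and f: "\<forall>s\<in>Gam (C \<union> D). \<forall>u\<in>carrier Gc. com s u = \<Lambda>' (com s u)"
      and z: "z \<in> carrier Gc"
    have "Gam C \<subseteq> Gam (C \<union> D)" "Gam D \<subseteq> Gam (C \<union> D)" by (rule Gam_mono, simp)+
    then have "\<forall>s\<in>Gam C. \<forall>u\<in>carrier Gc. com s u = \<Lambda>' (com s u)" "\<forall>s\<in>Gam D. \<forall>u\<in>carrier Gc. com s u = \<Lambda>' (com s u)"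
      using f by blast+
    then have "\<Lambda>' (\<Lambda> (rep z)) = \<Lambda> (rep z)" "\<Lambda>' (\<Theta> (rep z)) = \<Theta> (rep z)"
      using C(2) D(2) l z by blast+
    then show "\<Lambda>' (\<Lambda> (rep z) + \<Theta> (rep z)) = \<Lambda> (rep z) + \<Theta> (rep z)" by (simp add: linear_add[OF l])
  qed
qed

text \<open>Partitions of unity are replaced by the identity \<open>1 - (1 - \<sigma>) (1 - \<rho>) = \<sigma> + \<rho> (1 - \<sigma>)\<close>,
  whose last summand is again supported in a single trivialisation.\<close>

lemma good_on_compact:
  assumes C: "compactin X C"
  shows "\<exists>\<rho> \<Lambda>. good \<rho> \<Lambda> \<and> (\<forall>x\<in>C. \<rho> x = 1)"
proof -
  have "\<forall>x\<in>topspace X. \<exists>M. openin X M \<and> x \<in> M \<and> (\<exists>W \<Phi> \<rho> \<zeta>. (W, \<Phi>) \<in> trivs \<and> \<rho> \<in> lfun W \<and> \<zeta> \<in> lfun W \<and>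
      (\<forall>x. \<zeta> x * \<rho> x = \<rho> x) \<and> (\<forall>x\<in>M. \<rho> x = 1))"
  proof
    fix x assume "x \<in> topspace X"
    then obtain W \<Phi> where t: "(W, \<Phi>) \<in> trivs" "x \<in> W" using triv_cover by blast
    obtain \<rho> \<zeta> M where "smf \<rho>" "smf \<zeta>" "supp_in W \<rho>" "supp_in W \<zeta>" "\<forall>x. \<zeta> x * \<rho> x = (\<rho> x :: real)"
      "openin X M" "x \<in> M" "\<forall>x\<in>M. \<rho> x = 1"
      using bump_exists[OF triv_domain[OF t(1)] t(2)] by blast
    then show "\<exists>M. openin X M \<and> x \<in> M \<and> (\<exists>W \<Phi> \<rho> \<zeta>. (W, \<Phi>) \<in> trivs \<and> \<rho> \<in> lfun W \<and> \<zeta> \<in> lfun W \<and>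
      (\<forall>x. \<zeta> x * \<rho> x = \<rho> x) \<and> (\<forall>x\<in>M. \<rho> x = 1))"
      using t(1) unfolding lfun_def by blast
  qed
  then obtain M where M: "\<And>x. x \<in> topspace X \<Longrightarrow> openin X (M x)" "\<And>x. x \<in> topspace X \<Longrightarrow> x \<in> M x"
    and data: "\<And>x. x \<in> topspace X \<Longrightarrow> \<exists>W \<Phi> \<rho> \<zeta>. (W, \<Phi>) \<in> trivs \<and> \<rho> \<in> lfun W \<and> \<zeta> \<in> lfun W \<and>
      (\<forall>y. \<zeta> y * \<rho> y = \<rho> y) \<and> (\<forall>y\<in>M x. \<rho> y = 1)" by metis
  have CX: "C \<subseteq> topspace X" using C by (rule compactin_subset_topspace)
  have "\<exists>F. finite F \<and> F \<subseteq> M ` C \<and> C \<subseteq> \<Union>F"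
  proof (rule compactinD[OF C])
    show "\<And>U. U \<in> M ` C \<Longrightarrow> openin X U" using M(1) CX by blast
    show "C \<subseteq> \<Union> (M ` C)" using M(2) CX by blast
  qed
  then obtain A where A: "finite A" "A \<subseteq> C" "C \<subseteq> \<Union> (M ` A)" using finite_subset_image by metis
  have "\<exists>\<sigma> \<Lambda>. good \<sigma> \<Lambda> \<and> (\<forall>x\<in>\<Union> (M ` A). \<sigma> x = 1)"
    using A(1,2)
  proof (induction A)
    case empty
    then show ?case using good_zero by auto
  next
    case (insert a A)
    then obtain \<sigma> \<Lambda> where s: "good \<sigma> \<Lambda>" "\<forall>x\<in>\<Union> (M ` A). \<sigma> x = 1" by auto
    have a: "a \<in> topspace X" using insert.prems CX by blast
    obtain W \<Phi> \<rho> \<zeta> where t: "(W, \<Phi>) \<in> trivs" "\<rho> \<in> lfun W" "\<zeta> \<in> lfun W"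
      "\<forall>y. \<zeta> y * \<rho> y = \<rho> y" "\<forall>y\<in>M a. \<rho> y = 1"
      using data[OF a] by blast
    define \<tau> where "\<tau> x = (1 + (-1) * \<sigma> x) * \<rho> x" for x
    have \<tau>: "\<tau> \<in> lfun W" unfolding \<tau>_def
      by (rule lfun_mult[OF smf_add[OF smf_const smf_mult[OF smf_const goodD(1)[OF s(1)]]] t(2)])
    have "\<zeta> x * \<tau> x = \<tau> x" for x using t(4) by (simp add: \<tau>_def mult.left_commute[of "\<zeta> x"])
    then obtain \<Theta> where "good \<tau> \<Theta>" using good_bump[OF t(1) \<tau> t(3)] by blast
    from good_add[OF s(1) this] have "good (\<lambda>x. \<sigma> x + \<tau> x) (\<lambda>T. \<Lambda> T + \<Theta> T)" .
    moreover have "\<sigma> x + \<tau> x = 1" if "x \<in> \<Union> (M ` insert a A)" for x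
      using that s(2) t(5) by (auto simp: \<tau>_def)
    ultimately show ?case by blast
  qed
  then show ?thesis using A(3) by blast
qed

section \<open>The lift and its independence of the compact set\<close>

definition Lam :: "'x set \<Rightarrow> ('h \<Rightarrow>\<^sub>L 'h) \<Rightarrow> ('h \<Rightarrow>\<^sub>L 'h)" where
  "Lam C = (SOME \<Lambda>. \<exists>\<rho>. good \<rho> \<Lambda> \<and> (\<forall>x\<in>C. \<rho> x = 1))"

lemma Lam_good:
  assumes "compactin X C"
  shows "\<exists>\<rho>. good \<rho> (Lam C) \<and> (\<forall>x\<in>C. \<rho> x = 1)"
proof -
  have "\<exists>\<Lambda> \<rho>. good \<rho> \<Lambda> \<and> (\<forall>x\<in>C. \<rho> x = 1)" using good_on_compact[OF assms] by blast
  then show ?thesis unfolding Lam_def by (rule someI_ex)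
qed

lemma Lam_com:
  assumes C: "compactin X C" and s: "s \<in> Gam C" and u: "u \<in> carrier Gc"
  shows "com s u = Lam C (com s u)"
proof -
  obtain \<rho> where r: "good \<rho> (Lam C)" "\<And>x. x \<in> C \<Longrightarrow> \<rho> x = 1" using Lam_good[OF C] by blast
  have "s \<in> carrier Gc" using s by (simp add: Gam_def)
  moreover have "fmul \<rho> s = s" by (rule fmul_one[OF s goodD(1)[OF r(1)]]) (rule r(2))
  ultimately show ?thesis using goodD(6)[OF r(1) _ u] by metis
qed

lemma Lam_coset:
  assumes C: "compactin X C" and z: "z \<in> Gam C"
  shows "coset (Lam C (rep z)) = pb (prs z)"
proof -
  obtain \<rho> where r: "good \<rho> (Lam C)" "\<And>x. x \<in> C \<Longrightarrow> \<rho> x = 1" using Lam_good[OF C] by blast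
  have "z \<in> carrier Gc" using z by (simp add: Gam_def)
  moreover have "fmul \<rho> (prs z) = prs z" by (rule fmul_one[OF prs_Gam[OF C z] goodD(1)[OF r(1)]]) (rule r(2))
  ultimately show ?thesis using goodD(7)[OF r(1)] by simp
qed

text \<open>Both operators are fixed by \<open>Lam E\<close> once \<open>E\<close> contains the
  supports of the sections from which they are built. They represent the same element, so their
  difference is scalar and annihilated by \<open>Lam E\<close>; being also fixed, it is
  zero.\<close>

lemma Lam_independent:
  assumes C: "compactin X C" and D: "compactin X D" and z: "z \<in> Gam C" "z \<in> Gam D"
  shows "Lam C (rep z) = Lam D (rep z)"
proof -
  have zG: "z \<in> carrier Gc" using z by (simp add: Gam_def)
  obtain \<rho> \<sigma> where "good \<rho> (Lam C)" "good \<sigma> (Lam D)" using Lam_good[OF C] Lam_good[OF D] by blast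
  from goodD(8)[OF this(1)] goodD(8)[OF this(2)] obtain C1 D1 where
    c: "compactin X C1" "compactin X D1"
    "\<forall>\<Lambda>'. linear \<Lambda>' \<longrightarrow> (\<forall>s\<in>Gam C1. \<forall>u\<in>carrier Gc. com s u = \<Lambda>' (com s u)) \<longrightarrow>
      (\<forall>z\<in>carrier Gc. \<Lambda>' (Lam C (rep z)) = Lam C (rep z))"
    "\<forall>\<Lambda>'. linear \<Lambda>' \<longrightarrow> (\<forall>s\<in>Gam D1. \<forall>u\<in>carrier Gc. com s u = \<Lambda>' (com s u)) \<longrightarrow>
      (\<forall>z\<in>carrier Gc. \<Lambda>' (Lam D (rep z)) = Lam D (rep z))"
    by (elim exE conjE)
  define E where "E = C1 \<union> D1"
  have E: "compactin X E" unfolding E_def by (rule compactin_Un[OF c(1,2)])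
  obtain \<tau> where r: "good \<tau> (Lam E)" using Lam_good[OF E] by blast
  note l = goodD(2)[OF r]
  have sub: "Gam C1 \<subseteq> Gam E" "Gam D1 \<subseteq> Gam E" unfolding E_def by (rule Gam_mono, simp)+
  have "Lam E (Lam C (rep z)) = Lam C (rep z)" "Lam E (Lam D (rep z)) = Lam D (rep z)"
    using c(3)[THEN spec, THEN mp, OF l] c(4)[THEN spec, THEN mp, OF l] Lam_com[OF E] sub zG by blast+
  moreover have "Lam C (rep z) - Lam D (rep z) \<in> imaginary_scalars"
    unfolding coset_eq_iff[symmetric] using Lam_coset[OF C z(1)] Lam_coset[OF D z(2)] by simp
  then have "Lam E (Lam C (rep z) - Lam D (rep z)) = 0" by (rule goodD(5)[OF r])
  ultimately show ?thesis by (simp add: linear_diff[OF l])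
qed

definition lft :: "('h \<Rightarrow>\<^sub>L 'h) \<Rightarrow> ('h \<Rightarrow>\<^sub>L 'h)" where
  "lft = (SOME l. linear l \<and> (\<forall>S\<in>imaginary_scalars. l S = 0) \<and>
     (\<forall>A. A - l A \<in> imaginary_scalars) \<and> (\<forall>A. norm (l A) \<le> 2 * norm A))"

lemma lft: "linear lft" "\<And>S. S \<in> imaginary_scalars \<Longrightarrow> lft S = 0" "\<And>A. A - lft A \<in> imaginary_scalars"
    "\<And>A. norm (lft A) \<le> 2 * norm A"
proof -
  have "linear lft \<and> (\<forall>S\<in>imaginary_scalars. lft S = 0) \<and> (\<forall>A. A - lft A \<in> imaginary_scalars) \<and>
      (\<forall>A. norm (lft A) \<le> 2 * norm A)"
    unfolding lft_def by (rule someI_ex[OF linear_lift_exists])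
  then show "linear lft" "\<And>S. S \<in> imaginary_scalars \<Longrightarrow> lft S = 0" "\<And>A. A - lft A \<in> imaginary_scalars"
    "\<And>A. norm (lft A) \<le> 2 * norm A" by blast+
qed

text \<open>\<open>Lam C\<close> misses the central part of a section, and \<open>lft\<close> lifts
  the remainder linearly. Commutators fixed by \<open>Lam C\<close> are fixed by
  \<open>Fop C\<close> too, because the remainder is then zero.\<close>

definition Fop :: "'x set \<Rightarrow> ('h \<Rightarrow>\<^sub>L 'h) \<Rightarrow> ('h \<Rightarrow>\<^sub>L 'h)" where
  "Fop C T = Lam C T + lft (T - Lam C T)"

lemma Fop:
  assumes C: "compactin X C"
  shows "linear (Fop C)" "S \<in> imaginary_scalars \<Longrightarrow> Fop C S = 0" "T - Fop C T \<in> imaginary_scalars"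
    "\<exists>M\<ge>0. \<forall>T. norm (Fop C T) \<le> M * norm T"
proof -
  obtain \<rho> where r: "good \<rho> (Lam C)" using Lam_good[OF C] by blast
  note l = goodD(2)[OF r]
  show "linear (Fop C)"
    by (rule linearI) (simp_all add: Fop_def linear_add[OF l] linear_cmul[OF l] linear_add[OF lft(1)]
        linear_diff[OF lft(1)] linear_cmul[OF lft(1)] algebra_simps)
  show "Fop C S = 0" if "S \<in> imaginary_scalars"
    using goodD(5)[OF r that] lft(2)[OF that] by (simp add: Fop_def)
  show "T - Fop C T \<in> imaginary_scalars"
    using lft(3)[of "T - Lam C T"] by (simp add: Fop_def diff_diff_eq)
  obtain M where M: "0 \<le> M" "\<And>T. norm (Lam C T) \<le> M * norm T" using goodD(3)[OF r] by blast
  \<comment> \<open>The constant is \<open>M\<close> from \<open>Lam C\<close> plus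
    \<open>2 * (1 + M)\<close> from \<open>lft\<close> applied to the remainder.\<close>
  have "norm (Fop C T) \<le> (3 * M + 2) * norm T" for T
  proof -
    have "norm (Fop C T) \<le> norm (Lam C T) + norm (lft (T - Lam C T))" unfolding Fop_def by (rule norm_triangle_ineq)
    also have "\<dots> \<le> norm (Lam C T) + 2 * (norm T + norm (Lam C T))"
      by (rule add_left_mono, rule order_trans[OF lft(4)], rule mult_left_mono, rule norm_triangle_ineq4) simp
    also have "\<dots> \<le> (3 * M + 2) * norm T" using M(2)[of T] by (simp add: algebra_simps)
    finally show ?thesis .
  qed
  then show "\<exists>M\<ge>0. \<forall>T. norm (Fop C T) \<le> M * norm T" using M(1) by (intro exI[of _ "3 * M + 2"]) simp
qed

text \<open>The chosen compact set is immaterial by \<open>Lam_independent\<close>; linearity is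
  checked over one set large enough for all sections involved.\<close>

definition lift :: "('x \<Rightarrow> 'v) \<Rightarrow> ('h \<Rightarrow>\<^sub>L 'h)" where
  "lift z = Fop (SOME C. compactin X C \<and> z \<in> Gam C) (rep z)"

lemma lift_eq:
  assumes C: "compactin X C" and z: "z \<in> Gam C"
  shows "lift z = Fop C (rep z)"
proof -
  define D where "D = (SOME C. compactin X C \<and> z \<in> Gam C)"
  have "\<exists>C. compactin X C \<and> z \<in> Gam C" using assms by blast
  from someI_ex[OF this] have "compactin X D" "z \<in> Gam D" unfolding D_def by simp_all
  then have "Lam D (rep z) = Lam C (rep z)" using Lam_independent[OF _ C _ z] by simp
  then show ?thesis unfolding lift_def D_def[symmetric] Fop_def by simp
qed

lemma Fop_cong: "compactin X C \<Longrightarrow> coset T = coset T' \<Longrightarrow> Fop C T = Fop C T'"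
  using Fop(2)[of C "T - T'"] linear_diff[OF Fop(1), of C T T'] by (simp add: coset_eq_iff)

lemma coset_lift: "z \<in> carrier Gc \<Longrightarrow> coset (lift z) = pb z"
proof -
  assume z: "z \<in> carrier Gc"
  then obtain C where C: "compactin X C" "z \<in> Gam C" using Gc_Gam by blast
  have "coset (rep z) = coset (lift z)" unfolding lift_eq[OF C] coset_eq_iff by (rule Fop(3)[OF C(1)])
  then show ?thesis using rep(2)[OF z] by simp
qed

lemma lift_skew: "z \<in> carrier Gc \<Longrightarrow> lift z \<in> skew"
  using coset_subset_skew[OF rep(1), of z "lift z"] coset_lift[of z] rep(2)[of z] mem_coset[of "lift z" "lift z"] by simp

lemma Gam_ops:
  assumes C: "compactin X C" and s: "s \<in> Gam C" and u: "u \<in> Gam C"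
  shows "vadd Gc s u \<in> Gam C" "vscale Gc r s \<in> Gam C"
proof -
  show "vadd Gc s u \<in> Gam C" using s u Gc_add by (auto simp: Gam_def Gc_ops fibre_zero_ops)
  show "vscale Gc r s \<in> Gam C" unfolding vscale_fmul by (rule Gam_fmul[OF smf_const C s])
qed

lemma lift_add:
  assumes s: "s \<in> carrier Gc" and u: "u \<in> carrier Gc"
  shows "lift (vadd Gc s u) = lift s + lift u"
proof -
  obtain C D where "compactin X C" "s \<in> Gam C" "compactin X D" "u \<in> Gam D" using Gc_Gam s u by metis
  then have E: "compactin X (C \<union> D)" "s \<in> Gam (C \<union> D)" "u \<in> Gam (C \<union> D)"
    using Gam_mono[of C "C \<union> D"] Gam_mono[of D "C \<union> D"] by (auto simp: compactin_Un)
  have "coset (rep (vadd Gc s u)) = coset (rep s + rep u)" using rep(2)[OF Gc_add[OF s u]] pb_add[OF s u] by simp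
  from Fop_cong[OF E(1) this] show ?thesis
    using linear_add[OF Fop(1)[OF E(1)]]
    by (simp add: lift_eq[OF E(1,2)] lift_eq[OF E(1,3)] lift_eq[OF E(1) Gam_ops(1)[OF E]])
qed

lemma lift_scale:
  assumes s: "s \<in> carrier Gc"
  shows "lift (vscale Gc r s) = r *\<^sub>R lift s"
proof -
  obtain C where C: "compactin X C" "s \<in> Gam C" using Gc_Gam s by metis
  have "coset (rep (vscale Gc r s)) = coset (r *\<^sub>R rep s)" using rep(2)[OF Gc_scale[OF s]] pb_scale[OF s] by simp
  from Fop_cong[OF C(1) this] show ?thesis
    using linear_cmul[OF Fop(1)[OF C(1)]] by (simp add: lift_eq[OF C] lift_eq[OF C(1) Gam_ops(2)[OF C C(2)]])
qed

text \<open>Commutators with a section supported in \<open>C\<close> are fixed by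
  \<open>Fop C\<close>, and they can be computed from any representatives, in particular from the
  lifts.\<close>

lemma lift_br:
  assumes s: "s \<in> carrier Gc" and u: "u \<in> carrier Gc"
  shows "lift (lbr Gc s u) = comm (lift s) (lift u)"
proof -
  obtain C where C: "compactin X C" "s \<in> Gam C" using Gc_Gam s by metis
  have "coset (rep (lbr Gc s u)) = coset (com s u)"
    using rep(2)[OF Gc_br[OF s u]] pb_br[OF s u] by (simp add: com_def)
  then have "lift (lbr Gc s u) = Fop C (com s u)"
    unfolding lift_eq[OF C(1) Gam_br[OF C u]] by (rule Fop_cong[OF C(1)])
  also have "\<dots> = com s u" using Lam_com[OF C u, symmetric] linear_0[OF lft(1)] by (simp add: Fop_def)
  also have "\<dots> = comm (lift s) (rep u)"
    unfolding com_def by (rule comm_left_cong[OF rep(1)[OF u]]) (simp only: coset_lift[OF s] rep(2)[OF s])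
  also have "\<dots> = comm (lift s) (lift u)"
    by (rule comm_right_cong[OF lift_skew[OF s]]) (simp only: coset_lift[OF u] rep(2)[OF u])
  finally show ?thesis .
qed

text \<open>\<open>Fop C\<close> kills scalars, so its operator bound holds for every representative
  \<open>rep z + S\<close> and passes to the infimum.\<close>

lemma lift_bound:
  assumes C: "compactin X C"
  shows "\<exists>M\<ge>0. \<forall>z\<in>Gam C. norm (lift z) \<le> M * quotient_norm (pb z)"
proof -
  obtain M where M: "0 \<le> M" "\<And>T. norm (Fop C T) \<le> M * norm T" using Fop(4)[OF C] by blast
  have "norm (lift z) \<le> M * quotient_norm (pb z)" if z: "z \<in> Gam C" for z
  proof -
    have zG: "z \<in> carrier Gc" using z by (simp add: Gam_def)
    have "norm (lift z) \<le> M * norm (rep z + S)" if "S \<in> imaginary_scalars" for S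
    proof -
      have "coset (rep z) = coset (rep z + S)" unfolding coset_eq_iff using imaginary_scalars_neg[OF that] by simp
      from Fop_cong[OF C this] show ?thesis unfolding lift_eq[OF C z] using M(2)[of "rep z + S"] by simp
    qed
    then show ?thesis unfolding rep(2)[OF zG, symmetric] by (rule le_quotient_norm[OF M(1)])
  qed
  then show ?thesis using M(1) by blast
qed

lemma lie_hom_lift: "lie_hom Gc unitary_lie lift"
  by (simp add: lie_hom_def lift_skew lift_add lift_scale lift_br)

lemma vdiff_closed: "s \<in> carrier Gc \<Longrightarrow> u \<in> carrier Gc \<Longrightarrow> vdiff Gc s u \<in> carrier Gc"
  unfolding vdiff_def by (intro Gc_add Gc_scale)

lemma lift_vdiff: "s \<in> carrier Gc \<Longrightarrow> u \<in> carrier Gc \<Longrightarrow> lift (vdiff Gc s u) = lift s - lift u"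
  unfolding vdiff_def by (simp add: lift_add Gc_scale lift_scale)

lemma pb_vdiff:
  assumes s: "s \<in> carrier Gc" and u: "u \<in> carrier Gc"
  shows "pb (vdiff Gc s u) = vdiff proj_unitary_lie (pb s) (pb u)"
proof -
  have "pb (vdiff Gc s u) = coset (lift (vdiff Gc s u))" using coset_lift[OF vdiff_closed[OF s u]] by simp
  also have "\<dots> = vdiff proj_unitary_lie (coset (lift s)) (coset (lift u))"
    by (simp only: lift_vdiff[OF s u] proj_vdiff)
  finally show ?thesis by (simp only: coset_lift[OF s] coset_lift[OF u])
qed

section \<open>Continuity for the direct limit topology\<close>

lemma topspace_seminorm_topology: "topspace (seminorm_topology L P) = carrier L"
proof
  show "topspace (seminorm_topology L P) \<subseteq> carrier L"
    using openin_topspace[of "seminorm_topology L P"] unfolding openin_seminorm_topology by blast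
  have "openin (seminorm_topology L P) (carrier L)"
    unfolding openin_seminorm_topology by (auto intro!: exI[of _ "{}"] exI[of _ 1])
  then show "carrier L \<subseteq> topspace (seminorm_topology L P)" by (rule openin_subset)
qed

abbreviation "CT \<equiv> compact_sections_topology X B b0 atlas K trivs"

abbreviation "GCT C \<equiv> subtopology (sections_topology X B b0 atlas K trivs)
   {s \<in> carrier GG. section_support X K s \<subseteq> C}"

definition CTgen :: "('x \<Rightarrow> 'v) set set" where
  "CTgen = {U. \<exists>T. locally_convex_topology_on Gc T \<and> (\<forall>C. compactin X C \<longrightarrow> continuous_map (GCT C) T id) \<and> openin T U}"

lemma CT_eq: "CT = topology_generated_by CTgen"
proof -
  have "(\<forall>S\<in>{GCT C |C. compactin X C}. continuous_map S T id) \<longleftrightarrow> (\<forall>C. compactin X C \<longrightarrow> continuous_map (GCT C) T id)" for T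
    by blast
  then show ?thesis unfolding compact_sections_topology_def locally_convex_direct_limit_def CTgen_def by simp
qed

lemma topspace_GT:
  assumes C: "compactin X C"
  shows "topspace (GCT C) = Gam C"
proof -
  have "s \<in> carrier GG \<and> section_support X K s \<subseteq> C \<longleftrightarrow> s \<in> Gam C" for s
  proof
    assume a: "s \<in> carrier GG \<and> section_support X K s \<subseteq> C"
    then have "compactin X (section_support X K s)"
      using closed_compactin[OF C] by (auto simp: section_support_def)
    then have "s \<in> carrier Gc" using a carrier_Gc_GG by blast
    then show "s \<in> Gam C" using a support_subset_iff[OF C] carrier_GG by (auto simp: Gam_def)
  next
    assume a: "s \<in> Gam C"
    then have "s \<in> carrier GG" using carrier_Gc_GG by (auto simp: Gam_def)
    then show "s \<in> carrier GG \<and> section_support X K s \<subseteq> C"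
      using a support_subset_iff[OF C] carrier_GG by (auto simp: Gam_def)
  qed
  then show ?thesis
    by (auto simp: sections_topology_def topspace_seminorm_topology)
qed

text \<open>The empty family of seminorms gives the indiscrete topology, which is locally convex;
  through it the generated topology has the whole algebra as its space.\<close>

lemma carrier_CTgen: "carrier Gc \<in> CTgen"
proof -
  define T where "T = seminorm_topology Gc {}"
  have op: "openin T U \<longleftrightarrow> U = {} \<or> U = carrier Gc" for U
    unfolding T_def openin_seminorm_topology by (auto intro!: exI[of _ 1])
  have "locally_convex_topology_on Gc T" unfolding locally_convex_topology_on_def T_def by auto
  moreover have "continuous_map (GCT C) T id" if "compactin X C" for C
  proof -
    have "Gam C \<subseteq> carrier Gc" by (auto simp: Gam_def)
    moreover have "openin (GCT C) {x \<in> Gam C. id x \<in> U}" if "openin T U" for U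
    proof -
      have "{x \<in> Gam C. id x \<in> U} = {} \<or> {x \<in> Gam C. id x \<in> U} = topspace (GCT C)"
        using that op topspace_GT[OF \<open>compactin X C\<close>] \<open>Gam C \<subseteq> carrier Gc\<close> by auto
      then show ?thesis by (elim disjE) (simp_all only: openin_empty openin_topspace)
    qed
    ultimately show ?thesis
      unfolding continuous_map_def topspace_GT[OF that] T_def topspace_seminorm_topology by (auto simp: T_def)
  qed
  moreover have "openin T (carrier Gc)" using op by blast
  ultimately show ?thesis unfolding CTgen_def by blast
qed

lemma CTgen_subset:
  assumes "U \<in> CTgen"
  shows "U \<subseteq> carrier Gc"
proof -
  obtain T where "locally_convex_topology_on Gc T" "openin T U" using assms unfolding CTgen_def by blast
  then have "topspace T = carrier Gc" "U \<subseteq> topspace T"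
    by (auto simp: locally_convex_topology_on_def topspace_seminorm_topology openin_subset)
  then show ?thesis by simp
qed

lemma topspace_CT: "topspace CT = carrier Gc"
  unfolding CT_eq topology_generated_by_topspace using carrier_CTgen CTgen_subset by blast

lemma inclusion_continuous:
  assumes C: "compactin X C"
  shows "continuous_map (GCT C) CT id"
  unfolding CT_eq
proof (rule continuous_on_generated_topo)
  fix U assume "U \<in> CTgen"
  then obtain T where T: "continuous_map (GCT C) T id" "openin T U" using C unfolding CTgen_def by blast
  have "openin (GCT C) {x \<in> topspace (GCT C). id x \<in> U}" by (rule openin_continuous_map_preimage[OF T])
  moreover have "{x \<in> topspace (GCT C). id x \<in> U} = id -` U \<inter> topspace (GCT C)" by auto
  ultimately show "openin (GCT C) (id -` U \<inter> topspace (GCT C))" by simp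
next
  show "id ` topspace (GCT C) \<subseteq> \<Union> CTgen"
    unfolding topspace_GT[OF C] using carrier_CTgen by (auto simp: Gam_def)
qed

text \<open>The seminorm \<open>norm (lift z)\<close> defines a locally convex topology. By
  \<open>lift_bound\<close> and the continuity of \<open>pb\<close> every inclusion is continuous
  into it, so it is one of the topologies whose supremum is the direct limit topology.\<close>

lemma continuous_lift:
  assumes cont: "continuous_map CT proj_unitary_topology pb"
  shows "continuous_map CT unitary_topology lift"
proof -
  define n where "n z = norm (lift z)" for z
  define T where "T = seminorm_topology Gc {n}"
  have "seminorm_on Gc n"
    by (auto simp: seminorm_on_def n_def lift_add lift_scale norm_triangle_ineq)
  then have lc: "locally_convex_topology_on Gc T" unfolding locally_convex_topology_on_def T_def by blast
  have incl: "continuous_map (GCT C) T id" if C: "compactin X C" for C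
  proof -
    obtain M where M: "0 \<le> M" "\<And>z. z \<in> Gam C \<Longrightarrow> n z \<le> M * quotient_norm (pb z)"
      using lift_bound[OF C] unfolding n_def by blast
    have GC: "Gam C \<subseteq> carrier Gc" by (auto simp: Gam_def)
    have "openin (GCT C) {x \<in> Gam C. x \<in> U}" if U: "openin T U" for U
      unfolding openin_subopen[of _ "{x \<in> Gam C. x \<in> U}"]
    proof
      fix s assume "s \<in> {x \<in> Gam C. x \<in> U}"
      then have s: "s \<in> Gam C" "s \<in> U" "s \<in> carrier Gc" using GC by auto
      obtain F e where F: "F \<subseteq> {n}" "0 < e" "{y \<in> carrier Gc. \<forall>p\<in>F. p (vdiff Gc y s) < e} \<subseteq> U"
        using U s(2) unfolding T_def openin_seminorm_topology by blast
      have U': "y \<in> U" if "y \<in> carrier Gc" "n (vdiff Gc y s) < e" for y using that F(1,3) by auto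
      \<comment> \<open>\<open>M + 1\<close> keeps the division legitimate when the bound
        \<open>M\<close> is zero, and it makes \<open>M * d\<close> strictly smaller than
        \<open>e\<close>.\<close>
      define d where "d = e / (M + 1)"
      have d: "0 < d" "M * d < e"
      proof -
        show "0 < d" using F(2) M(1) by (simp add: d_def)
        then have "M * d < (M + 1) * d" by (simp add: distrib_right)
        also have "\<dots> = e" using M(1) by (simp add: d_def)
        finally show "M * d < e" .
      qed
      define Bl where "Bl = {P \<in> carrier proj_unitary_lie. quotient_norm (vdiff proj_unitary_lie P (pb s)) < d}"
      have "openin proj_unitary_topology Bl"
        unfolding Bl_def rep(2)[OF s(3), symmetric] by (rule openin_proj_ball[OF rep(1)[OF s(3)]])
      from openin_continuous_map_preimage[OF cont this]
      have "openin CT {y \<in> carrier Gc. pb y \<in> Bl}" unfolding topspace_CT .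
      from openin_continuous_map_preimage[OF inclusion_continuous[OF C] this]
      moreover have "{x \<in> topspace (GCT C). id x \<in> {y \<in> carrier Gc. pb y \<in> Bl}} = {y \<in> Gam C. pb y \<in> Bl}"
        using GC unfolding topspace_GT[OF C] by auto
      ultimately have op: "openin (GCT C) {y \<in> Gam C. pb y \<in> Bl}" by (simp only:)
      have "{y \<in> Gam C. pb y \<in> Bl} \<subseteq> {x \<in> Gam C. x \<in> U}"
      proof safe
        fix y assume y: "y \<in> Gam C" "pb y \<in> Bl"
        then have yG: "y \<in> carrier Gc" using GC by blast
        have "vdiff Gc y s \<in> Gam C"
          unfolding vdiff_def using Gam_ops(1)[OF C y(1) Gam_ops(2)[OF C s(1) s(1)]] .
        then have "n (vdiff Gc y s) \<le> M * quotient_norm (vdiff proj_unitary_lie (pb y) (pb s))"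
          unfolding pb_vdiff[OF yG s(3), symmetric] by (rule M(2))
        also have "\<dots> \<le> M * d" using y(2) M(1) by (intro mult_left_mono) (auto simp: Bl_def)
        also have "\<dots> < e" by (rule d(2))
        finally show "y \<in> U" using U' yG by blast
      qed
      moreover have "s \<in> {y \<in> Gam C. pb y \<in> Bl}"
      proof -
        have "quotient_norm (coset (0 :: 'h \<Rightarrow>\<^sub>L 'h)) \<le> norm (0 :: 'h \<Rightarrow>\<^sub>L 'h)"
          using quotient_norm_le[of 0 "0 :: 'h \<Rightarrow>\<^sub>L 'h"] by simp
        moreover have "vdiff proj_unitary_lie (pb s) (pb s) = coset 0"
          using proj_vdiff[of "rep s" "rep s"] rep(2)[OF s(3)] by simp
        moreover have "pb s \<in> carrier proj_unitary_lie" using rep[OF s(3)] by (auto simp: proj_carrier)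
        ultimately show ?thesis using s(1) d(1) by (simp add: Bl_def)
      qed
      ultimately show "\<exists>T. openin (GCT C) T \<and> s \<in> T \<and> T \<subseteq> {x \<in> Gam C. x \<in> U}" using op by blast
    qed
    then show ?thesis
      unfolding continuous_map_def topspace_GT[OF C] using GC by (auto simp: T_def topspace_seminorm_topology)
  qed
  have "openin CT {s \<in> carrier Gc. lift s \<in> U}" if U: "openin unitary_topology U" for U
  proof -
    have "openin T {s \<in> carrier Gc. lift s \<in> U}"
      unfolding T_def openin_seminorm_topology
    proof (intro conjI ballI)
      fix s assume "s \<in> {s \<in> carrier Gc. lift s \<in> U}"
      then have s: "s \<in> carrier Gc" "lift s \<in> U" by auto
      obtain F e where F: "F \<subseteq> {norm}" "0 < e" "{A \<in> skew. \<forall>p\<in>F. p (vdiff unitary_lie A (lift s)) < e} \<subseteq> U"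
        using U s(2) unfolding unitary_topology_def openin_seminorm_topology by blast
      have "{y \<in> carrier Gc. \<forall>p\<in>{n}. p (vdiff Gc y s) < e} \<subseteq> {s \<in> carrier Gc. lift s \<in> U}"
      proof safe
        fix y assume y: "y \<in> carrier Gc" "\<forall>p\<in>{n}. p (vdiff Gc y s) < e"
        then have "norm (lift y - lift s) < e" by (simp add: n_def lift_vdiff s(1))
        then have "norm (vdiff unitary_lie (lift y) (lift s)) < e" by (simp add: vdiff_def)
        then show "lift y \<in> U" using F(1,3) lift_skew[OF y(1)] by auto
      qed
      then show "\<exists>F e. finite F \<and> F \<subseteq> {n} \<and> 0 < e \<and>
          {y \<in> carrier Gc. \<forall>p\<in>F. p (vdiff Gc y s) < e} \<subseteq> {s \<in> carrier Gc. lift s \<in> U}"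
        using F(2) by (intro exI[of _ "{n}"] exI[of _ e]) simp
    qed auto
    then have "{s \<in> carrier Gc. lift s \<in> U} \<in> CTgen" using lc incl unfolding CTgen_def by blast
    then show ?thesis unfolding CT_eq by (rule topology_generated_by_Basis)
  qed
  moreover have "lift \<in> carrier Gc \<rightarrow> topspace unitary_topology"
    using lift_skew by (simp add: unitary_topology_def topspace_seminorm_topology)
  ultimately show ?thesis unfolding continuous_map_def topspace_CT by blast
qed

end

theorem theorem5p4:
  fixes X :: "'x topology"
    and B :: "'m::euclidean_space set" and b0 :: 'm
    and atlas :: "('x set \<times> ('x \<Rightarrow> 'm)) set"
    and K :: "'x \<Rightarrow> 'v lie_alg"
    and \<kk> :: "'k::euclidean_space set" and br :: "'k \<Rightarrow> 'k \<Rightarrow> 'k"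
    and trivs :: "('x set \<times> ('x \<Rightarrow> 'v \<Rightarrow> 'k)) set"
    and pi_bar :: "('x \<Rightarrow> 'v) \<Rightarrow> ('h::complex_hilbert_space \<Rightarrow>\<^sub>L 'h) set"
  assumes "sigma_compact_space X"
    and "lie_algebra_bundle X B b0 atlas K \<kk> br trivs"
    and "compactin X (manifold_boundary B b0 atlas)"
    and "compact_lie_algebra \<kk> br"
    and "continuous_lie_hom
           (compact_sections X B b0 atlas K trivs) (compact_sections_topology X B b0 atlas K trivs)
           proj_unitary_lie proj_unitary_topology pi_bar"
  shows "\<exists>\<pi> :: ('x \<Rightarrow> 'v) \<Rightarrow> ('h \<Rightarrow>\<^sub>L 'h).
           continuous_lie_hom
             (compact_sections X B b0 atlas K trivs) (compact_sections_topology X B b0 atlas K trivs)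
             unitary_lie unitary_topology \<pi> \<and>
           (\<forall>s\<in>carrier (compact_sections X B b0 atlas K trivs).
              proj_unitary_quotient_map (\<pi> s) = pi_bar s)"
proof -
  obtain N where N: "compact_lie \<kk> br N"
    using assms(4) unfolding compact_lie_algebra_def compact_lie_def by blast
  then interpret k: compact_lie \<kk> br N .
  interpret b: compact_bundle X B b0 atlas K \<kk> br trivs N
    by (intro compact_bundle.intro assms(2) N)
  \<comment> \<open>The Casimir pairs are indexed by the orthonormal basis vectors themselves, which
    fixes the index type.\<close>
  obtain I :: "'k set" and p q where cas: "k.casimir I p q" using k.casimir_exists by blast
  have hom: "lie_hom (compact_sections X B b0 atlas K trivs) proj_unitary_lie pi_bar"
    and cont: "continuous_map (compact_sections_topology X B b0 atlas K trivs) proj_unitary_topology pi_bar"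
    using assms(5) by (auto simp: continuous_lie_hom_def)
  interpret r: bundle_rep X B b0 atlas K \<kk> br trivs N pi_bar I p q
  proof
    show "lie_hom (compact_sections X B b0 atlas K trivs) proj_unitary_lie pi_bar" by (rule hom)
    show "k.casimir I p q" by (rule cas)
  qed (fact b.Gc_zero b.Gc_add b.Gc_scale b.Gc_br b.Gc_scale_zero)+
  show ?thesis
    using r.lie_hom_lift r.continuous_lift[OF cont] r.coset_lift
    by (intro exI[of _ r.lift]) (simp add: continuous_lie_hom_def)
qed

end
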